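(* Let $N\ge1$, let $a_1<a_2<\dots<a_{2N}$ be real, $I=[a_1,a_2]\cup\dots\cup[a_{2N-1},a_{2N}]$, and $\tau\in\mathbb R$. Let $\widetilde K$ be the integral operator on $L^2(\gamma_L\cup\gamma_R\cup i\mathbb R)$ with kernel $$\widetilde K(\lambda,\mu)=\frac{\vec f^{T}(\lambda)\,\vec g(\mu)}{\lambda-\mu},$$ where, with $\Theta_0(\lambda)=\frac{\lambda^4}4-\frac\tau2\lambda^2$, $\vec f,\vec g$ are the $\mathbb C^{2N+1}$-valued functions $$\vec f(\lambda)=\frac1{2\pi i}\Big(\big[e^{\frac12\Theta_0(\lambda)},0,\dots,0\big]^T\chi_{\gamma_L\cup\gamma_R}(\lambda)+\big[0,e^{-\frac12\Theta_0(\lambda)+a_1\lambda},\dots,e^{-\frac12\Theta_0(\lambda)+a_{2N}\lambda}\big]^T\chi_{i\mathbb R}(\lambda)\Big),$$ $$\vec g(\lambda)=\big[0,e^{\frac12\Theta_0(\lambda)-a_1\lambda},-e^{\frac12\Theta_0(\lambda)-a_2\lambda},\dots,(-1)^{2N+1}e^{\frac12\Theta_0(\lambda)-a_{2N}\lambda}\big]^T\chi_{\gamma_L\cup\gamma_R}(\lambda)+\big[e^{-\frac12\Theta_0(\lambda)},0,\dots,0\big]^T\chi_{i\mathbb R}(\lambda).$$ Then $\widetilde K$ is of trace class on $L^2(\gamma_L\cup\gamma_R\cup i\mathbb R)$ and $$\det(\mathrm{Id}-\widetilde K)=\det(\mathrm{Id}-K_P\chi_I),$$ where $K_P$ is the Pearcey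 kernel with parameter $\tau$.
   Context: Contours: $i\mathbb R$ is oriented upwards; $\gamma_R$ is a smooth curve in the open right half-plane, at positive distance from $i\mathbb R$, going from $e^{i\pi/4}\infty$ to $e^{-i\pi/4}\infty$; $\gamma_L=-\gamma_R$ is its image under $\mu\mapsto-\mu$ with the induced orientation (from $e^{5i\pi/4}\infty$ to $e^{3i\pi/4}\infty$). Integral operators act by $(\widetilde Kh)(\lambda)=\int\widetilde K(\lambda,\mu)h(\mu)\,d\mu$ over $\gamma_L\cup\gamma_R\cup i\mathbb R$ (complex line element, with $i\mathbb R$ oriented upwards, $\gamma_R$ oriented from $e^{i\pi/4}\infty$ to $e^{-i\pi/4}\infty$ and $\gamma_L$ oriented from $e^{5i\pi/4}\infty$ to $e^{3i\pi/4}\infty$). $\chi_A$ is the characteristic function of $A$. Pearcey kernel: $$K_P(x,y;\tau)=\frac1{(2\pi i)^2}\int_{\gamma_L\cup\gamma_R}d\mu\int_{i\mathbb R}d\lambda\,\frac{e^{\Theta_x(\mu)-\Theta_y(\lambda)}}{\lambda-\mu},\qquad \Theta_x(\mu)=\frac{\mu^4}{4}-\frac{\tau}{2}\mu^2-x\mu .$$ $\det(\mathrm{Id}-K_P\chi_I)$ is the Fredholm determinant of the Pearcey kernel operator restricted to $I$ (i.e. acting on $L^2(I)$).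
   Formalization: The curve γ_R is also assumed to be simple and regular, with its unit tangent (not only its position) tending to the prescribed directions at both ends; without control of arc length at infinity the operator need not act on L². *)

theory Defs
  imports "HOL-Analysis.Analysis"
begin

section \<open>Operators on L2 spaces\<close>

text \<open>Elements of the Hilbert space L2(M) are represented by square-integrable functions;
  operators act on such representatives, and identities between elements hold almost everywhere.\<close>

definition l2_space :: "'a measure \<Rightarrow> ('a \<Rightarrow> complex) set" where
  "l2_space M = {h \<in> borel_measurable M. integrable M (\<lambda>x. (norm (h x))\<^sup>2)}"

definition l2_inner :: "'a measure \<Rightarrow> ('a \<Rightarrow> complex) \<Rightarrow> ('a \<Rightarrow> complex) \<Rightarrow> complex" where
  "l2_inner M f g = (\<integral>x. f x * cnj (g x) \<partial>M)"

definition l2_norm :: "'a measure \<Rightarrow> ('a \<Rightarrow> complex) \<Rightarrow> real" where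
  "l2_norm M f = sqrt (\<integral>x. (norm (f x))\<^sup>2 \<partial>M)"

definition l2_bounded_operator ::
  "'a measure \<Rightarrow> (('a \<Rightarrow> complex) \<Rightarrow> 'a \<Rightarrow> complex) \<Rightarrow> bool" where
  "l2_bounded_operator M T \<longleftrightarrow>
     (\<forall>h\<in>l2_space M. T h \<in> l2_space M) \<and>
     (\<forall>h\<in>l2_space M. \<forall>k\<in>l2_space M. \<forall>c d.
        AE x in M. T (\<lambda>y. c * h y + d * k y) x = c * T h x + d * T k x) \<and>
     (\<exists>C. \<forall>h\<in>l2_space M. l2_norm M (T h) \<le> C * l2_norm M h)"

definition orthonormal_seq :: "'a measure \<Rightarrow> (nat \<Rightarrow> 'a \<Rightarrow> complex) \<Rightarrow> bool" where
  "orthonormal_seq M e \<longleftrightarrow>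
     (\<forall>n. e n \<in> l2_space M) \<and>
     (\<forall>m n. l2_inner M (e m) (e n) = (if m = n then 1 else 0))"

text \<open>Bases are indexed by the natural numbers: the L2 spaces considered here are separable and
  infinite-dimensional.\<close>

definition orthonormal_basis :: "'a measure \<Rightarrow> (nat \<Rightarrow> 'a \<Rightarrow> complex) \<Rightarrow> bool" where
  "orthonormal_basis M e \<longleftrightarrow>
     orthonormal_seq M e \<and>
     (\<forall>h\<in>l2_space M. (\<forall>n. l2_inner M h (e n) = 0) \<longrightarrow> (AE x in M. h x = 0))"

text \<open>The supremum of the sums below over all pairs of orthonormal sequences is the trace norm
  of \<open>T\<close>.\<close>

definition trace_class ::
  "'a measure \<Rightarrow> (('a \<Rightarrow> complex) \<Rightarrow> 'a \<Rightarrow> complex) \<Rightarrow> bool" where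
  "trace_class M T \<longleftrightarrow>
     l2_bounded_operator M T \<and>
     (\<forall>e f. orthonormal_seq M e \<longrightarrow> orthonormal_seq M f \<longrightarrow>
        summable (\<lambda>n. norm (l2_inner M (T (e n)) (f n))))"

text \<open>Leibniz formula for the determinant of a matrix whose rows and columns are indexed by a
  finite set \<open>S\<close>.\<close>

definition set_det :: "'i set \<Rightarrow> ('i \<Rightarrow> 'i \<Rightarrow> complex) \<Rightarrow> complex" where
  "set_det S A = (\<Sum>p | p permutes S. of_int (sign p) * (\<Prod>i\<in>S. A i (p i)))"

text \<open>The trace of the \<open>k\<close>-th exterior power of \<open>T\<close>. An orthonormal basis \<open>e\<close> of the space induces
  the orthonormal basis of its \<open>k\<close>-th exterior power consisting of the wedge products of
  \<open>e i\<close> (\<open>i \<in> S\<close>), with \<open>S\<close> ranging over the \<open>k\<close>-element sets of indices, and the corresponding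
  diagonal entry of the exterior power of \<open>T\<close> is a principal minor. For trace class operators the
  sum converges absolutely and does not depend on the basis.\<close>

definition exterior_trace ::
  "'a measure \<Rightarrow> (('a \<Rightarrow> complex) \<Rightarrow> 'a \<Rightarrow> complex) \<Rightarrow> nat \<Rightarrow> complex" where
  "exterior_trace M T k = (THE t. \<forall>e. orthonormal_basis M e \<longrightarrow>
     ((\<lambda>S. set_det S (\<lambda>i j. l2_inner M (T (e j)) (e i))) has_sum t) {S. finite S \<and> card S = k})"

text \<open>The Fredholm determinant of the identity minus \<open>T\<close>.\<close>

definition fredholm_det :: "'a measure \<Rightarrow> (('a \<Rightarrow> complex) \<Rightarrow> 'a \<Rightarrow> complex) \<Rightarrow> complex" where
  "fredholm_det M T = (\<Sum>k. (-1) ^ k * exterior_trace M T k)"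


section \<open>Unbounded oriented contours\<close>

text \<open>A contour is a list of parametrized curves, each defined on the whole real line and oriented
  by its parametrization.\<close>

definition curve_measure :: "(real \<Rightarrow> complex) \<Rightarrow> complex measure" where
  "curve_measure c =
     distr (density lborel (\<lambda>t. ennreal (norm (vector_derivative c (at t))))) borel c"

text \<open>Arc length on a contour; all its curves will be simple and pairwise disjoint.\<close>

definition arc_length :: "(real \<Rightarrow> complex) list \<Rightarrow> complex measure" where
  "arc_length cs = measure_of UNIV (sets borel) (\<lambda>A. \<Sum>c\<leftarrow>cs. emeasure (curve_measure c) A)"

lemma sets_arc_length [simp]: "sets (arc_length cs) = sets borel"
  by (simp add: arc_length_def sigma_algebra.sets_measure_of_eq[OF sets.sigma_algebra_axioms[of borel, simplified]])

lemma emeasure_arc_length: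
  assumes "A \<in> sets borel"
  shows "emeasure (arc_length cs) A = (\<Sum>c\<leftarrow>cs. emeasure (curve_measure c) A)"
proof (rule emeasure_measure_of[OF arc_length_def])
  show "positive (sets (arc_length cs)) (\<lambda>A. \<Sum>c\<leftarrow>cs. emeasure (curve_measure c) A)"
    by (induction cs) (auto simp: positive_def)
  show "countably_additive (sets (arc_length cs)) (\<lambda>A. \<Sum>c\<leftarrow>cs. emeasure (curve_measure c) A)"
    unfolding countably_additive_def
  proof (intro allI impI)
    fix B :: "nat \<Rightarrow> complex set"
    assume "range B \<subseteq> sets (arc_length cs)" and dis: "disjoint_family B"
    then have B: "range B \<subseteq> sets borel" by simp
    show "(\<Sum>i. \<Sum>c\<leftarrow>cs. emeasure (curve_measure c) (B i)) =
          (\<Sum>c\<leftarrow>cs. emeasure (curve_measure c) (\<Union> (range B)))"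
    proof (induction cs)
      case (Cons c cs)
      have "(\<Sum>i. emeasure (curve_measure c) (B i)) = emeasure (curve_measure c) (\<Union> (range B))"
        by (rule suminf_emeasure) (use B dis in \<open>auto simp: curve_measure_def\<close>)
      with Cons show ?case by (simp add: suminf_add[symmetric])
    qed simp
  qed
qed (use assms in auto)

text \<open>Integration with respect to the complex line element.\<close>

definition line_integral :: "(real \<Rightarrow> complex) list \<Rightarrow> (complex \<Rightarrow> complex) \<Rightarrow> complex" where
  "line_integral cs F =
     (\<Sum>c\<leftarrow>cs. \<integral>t. F (c t) * vector_derivative c (at t) \<partial>lborel)"

definition curve_support :: "(real \<Rightarrow> complex) list \<Rightarrow> complex set" where
  "curve_support cs = (\<Union>c\<in>set cs. range c)"

definition smooth_curve :: "(real \<Rightarrow> complex) \<Rightarrow> bool" where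
  "smooth_curve c \<longleftrightarrow>
     (\<forall>k t. ((\<lambda>f s. vector_derivative f (at s)) ^^ k) c differentiable (at t)) \<and>
     (\<forall>t. vector_derivative c (at t) \<noteq> 0) \<and> inj c"

text \<open>The curves in the right half-plane coming from infinity in the direction \<open>cis (pi / 4)\<close> and
  going to infinity in the direction \<open>cis (- pi / 4)\<close>. As for the behaviour at infinity,
  both the position and the tangent have the prescribed limiting direction; without control of
  the tangent, the arc length of an oscillating curve could outgrow the decay of the kernels.\<close>

definition right_contour :: "(real \<Rightarrow> complex) \<Rightarrow> bool" where
  "right_contour \<gamma> \<longleftrightarrow>
     smooth_curve \<gamma> \<and>
     (\<exists>\<delta>>0. \<forall>t. \<delta> \<le> Re (\<gamma> t)) \<and>
     filterlim (\<lambda>t. norm (\<gamma> t)) at_top at_bot \<and>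
     filterlim (\<lambda>t. norm (\<gamma> t)) at_top at_top \<and>
     ((\<lambda>t. sgn (\<gamma> t)) \<longlongrightarrow> cis (pi / 4)) at_bot \<and>
     ((\<lambda>t. sgn (\<gamma> t)) \<longlongrightarrow> cis (- pi / 4)) at_top \<and>
     ((\<lambda>t. sgn (vector_derivative \<gamma> (at t))) \<longlongrightarrow> - cis (pi / 4)) at_bot \<and>
     ((\<lambda>t. sgn (vector_derivative \<gamma> (at t))) \<longlongrightarrow> cis (- pi / 4)) at_top"

definition imaginary_axis :: "real \<Rightarrow> complex" where
  "imaginary_axis t = \<i> * of_real t"

definition left_right :: "(real \<Rightarrow> complex) \<Rightarrow> (real \<Rightarrow> complex) list" where
  "left_right \<gamma> = [\<lambda>t. - \<gamma> t, \<gamma>]"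

definition full_contour :: "(real \<Rightarrow> complex) \<Rightarrow> (real \<Rightarrow> complex) list" where
  "full_contour \<gamma> = left_right \<gamma> @ [imaginary_axis]"


section \<open>The Pearcey kernel and the integrable kernel\<close>

definition Theta :: "real \<Rightarrow> real \<Rightarrow> complex \<Rightarrow> complex" where
  "Theta \<tau> x \<mu> = \<mu> ^ 4 / 4 - of_real \<tau> / 2 * \<mu>\<^sup>2 - of_real x * \<mu>"

definition pearcey_kernel :: "real \<Rightarrow> (real \<Rightarrow> complex) \<Rightarrow> real \<Rightarrow> real \<Rightarrow> complex" where
  "pearcey_kernel \<tau> \<gamma> x y =
     1 / (2 * of_real pi * \<i>)\<^sup>2 *
     line_integral (left_right \<gamma>) (\<lambda>\<mu>. line_integral [imaginary_axis]
       (\<lambda>l. exp (Theta \<tau> x \<mu> - Theta \<tau> y l) / (l - \<mu>)))"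

definition interval_union :: "nat \<Rightarrow> (nat \<Rightarrow> real) \<Rightarrow> real set" where
  "interval_union N a = (\<Union>k\<in>{1..N}. {a (2 * k - 1)..a (2 * k)})"

definition pearcey_operator ::
  "real \<Rightarrow> (real \<Rightarrow> complex) \<Rightarrow> real set \<Rightarrow> (real \<Rightarrow> complex) \<Rightarrow> real \<Rightarrow> complex" where
  "pearcey_operator \<tau> \<gamma> I h x =
     (\<integral>y. pearcey_kernel \<tau> \<gamma> x y * h y \<partial>restrict_space lborel I)"

text \<open>Components \<open>0, \<dots>, 2N\<close> of the vector functions; the endpoints are \<open>a 1, \<dots>, a (2N)\<close>.\<close>

definition f_vec ::
  "(nat \<Rightarrow> real) \<Rightarrow> real \<Rightarrow> (real \<Rightarrow> complex) \<Rightarrow> complex \<Rightarrow> nat \<Rightarrow> complex" where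
  "f_vec a \<tau> \<gamma> l j = 1 / (2 * of_real pi * \<i>) *
     ((if j = 0 then exp (Theta \<tau> 0 l / 2) else 0) * indicator (curve_support (left_right \<gamma>)) l +
      (if j = 0 then 0 else exp (- Theta \<tau> 0 l / 2 + of_real (a j) * l)) *
        indicator (range imaginary_axis) l)"

definition g_vec ::
  "(nat \<Rightarrow> real) \<Rightarrow> real \<Rightarrow> (real \<Rightarrow> complex) \<Rightarrow> complex \<Rightarrow> nat \<Rightarrow> complex" where
  "g_vec a \<tau> \<gamma> l j =
     (if j = 0 then 0 else (-1) ^ (j + 1) * exp (Theta \<tau> 0 l / 2 - of_real (a j) * l)) *
        indicator (curve_support (left_right \<gamma>)) l +
     (if j = 0 then exp (- Theta \<tau> 0 l / 2) else 0) * indicator (range imaginary_axis) l"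

text \<open>On the diagonal this takes the value 0, by division by zero. This agrees with the continuous
  extension along the contour: the numerator vanishes whenever both arguments lie on the left and
  right curves, or both on the imaginary axis.\<close>

definition tilde_kernel ::
  "nat \<Rightarrow> (nat \<Rightarrow> real) \<Rightarrow> real \<Rightarrow> (real \<Rightarrow> complex) \<Rightarrow> complex \<Rightarrow> complex \<Rightarrow> complex" where
  "tilde_kernel N a \<tau> \<gamma> l \<mu> = (\<Sum>j\<le>2 * N. f_vec a \<tau> \<gamma> l j * g_vec a \<tau> \<gamma> \<mu> j) / (l - \<mu>)"

definition tilde_operator ::
  "nat \<Rightarrow> (nat \<Rightarrow> real) \<Rightarrow> real \<Rightarrow> (real \<Rightarrow> complex) \<Rightarrow> (complex \<Rightarrow> complex) \<Rightarrow> complex \<Rightarrow> complex"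
  where
  "tilde_operator N a \<tau> \<gamma> h l =
     line_integral (full_contour \<gamma>) (\<lambda>\<mu>. tilde_kernel N a \<tau> \<gamma> l \<mu> * h \<mu>)"

end

theory Submission
  imports Defs
begin

text \<open>
  With respect to the splitting of the contour into the curves and the imaginary axis,
  \<open>tilde_operator\<close> is an off-diagonal block operator. Writing
  \<open>1 / (z - \<mu>)\<close> as a Laplace integral over an auxiliary real line in one block, and
  \<open>(exp (u * w) - exp (v * w)) / w\<close> as an integral over \<open>[u, v]\<close> in the other one, factors the
  operator as \<open>P1 Q1 + p b\<close> with square integrable kernels \<open>P1, Q1\<close> through \<open>L2(\<real>)\<close> and \<open>p, b\<close>
  through \<open>L2(I)\<close>, and \<open>b P1 Q1 p\<close> is the Pearcey operator on \<open>I\<close>. The disjoint supports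
  give \<open>Q1 P1 = 0\<close> and \<open>b p = 0\<close>.

  In orthonormal bases all factors become Hilbert--Schmidt matrices, and the exterior traces can be
  compared by manipulating absolutely convergent sums: those of \<open>A B\<close> and \<open>B A\<close> agree, and the
  one of an off-diagonal matrix in degree \<open>2 m\<close> is \<open>(-1) ^ m\<close> times the one in degree \<open>m\<close> of the
  product of its two blocks. No convergence of the Fredholm series itself is needed.
\<close>

section \<open>Determinants indexed by finite sets\<close>

text \<open>\<open>exterior_trace\<close> is a definite description quantified over all orthonormal
  bases: existence of the sums and their independence of the basis must be proved before two traces
  can be compared. Both fall out of one comparison. A sum in a basis of the contour space and one in
  a basis of L2(I) determine each other, up to sign and vanishing odd degrees, so either basis may
  vary while the other is kept fixed. The description also fails unless some basis indexed by the
  natural numbers exists, which is why separability and infinite dimension are established.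

  Each block is Hilbert--Schmidt as it stands, because z - \<mu> is bounded away from 0; trace class
  asks for a product of two Hilbert--Schmidt factors, and the auxiliary integrations provide it.
  Every factor has a pointwise majorant |\<alpha>(x)| |\<beta>(y)| with square integrable \<alpha>,
  \<beta>. This one estimate gives Fubini, square integrable sections at every point, and the bound
  on matrix coefficients. Line element and arc length differ by the unit tangent, which is absorbed
  into Q1 and b.\<close>

lemma set_det_cong:
  assumes "\<And>i j. i \<in> S \<Longrightarrow> j \<in> S \<Longrightarrow> A i j = B i j"
  shows "set_det S A = set_det S B"
  unfolding set_det_def
  by (intro sum.cong refl arg_cong2[of _ _ _ _ "(*)"] prod.cong assms)
    (auto simp: permutes_in_image)

text \<open>Conjugation by f carries the permutations of S' to those of S and keeps signs and
  Leibniz terms. The two sets may live in different types, which later lets tuples and disjoint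
  unions serve as index sets.\<close>

lemma set_det_reindex:
  assumes f: "bij_betw f S' S" and fin: "finite S'"
  shows "set_det S A = set_det S' (\<lambda>i j. A (f i) (f j))"
proof -
  have inj: "inj_on f S'" and im: "f ` S' = S"
    using f by (auto simp: bij_betw_def)
  have bij: "bij_betw (map_permutation S' f) {p. p permutes S'} {p. p permutes S}"
  proof -
    have "map_permutation S' f = (\<lambda>\<pi> x. if x \<in> S then f (\<pi> (inv_into S' f x)) else x)"
      by (simp add: fun_eq_iff map_permutation_def restrict_id_def im)
    then show ?thesis
      using bij_betw_permutations[OF f] by simp
  qed
  have "set_det S A = (\<Sum>p | p permutes S'. of_int (sign (map_permutation S' f p)) *
      (\<Prod>i\<in>S. A i (map_permutation S' f p i)))"
    unfolding set_det_def by (rule sum.reindex_bij_betw[OF bij, symmetric])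
  also have "\<dots> = set_det S' (\<lambda>i j. A (f i) (f j))"
    unfolding set_det_def
  proof (intro sum.cong refl)
    fix p assume "p \<in> {p. p permutes S'}"
    then have p: "p permutes S'" by simp
    have "(\<Prod>i\<in>S. A i (map_permutation S' f p i)) = (\<Prod>i\<in>S'. A (f i) (map_permutation S' f p (f i)))"
      by (rule prod.reindex_bij_betw[OF f, symmetric])
    also have "\<dots> = (\<Prod>i\<in>S'. A (f i) (f (p i)))"
      by (intro prod.cong refl) (simp add: map_permutation_apply[OF inj])
    finally show "of_int (sign (map_permutation S' f p)) * (\<Prod>i\<in>S. A i (map_permutation S' f p i)) =
      of_int (sign p) * (\<Prod>i\<in>S'. A (f i) (f (p i)))"
      by (simp add: sign_map_permutation[OF inj p fin])
  qed
  finally show ?thesis .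
qed

lemma set_det_permute_columns:
  assumes q: "q permutes S" and fin: "finite S"
  shows "set_det S (\<lambda>i j. A i (q j)) = of_int (sign q) * set_det S A"
proof -
  have "set_det S A = (\<Sum>p | p permutes S. of_int (sign (q \<circ> p)) * (\<Prod>i\<in>S. A i ((q \<circ> p) i)))"
    unfolding set_det_def
    by (rule sum.reindex_bij_witness[of _ "\<lambda>p. q \<circ> p" "\<lambda>p. inv q \<circ> p"])
      (use q in \<open>auto simp: permutes_compose permutes_inv o_assoc permutes_inv_o\<close>)
  also have "\<dots> = (\<Sum>p | p permutes S. of_int (sign q) * (of_int (sign p) * (\<Prod>i\<in>S. A i (q (p i)))))"
    using q fin by (intro sum.cong refl)
      (auto simp: sign_compose permutes_imp_permutation mult.assoc)
  also have "\<dots> = of_int (sign q) * set_det S (\<lambda>i j. A i (q j))"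
    by (simp add: set_det_def sum_distrib_left)
  finally show ?thesis
    by (simp add: mult.assoc[symmetric] of_int_mult[symmetric] del: of_int_mult)
qed

lemma set_det_transpose:
  assumes fin: "finite S"
  shows "set_det S (\<lambda>i j. A j i) = set_det S A"
proof -
  have "set_det S A = (\<Sum>p | p permutes S. of_int (sign (inv p)) * (\<Prod>i\<in>S. A i (inv p i)))"
    unfolding set_det_def by (rule sum_permutations_inverse)
  also have "\<dots> = (\<Sum>p | p permutes S. of_int (sign p) * (\<Prod>i\<in>S. A (p i) i))"
  proof (intro sum.cong refl)
    fix p assume "p \<in> {p. p permutes S}"
    then have p: "p permutes S" by simp
    have "(\<Prod>i\<in>S. A i (inv p i)) = (\<Prod>i\<in>S. A (p i) (inv p (p i)))"
      using prod.permute[OF p, of "\<lambda>i. A i (inv p i)"] by (simp add: o_def)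
    then show "of_int (sign (inv p)) * (\<Prod>i\<in>S. A i (inv p i)) = of_int (sign p) * (\<Prod>i\<in>S. A (p i) i)"
      using p fin by (simp add: permutes_inverses sign_inverse permutes_imp_permutation)
  qed
  finally show ?thesis by (simp add: set_det_def)
qed

lemma set_det_permute_rows:
  assumes q: "q permutes S" and fin: "finite S"
  shows "set_det S (\<lambda>i j. A (q i) j) = of_int (sign q) * set_det S A"
  using set_det_permute_columns[OF assms, of "\<lambda>i j. A j i"]
  by (simp add: set_det_transpose[OF fin, of A]
      set_det_transpose[OF fin, of "\<lambda>i j. A (q i) j"])

lemma set_det_equal_columns:
  assumes "finite S" "a \<in> S" "b \<in> S" "a \<noteq> b" and eq: "\<And>i. i \<in> S \<Longrightarrow> A i a = A i b"
  shows "set_det S A = 0"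
proof -
  have "set_det S (\<lambda>i j. A i (Transposition.transpose a b j)) = - set_det S A"
    using set_det_permute_columns[OF permutes_swap_id, of a S b A] assms
    by (simp add: sign_swap_id)
  moreover have "set_det S (\<lambda>i j. A i (Transposition.transpose a b j)) = set_det S A"
    by (rule set_det_cong) (auto simp: Transposition.transpose_def eq)
  ultimately show ?thesis by simp
qed

section \<open>Determinants of two-by-two block matrices\<close>

lemma permutes_map_sum:
  assumes "q permutes U" "r permutes W"
  shows "map_sum q r permutes (U <+> W)"
proof (rule bij_imp_permutes)
  show "bij_betw (map_sum q r) (U <+> W) (U <+> W)"
  proof (rule bij_betwI[of _ _ _ "map_sum (inv q) (inv r)"])
    show "map_sum q r \<in> U <+> W \<rightarrow> U <+> W"
      using assms by (auto simp: permutes_in_image)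
    show "map_sum (inv q) (inv r) \<in> U <+> W \<rightarrow> U <+> W"
      using assms[THEN permutes_inv] by (auto simp: permutes_in_image)
  qed (use assms in \<open>auto simp: permutes_inverses\<close>)
  show "map_sum q r x = x" if "x \<notin> U <+> W" for x
    using that assms by (cases x) (auto dest: permutes_not_in)
qed

text \<open>\<open>map_sum q r\<close> is the composition of \<open>map_sum q id\<close> and
  \<open>map_sum id r\<close>; each of these is q or r transported along an injection, and transport
  keeps the sign.\<close>

lemma sign_map_sum:
  fixes U :: "'a set" and W :: "'b set"
  assumes "q permutes U" "r permutes W" "finite U" "finite W"
  shows "sign (map_sum q r) = sign q * sign r"
proof -
  have 1: "map_permutation U Inl q = (map_sum q id :: 'a + 'b \<Rightarrow> _)"
  proof
    fix x :: "'a + 'b" show "map_permutation U Inl q x = map_sum q id x"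
    proof (cases "x \<in> Inl ` U")
      case True
      then show ?thesis by (auto simp: map_permutation_apply)
    next
      case False
      then show ?thesis using assms(1)
        by (cases x) (auto simp: map_permutation_def restrict_id_def dest: permutes_not_in)
    qed
  qed
  have 2: "map_permutation W Inr r = (map_sum id r :: 'a + 'b \<Rightarrow> _)"
  proof
    fix x :: "'a + 'b" show "map_permutation W Inr r x = map_sum id r x"
    proof (cases "x \<in> Inr ` W")
      case True
      then show ?thesis by (auto simp: map_permutation_apply)
    next
      case False
      then show ?thesis using assms(2)
        by (cases x) (auto simp: map_permutation_def restrict_id_def dest: permutes_not_in)
    qed
  qed
  have "map_sum q r = map_sum q id \<circ> map_sum id r"
    by (simp add: map_sum.comp)
  moreover have "permutation (map_sum q id :: 'a + 'b \<Rightarrow> _)"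
    using permutes_map_sum[OF assms(1) permutes_id[of "{} :: 'b set"]] assms(3)
    by (auto intro!: permutes_imp_permutation[of "U <+> {}"])
  moreover have "permutation (map_sum id r :: 'a + 'b \<Rightarrow> _)"
    using permutes_map_sum[OF permutes_id[of "{} :: 'a set"] assms(2)] assms(4)
    by (auto intro!: permutes_imp_permutation[of "{} <+> W"])
  moreover have "sign (map_sum q id :: 'a + 'b \<Rightarrow> _) = sign q"
    using sign_map_permutation[of "Inl :: 'a \<Rightarrow> 'a + 'b" U q] assms 1 by simp
  moreover have "sign (map_sum id r :: 'a + 'b \<Rightarrow> _) = sign r"
    using sign_map_permutation[of "Inr :: 'b \<Rightarrow> 'a + 'b" W r] assms 2 by simp
  ultimately show ?thesis by (simp add: sign_compose)
qed

text \<open>In a nonzero Leibniz term no element of the first block goes to the second. By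
  injectivity and finiteness the first block is then mapped onto itself, so the second one is
  preserved as well and the permutation splits as \<open>map_sum q r\<close>. The argument covers
  block triangular matrices.\<close>

lemma set_det_block_diagonal:
  fixes U :: "'a set" and W :: "'b set"
  assumes fin: "finite U" "finite W"
    and zero: "\<And>u w. u \<in> U \<Longrightarrow> w \<in> W \<Longrightarrow> D (Inl u) (Inr w) = 0"
  shows "set_det (U <+> W) D =
    set_det U (\<lambda>i j. D (Inl i) (Inl j)) * set_det W (\<lambda>i j. D (Inr i) (Inr j))"
proof -
  let ?P = "{p. p permutes (U <+> W)}" and ?M = "\<lambda>(q, r). map_sum q r"
  let ?Q = "{q. q permutes U} \<times> {r. r permutes W}"
  have finP: "finite ?P"
    using fin by (intro finite_permutations finite_Plus)
  have sub: "?M ` ?Q \<subseteq> ?P"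
    by (auto simp: permutes_map_sum)
  have inj: "inj_on ?M ?Q"
  proof (rule inj_onI, clarify)
    fix q r q' r' assume "map_sum q r = map_sum q' r'"
    from fun_cong[OF this] show "q = q' \<and> r = r'"
      by (metis ext map_sum.simps sum.inject)
  qed
  have van: "(\<Prod>i\<in>U <+> W. D i (p i)) = 0" if p: "p \<in> ?P - ?M ` ?Q" for p
  proof (cases "\<forall>u\<in>U. p (Inl u) \<in> Inl ` U")
    case False
    then obtain u where u: "u \<in> U" "p (Inl u) \<notin> Inl ` U" by auto
    have "p (Inl u) \<in> U <+> W" using p u(1) by (auto simp: permutes_in_image)
    then obtain w where "w \<in> W" "p (Inl u) = Inr w" using u(2) by auto
    then have "D (Inl u) (p (Inl u)) = 0" using zero u(1) by simp
    then show ?thesis using fin u(1) by (intro prod_zero) auto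
  next
    case True
    have pp: "p permutes (U <+> W)" using p by simp
    have "inj p" using pp by (rule permutes_inj)
    have UU: "p ` Inl ` U = Inl ` U"
    proof (rule card_subset_eq)
      show "p ` Inl ` U \<subseteq> Inl ` U" using True by auto
      show "card (p ` Inl ` U) = card (Inl ` U :: ('a + 'b) set)"
        by (rule card_image[OF inj_on_subset[OF \<open>inj p\<close>]]) auto
    qed (use fin in auto)
    have WW: "p (Inr w) \<in> Inr ` W" if "w \<in> W" for w
    proof (rule ccontr)
      assume a: "p (Inr w) \<notin> Inr ` W"
      have "p (Inr w) \<in> U <+> W" using pp that by (auto simp: permutes_in_image)
      then have "p (Inr w) \<in> p ` Inl ` U" using a UU by auto
      then show False using \<open>inj p\<close> by (auto dest: injD)
    qed
    define q where "q u = (if u \<in> U then projl (p (Inl u)) else u)" for u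
    define r where "r w = (if w \<in> W then projr (p (Inr w)) else w)" for w
    have q: "Inl (q u) = p (Inl u)" if "u \<in> U" for u using True that by (auto simp: q_def)
    have r: "Inr (r w) = p (Inr w)" if "w \<in> W" for w using WW[OF that] that by (auto simp: r_def)
    have pe: "p = map_sum q r"
    proof
      fix x show "p x = map_sum q r x"
        by (cases "x \<in> U <+> W"; cases x)
          (use q r pp in \<open>auto simp: q_def r_def permutes_not_in\<close>)
    qed
    have "q permutes U"
    proof (rule inj_imp_permutes)
      show "inj_on q U" by (rule inj_onI) (metis q \<open>inj p\<close> injD Inl_inject)
      show "q u \<in> U" if "u \<in> U" for u using q[OF that] True that by (metis Inl_inject imageE)
    qed (use fin in \<open>auto simp: q_def\<close>)
    moreover have "r permutes W"
    proof (rule inj_imp_permutes)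
      show "inj_on r W" by (rule inj_onI) (metis r \<open>inj p\<close> injD Inr_inject)
      show "r w \<in> W" if "w \<in> W" for w using r[OF that] WW[OF that] by (metis Inr_inject imageE)
    qed (use fin in \<open>auto simp: r_def\<close>)
    ultimately show ?thesis using p pe by auto
  qed
  have "set_det (U <+> W) D = (\<Sum>p\<in>?M ` ?Q. of_int (sign p) * (\<Prod>i\<in>U <+> W. D i (p i)))"
    unfolding set_det_def using sub finP van by (intro sum.mono_neutral_right) auto
  also have "\<dots> = (\<Sum>(q, r)\<in>?Q. of_int (sign (map_sum q r)) * (\<Prod>i\<in>U <+> W. D i (map_sum q r i)))"
    by (subst sum.reindex[OF inj]) (simp add: case_prod_beta')
  also have "\<dots> = (\<Sum>(q, r)\<in>?Q. (of_int (sign q) * (\<Prod>i\<in>U. D (Inl i) (Inl (q i)))) *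
      (of_int (sign r) * (\<Prod>i\<in>W. D (Inr i) (Inr (r i)))))"
    using fin by (intro sum.cong refl) (auto simp: sign_map_sum prod.Plus)
  also have "\<dots> = set_det U (\<lambda>i j. D (Inl i) (Inl j)) * set_det W (\<lambda>i j. D (Inr i) (Inr j))"
    unfolding set_det_def by (simp add: sum_product sum.cartesian_product)
  finally show ?thesis .
qed

definition block_swap :: "'a set \<Rightarrow> 'a + 'a \<Rightarrow> 'a + 'a" where
  "block_swap U x = (if x \<in> U <+> U then case_sum Inr Inl x else x)"

text \<open>Induction step for the next two lemmas: each element of U contributes one transposition,
  hence one factor -1 in the sign.\<close>

lemma block_swap_insert:
  assumes "u \<notin> U"
  shows "block_swap (insert u U) = Transposition.transpose (Inl u) (Inr u) \<circ> block_swap U"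
proof
  fix x show "block_swap (insert u U) x = (Transposition.transpose (Inl u) (Inr u) \<circ> block_swap U) x"
    using assms by (cases x) (auto simp: block_swap_def Transposition.transpose_def)
qed

lemma block_swap_permutes: "finite U \<Longrightarrow> block_swap U permutes (U <+> U)"
proof (induction rule: finite_induct)
  case empty
  have "block_swap {} = (id :: 'a + 'a \<Rightarrow> 'a + 'a)"
    by (rule ext) (simp add: block_swap_def Plus_def)
  then show ?case by (simp only: permutes_id)
next
  case (insert u U)
  have 1: "block_swap U permutes (insert u U <+> insert u U)"
    by (rule permutes_subset[OF insert.IH]) auto
  have 2: "Transposition.transpose (Inl u) (Inr u) permutes (insert u U <+> insert u U)"
    by (rule permutes_swap_id) auto
  show ?case
    unfolding block_swap_insert[OF insert.hyps(2)] by (rule permutes_compose[OF 1 2])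
qed

lemma sign_block_swap: "finite U \<Longrightarrow> sign (block_swap U) = (-1) ^ card U"
proof (induction rule: finite_induct)
  case empty
  have "block_swap {} = (id :: 'a + 'a \<Rightarrow> 'a + 'a)"
    by (rule ext) (simp add: block_swap_def Plus_def)
  then show ?case by simp
next
  case (insert u U)
  have "permutation (block_swap U)"
    using insert.hyps(1) by (intro permutes_imp_permutation[OF _ block_swap_permutes]) auto
  then show ?case
    unfolding block_swap_insert[OF insert.hyps(2)]
    by (subst sign_compose[OF permutation_swap_id]) (use insert in \<open>simp_all add: sign_swap_id\<close>)
qed

text \<open>Once n has identified V with U, exchanging the two halves of the columns makes the
  matrix block diagonal. The sign of this exchange is the origin of the sign (-1) ^ m in
  \<open>exterior_trace_off_diagonal\<close>. Another choice of n changes both determinants on the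
  right by the same sign.\<close>

lemma set_det_off_diagonal:
  assumes fin: "finite U" and n: "bij_betw n U V"
    and z1: "\<And>i j. K (Inl i) (Inl j) = 0" and z2: "\<And>i j. K (Inr i) (Inr j) = 0"
  shows "set_det (V <+> U) K = (-1) ^ card U *
    (set_det U (\<lambda>u u'. K (Inr u) (Inl (n u'))) * set_det U (\<lambda>u u'. K (Inl (n u)) (Inr u')))"
proof -
  let ?s = "block_swap U"
  let ?f = "map_sum n id"
  let ?K = "\<lambda>i j. K (?f i) (?f j)"
  have "bij_betw ?f (U <+> U) (V <+> U)"
  proof -
    have "inj_on ?f (U <+> U)"
      using bij_betw_imp_inj_on[OF n] by (intro inj_onI) (auto dest: inj_onD elim!: PlusE)
    moreover have "?f ` (U <+> U) = V <+> U"
      unfolding Plus_def image_Un image_image bij_betw_imp_surj_on[OF n, symmetric] by simp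
    ultimately show ?thesis by (simp add: bij_betw_def)
  qed
  then have "set_det (V <+> U) K = set_det (U <+> U) ?K"
    by (rule set_det_reindex) (use fin in simp)
  also have "set_det (U <+> U) (\<lambda>i j. ?K i (?s j)) = (-1) ^ card U * set_det (U <+> U) ?K"
    using set_det_permute_columns[OF block_swap_permutes[OF fin], of ?K] fin
    by (simp add: sign_block_swap[OF fin])
  then have "set_det (U <+> U) ?K = (-1) ^ card U * set_det (U <+> U) (\<lambda>i j. ?K i (?s j))"
    by simp
  also have "set_det (U <+> U) (\<lambda>i j. ?K i (?s j)) =
    set_det U (\<lambda>i j. ?K (Inl i) (?s (Inl j))) * set_det U (\<lambda>i j. ?K (Inr i) (?s (Inr j)))"
    using fin by (intro set_det_block_diagonal) (auto simp: z1 block_swap_def)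
  also have "set_det U (\<lambda>i j. ?K (Inl i) (?s (Inl j))) = set_det U (\<lambda>u u'. K (Inl (n u)) (Inr u'))"
    by (rule set_det_cong) (auto simp: block_swap_def)
  also have "set_det U (\<lambda>i j. ?K (Inr i) (?s (Inr j))) = set_det U (\<lambda>u u'. K (Inr u) (Inl (n u')))"
    by (rule set_det_cong) (auto simp: block_swap_def)
  finally show ?thesis by (simp add: mult_ac)
qed

text \<open>A permutation with a nonzero Leibniz term sends each of the two blocks into the other;
  injectivity then bounds each cardinality by the other.\<close>

lemma set_det_off_diagonal_zero:
  fixes U :: "'b set" and V :: "'a set"
  assumes fin: "finite U" "finite V" and neq: "card U \<noteq> card V"
    and z1: "\<And>i j. K (Inl i) (Inl j) = 0" and z2: "\<And>i j. K (Inr i) (Inr j) = 0"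
  shows "set_det (V <+> U) K = 0"
  unfolding set_det_def
proof (intro sum.neutral ballI)
  fix p assume "p \<in> {p. p permutes V <+> U}"
  then have p: "p permutes V <+> U" by simp
  have "\<exists>i\<in>V <+> U. K i (p i) = 0"
  proof (rule ccontr)
    assume "\<not> ?thesis"
    then have nz: "K i (p i) \<noteq> 0" if "i \<in> V <+> U" for i using that by auto
    have inj: "inj p" using p by (rule permutes_inj)
    have "p (Inl v) \<in> Inr ` U" if "v \<in> V" for v
      using nz[of "Inl v"] z1 permutes_in_image[OF p, of "Inl v"] that by (cases "p (Inl v)") auto
    then have "card (p ` Inl ` V) \<le> card (Inr ` U :: ('a + 'b) set)"
      by (intro card_mono finite_imageI fin) auto
    moreover have "p (Inr u) \<in> Inl ` V" if "u \<in> U" for u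
      using nz[of "Inr u"] z2 permutes_in_image[OF p, of "Inr u"] that by (cases "p (Inr u)") auto
    then have "card (p ` Inr ` U) \<le> card (Inl ` V :: ('a + 'b) set)"
      by (intro card_mono finite_imageI fin) auto
    moreover have "card (p ` Inr ` U) = card U" "card (p ` Inl ` V) = card V"
      by (simp_all add: card_image inj_on_subset[OF inj])
    ultimately show False
      using neq by (simp add: card_image)
  qed
  then show "of_int (sign p) * (\<Prod>i\<in>V <+> U. K i (p i)) = 0"
    using fin by (auto intro!: prod_zero)
qed

section \<open>Exterior traces of infinite matrices\<close>

lemma has_sum_finite_sum:
  fixes f :: "'i \<Rightarrow> 'a \<Rightarrow> 'b :: topological_comm_monoid_add"
  assumes "finite I" "\<And>i. i \<in> I \<Longrightarrow> (f i has_sum s i) A"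
  shows "((\<lambda>x. \<Sum>i\<in>I. f i x) has_sum (\<Sum>i\<in>I. s i)) A"
  using assms by (induction I rule: finite_induct) (auto intro: has_sum_add)

lemma bij_betw_PiE_insert:
  assumes "x \<notin> J"
  shows "bij_betw (\<lambda>(y, n). n(x := y)) (B x \<times> PiE J B) (PiE (insert x J) B)"
  unfolding bij_betw_def
proof
  show "inj_on (\<lambda>(y, n). n(x := y)) (B x \<times> PiE J B)"
    using assms by (rule inj_combinator)
  show "(\<lambda>(y, n). n(x := y)) ` (B x \<times> PiE J B) = PiE (insert x J) B"
    by (rule PiE_insert_eq[symmetric])
qed

text \<open>Distributivity, one coordinate at a time. Over the complex numbers summability is
  automatically absolute, which justifies multiplying two sums and summing over the product of the
  index sets.\<close>

lemma has_sum_prod_PiE: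
  fixes f :: "'j \<Rightarrow> 'n \<Rightarrow> complex"
  assumes "finite J" "\<And>j. j \<in> J \<Longrightarrow> (f j has_sum s j) (B j)"
  shows "((\<lambda>n. \<Prod>j\<in>J. f j (n j)) has_sum (\<Prod>j\<in>J. s j)) (PiE J B)"
  using assms
proof (induction J rule: finite_induct)
  case empty
  then show ?case by (simp add: has_sum_finiteI)
next
  case (insert x J)
  let ?F = "\<lambda>(y, n). f x y * (\<Prod>j\<in>J. f j (n j))"
  let ?s = "\<Prod>j\<in>J. s j"
  have hs: "((\<lambda>n. \<Prod>j\<in>J. f j (n j)) has_sum ?s) (PiE J B)" and hx: "(f x has_sum s x) (B x)"
    using insert by auto
  have ns: "(\<lambda>n. norm (\<Prod>j\<in>J. f j (n j))) summable_on PiE J B"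
    and nx: "(\<lambda>y. norm (f x y)) summable_on B x"
    using has_sum_imp_summable[OF hs] has_sum_imp_summable[OF hx]
    by (simp_all flip: summable_on_iff_abs_summable_on_complex)
  have "(\<lambda>p. norm (?F p)) summable_on (SIGMA y:B x. PiE J B)"
  proof (rule summable_on_SigmaI)
    show "((\<lambda>n. norm (?F (y, n))) has_sum
        norm (f x y) * infsum (\<lambda>n. norm (\<Prod>j\<in>J. f j (n j))) (PiE J B)) (PiE J B)" for y
      using has_sum_cmult_right[OF has_sum_infsum[OF ns], of "norm (f x y)"]
      by (simp add: norm_mult)
  qed (auto intro!: summable_on_cmult_left nx)
  then have sF: "?F summable_on (SIGMA y:B x. PiE J B)"
    by (rule abs_summable_summable)
  have "(?F has_sum s x * ?s) (SIGMA y:B x. PiE J B)"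
    by (rule has_sum_SigmaI[OF _ has_sum_cmult_left[OF hx] sF])
      (use has_sum_cmult_right[OF hs] in simp)
  also have "?F = (\<lambda>p. (\<lambda>n. \<Prod>j\<in>insert x J. f j (n j)) ((\<lambda>(y, n). n(x := y)) p))"
  proof
    fix p
    have "(\<Prod>j\<in>J. f j (n j)) = (\<Prod>j\<in>J. f j ((n(x := y)) j))" for n y
      using insert.hyps(2) by (intro prod.cong) auto
    then show "?F p = (\<lambda>n. \<Prod>j\<in>insert x J. f j (n j)) ((\<lambda>(y, n). n(x := y)) p)"
      using insert.hyps by (cases p) simp
  qed
  finally show ?case
    by (simp only: has_sum_reindex_bij_betw[OF bij_betw_PiE_insert[OF insert.hyps(2)],
        where f = "\<lambda>n. \<Prod>j\<in>insert x J. f j (n j)"] prod.insert[OF insert.hyps, of s])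
qed

lemma bij_betw_PiE_compose:
  assumes q: "q permutes J"
  shows "bij_betw (\<lambda>n. restrict (n \<circ> q) J) (PiE J (\<lambda>_. UNIV)) (PiE J (\<lambda>_. UNIV))"
proof (rule bij_betwI[of _ _ _ "\<lambda>n. restrict (n \<circ> inv q) J"])
  note [simp] = permutes_in_image[OF q] permutes_in_image[OF permutes_inv[OF q]] permutes_inverses[OF q]
  show "restrict (restrict (n \<circ> q) J \<circ> inv q) J = n" if "n \<in> PiE J (\<lambda>_. UNIV)" for n
    using that by (auto simp: fun_eq_iff PiE_def extensional_def restrict_def)
  show "restrict (restrict (n \<circ> inv q) J \<circ> q) J = n" if "n \<in> PiE J (\<lambda>_. UNIV)" for n
    using that by (auto simp: fun_eq_iff PiE_def extensional_def restrict_def)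
qed auto

lemma bij_betw_PiE_pairs:
  "bij_betw (\<lambda>w. (restrict (fst \<circ> w) J, restrict (snd \<circ> w) J))
    (PiE J (\<lambda>_. UNIV)) (PiE J (\<lambda>_. UNIV) \<times> PiE J (\<lambda>_. UNIV))"
proof (rule bij_betwI[of _ _ _ "\<lambda>(i, n). restrict (\<lambda>j. (i j, n j)) J"])
qed (auto simp: fun_eq_iff PiE_def extensional_def restrict_def)

text \<open>Exterior traces are sums over sets, whereas products and exchanges of sums produce
  tuples. Every set of size \<open>card J\<close> is the image of exactly
  \<open>fact (card J)\<close> injective tuples, and the other tuples contribute nothing.\<close>

lemma has_sum_subsets:
  fixes g :: "('j \<Rightarrow> 'a) \<Rightarrow> complex"
  assumes J: "finite J"
    and g: "(g has_sum t) (PiE J (\<lambda>_. UNIV))"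
    and g0: "\<And>n. n \<in> PiE J (\<lambda>_. UNIV) \<Longrightarrow> \<not> inj_on n J \<Longrightarrow> g n = 0"
    and gf: "\<And>n. n \<in> PiE J (\<lambda>_. UNIV) \<Longrightarrow> inj_on n J \<Longrightarrow> g n = f (n ` J)"
  shows "(f has_sum (t / fact (card J))) {S. finite S \<and> card S = card J}"
proof -
  let ?I = "\<lambda>S. {n \<in> J \<rightarrow>\<^sub>E S. inj_on n J}" and ?\<S> = "{S :: 'a set. finite S \<and> card S = card J}"
  have im: "n ` J = S" if "n \<in> ?I S" "S \<in> ?\<S>" for n S
    using that by (intro card_subset_eq) (auto simp: card_image)
  have bij: "bij_betw snd (SIGMA S:?\<S>. ?I S) {n \<in> PiE J (\<lambda>_. UNIV). inj_on n J}"
  proof (rule bij_betwI[of _ _ _ "\<lambda>n. (n ` J, n)"])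
    show "snd \<in> (SIGMA S:?\<S>. ?I S) \<rightarrow> {n \<in> PiE J (\<lambda>_. UNIV). inj_on n J}"
      by (auto simp: PiE_iff dest: extensional_arb)
    show "(\<lambda>n. (n ` J, n)) \<in> {n \<in> PiE J (\<lambda>_. UNIV). inj_on n J} \<rightarrow> (SIGMA S:?\<S>. ?I S)"
      using J by (auto simp: card_image PiE_def)
    show "(snd p ` J, snd p) = p" if "p \<in> (SIGMA S:?\<S>. ?I S)" for p
      using that im[of "snd p" "fst p"] by (cases p) auto
  qed auto
  have "(g has_sum t) {n \<in> PiE J (\<lambda>_. UNIV). inj_on n J}"
    using g by (rule has_sum_cong_neutral[THEN iffD1, rotated -1]) (use g0 in auto)
  then have "((\<lambda>p. g (snd p)) has_sum t) (SIGMA S:?\<S>. ?I S)"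
    by (simp add: has_sum_reindex_bij_betw[OF bij])
  then have "((\<lambda>S. fact (card J) * f S) has_sum t) ?\<S>"
  proof (rule has_sum_SigmaD)
    fix S assume S: "S \<in> ?\<S>"
    have fin: "finite (?I S)"
      using S J by (intro finite_subset[of "?I S" "J \<rightarrow>\<^sub>E S"] finite_PiE) auto
    have "(\<Sum>n\<in>?I S. g n) = (\<Sum>n\<in>?I S. f S)"
    proof (rule sum.cong)
      fix n assume n: "n \<in> ?I S"
      then show "g n = f S" using gf[of n] im[OF n S] by (auto simp: PiE_iff)
    qed simp
    also have "\<dots> = fact (card J) * f S"
    proof -
      have "card (?I S) = fact (card J)"
        using S J card_inj_on_subset_funcset[of J S J] fact_prod_rev[of "card J", where 'a = nat]
        by simp
      then show ?thesis by simp
    qed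
    finally show "((\<lambda>n. g (snd (S, n))) has_sum fact (card J) * f S) (?I S)"
      using fin by (intro has_sum_finiteI) auto
  qed
  from has_sum_cmult_right[OF this, of "1 / fact (card J)"] show ?thesis
    by simp
qed

lemma has_sum_set_det_tuples:
  fixes J :: "'j set" and M :: "'a \<Rightarrow> 'a \<Rightarrow> complex"
  assumes J: "finite J"
    and g: "((\<lambda>n. set_det J (\<lambda>l m. M (n l) (n m))) has_sum t) (PiE J (\<lambda>_. UNIV))"
  shows "((\<lambda>S. set_det S M) has_sum (t / fact (card J))) {S. finite S \<and> card S = card J}"
proof (rule has_sum_subsets[OF J g])
  fix n :: "'j \<Rightarrow> 'a" assume "\<not> inj_on n J"
  then obtain a b where "a \<in> J" "b \<in> J" "a \<noteq> b" "n a = n b"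
    by (auto simp: inj_on_def)
  then show "set_det J (\<lambda>l m. M (n l) (n m)) = 0"
    using J by (intro set_det_equal_columns[of J a b]) auto
next
  fix n :: "'j \<Rightarrow> 'a" assume "inj_on n J"
  then show "set_det J (\<lambda>l m. M (n l) (n m)) = set_det (n ` J) M"
    using J by (intro set_det_reindex[symmetric]) (auto simp: inj_on_imp_bij_betw)
qed

text \<open>The first half of the Cauchy--Binet formula: C = A B is expanded by multilinearity in
  its rows. Tuples are not yet grouped into sets, since it is this unsymmetrized summand that can
  later be summed in either order.\<close>

lemma has_sum_row_det:
  fixes A :: "'j \<Rightarrow> 'b \<Rightarrow> complex" and B :: "'b \<Rightarrow> 'j \<Rightarrow> complex"
  assumes J: "finite J"
    and AB: "\<And>l m. l \<in> J \<Longrightarrow> m \<in> J \<Longrightarrow> ((\<lambda>n. A l n * B n m) has_sum C l m) UNIV"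
  shows "((\<lambda>n. (\<Prod>l\<in>J. A l (n l)) * set_det J (\<lambda>l m. B (n l) m)) has_sum set_det J C)
    (PiE J (\<lambda>_. UNIV))"
proof -
  have "((\<lambda>n. \<Sum>p | p permutes J. of_int (sign p) * (\<Prod>l\<in>J. A l (n l) * B (n l) (p l))) has_sum
    (\<Sum>p | p permutes J. of_int (sign p) * (\<Prod>l\<in>J. C l (p l)))) (PiE J (\<lambda>_. UNIV))"
    by (intro has_sum_finite_sum has_sum_cmult_right has_sum_prod_PiE J finite_permutations AB)
      (auto simp: permutes_in_image)
  then show ?thesis
    by (simp add: set_det_def sum_distrib_left prod.distrib mult_ac)
qed

text \<open>The expansion along columns, by transposition. Its summand has the same shape as in
  \<open>has_sum_row_det\<close>, and this coincidence is what makes cyclicity work.\<close>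

lemma has_sum_column_det:
  fixes A :: "'a \<Rightarrow> 'j \<Rightarrow> complex" and B :: "'j \<Rightarrow> 'a \<Rightarrow> complex"
  assumes J: "finite J"
    and BA: "\<And>l m. l \<in> J \<Longrightarrow> m \<in> J \<Longrightarrow> ((\<lambda>i. B l i * A i m) has_sum C l m) UNIV"
  shows "((\<lambda>i. (\<Prod>l\<in>J. A (i l) l) * set_det J (\<lambda>l m. B l (i m))) has_sum set_det J C)
    (PiE J (\<lambda>_. UNIV))"
proof -
  have "((\<lambda>i. (\<Prod>l\<in>J. A (i l) l) * set_det J (\<lambda>l m. B m (i l))) has_sum set_det J (\<lambda>l m. C m l))
    (PiE J (\<lambda>_. UNIV))"
    by (rule has_sum_row_det[OF J]) (use BA in \<open>simp add: mult.commute\<close>)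
  moreover have "set_det J (\<lambda>l m. B m (i l)) = set_det J (\<lambda>l m. B l (i m))" for i
    by (rule set_det_transpose[OF J])
  ultimately show ?thesis
    by (simp add: set_det_transpose[OF J, of C])
qed

section \<open>Hilbert--Schmidt matrices and the cyclicity of exterior traces\<close>

definition hs_matrix :: "('a \<Rightarrow> 'b \<Rightarrow> complex) \<Rightarrow> bool" where
  "hs_matrix A \<longleftrightarrow> (\<lambda>(i, j). (norm (A i j))\<^sup>2) summable_on UNIV"

text \<open>\<open>has_sum_prod_PiE\<close> is stated for complex summands, so the real entries are
  embedded and real parts are taken at the end. A tuple of pairs is then read as a pair of
  tuples.\<close>

lemma summable_on_prod_entries:
  fixes a :: "'a \<Rightarrow> 'b \<Rightarrow> real"
  assumes J: "finite J" and a: "(\<lambda>(i, j). a i j) summable_on UNIV"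
  shows "(\<lambda>(i, n). \<Prod>l\<in>J. a (i l) (n l)) summable_on (PiE J (\<lambda>_. UNIV) \<times> PiE J (\<lambda>_. UNIV))"
proof -
  let ?f = "\<lambda>p. complex_of_real (case p of (i, j) \<Rightarrow> a i j)"
  have "?f summable_on UNIV"
    by (rule summable_on_of_real[OF a])
  then obtain s where "(?f has_sum s) UNIV"
    by (auto simp: summable_on_def)
  then have "((\<lambda>w. \<Prod>l\<in>J. ?f (w l)) has_sum (\<Prod>l\<in>J. s)) (PiE J (\<lambda>_. UNIV))"
    by (intro has_sum_prod_PiE J)
  then have "((\<lambda>w. Re (\<Prod>l\<in>J. ?f (w l))) has_sum Re (\<Prod>l\<in>J. s)) (PiE J (\<lambda>_. UNIV))"
    by (rule has_sum_Re)
  then have "(\<lambda>w. \<Prod>l\<in>J. case w l of (i, j) \<Rightarrow> a i j) summable_on (PiE J (\<lambda>_. UNIV))"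
    by (simp only: of_real_prod[symmetric] Re_complex_of_real) (rule has_sum_imp_summable)
  then have "(\<lambda>w. (\<lambda>(i, n). \<Prod>l\<in>J. a (i l) (n l)) (restrict (fst \<circ> w) J, restrict (snd \<circ> w) J))
      summable_on (PiE J (\<lambda>_. UNIV))"
    by (rule summable_on_cong[THEN iffD1, rotated]) (simp add: case_prod_beta)
  then show ?thesis
    by (simp only: summable_on_reindex_bij_betw[OF bij_betw_PiE_pairs,
        where f = "\<lambda>(i, n). \<Prod>l\<in>J. a (i l) (n l)"])
qed

lemma two_mult_le_squares: "2 * (x * y) \<le> x\<^sup>2 + (y :: real)\<^sup>2"
  using sum_squares_bound[of x y] by simp

text \<open>F is summed over pairs of tuples in both orders: over n first it yields the determinants
  for A B by \<open>has_sum_row_det\<close>, over i first those for B A by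
  \<open>has_sum_column_det\<close>. What remains is absolute summability of F, for which square
  summable entries are enough.\<close>

theorem exterior_trace_cyclic:
  fixes A :: "'a \<Rightarrow> 'b \<Rightarrow> complex" and B :: "'b \<Rightarrow> 'a \<Rightarrow> complex"
  assumes hs: "hs_matrix A" "hs_matrix B"
    and AB: "\<And>i j. ((\<lambda>n. A i n * B n j) has_sum AB i j) UNIV"
    and BA: "\<And>n m. ((\<lambda>i. B n i * A i m) has_sum BA n m) UNIV"
  obtains t where "((\<lambda>S. set_det S AB) has_sum t) {S. finite S \<and> card S = k}"
    and "((\<lambda>S. set_det S BA) has_sum t) {S. finite S \<and> card S = k}"
proof -
  define J where "J = {..<k}"
  have J: "finite J" and cardJ: "card J = k" by (auto simp: J_def)
  let ?X = "PiE J (\<lambda>_. UNIV :: 'a set)" and ?Y = "PiE J (\<lambda>_. UNIV :: 'b set)"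
  define F where "F = (\<lambda>(i, n). (\<Prod>l\<in>J. A (i l) (n l)) * set_det J (\<lambda>l m. B (n l) (i m)))"
  \<comment> \<open>One summand for each Leibniz term of F, from u v <= u^2 + v^2 with u the product
    of the entries of A and v that of the entries of B, in absolute value.\<close>
  define G where "G = (\<lambda>(i, n). \<Sum>p | p permutes J.
    (\<Prod>l\<in>J. (norm (A (i l) (n l)))\<^sup>2) + (\<Prod>l\<in>J. (norm (B (n l) (i (p l))))\<^sup>2))"
  have "(\<lambda>x. norm (F x)) summable_on ?X \<times> ?Y"
  proof (rule Infinite_Sum.abs_summable_on_comparison_test'[of G])
    have 1: "(\<lambda>(i, n). \<Prod>l\<in>J. (norm (A (i l) (n l)))\<^sup>2) summable_on ?X \<times> ?Y"
      by (rule summable_on_prod_entries[OF J]) (use hs(1) in \<open>simp add: hs_matrix_def\<close>)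
    have 2: "(\<lambda>(i, n). \<Prod>l\<in>J. (norm (B (n l) (i (p l))))\<^sup>2) summable_on ?X \<times> ?Y"
      if p: "p permutes J" for p
    proof -
      have "(\<lambda>(n, i). \<Prod>l\<in>J. (norm (B (n l) (i l)))\<^sup>2) summable_on ?Y \<times> ?X"
        by (rule summable_on_prod_entries[OF J]) (use hs(2) in \<open>simp add: hs_matrix_def\<close>)
      then have 3: "(\<lambda>(i, n). \<Prod>l\<in>J. (norm (B (n l) (i l)))\<^sup>2) summable_on ?X \<times> ?Y"
        by (subst (asm) summable_on_swap) simp
      \<comment> \<open>Relabelling the tuple i by p is a bijection of the index tuples and removes
        p from the product.\<close>
      have "bij_betw (map_prod (\<lambda>i. restrict (i \<circ> p) J) id) (?X \<times> ?Y) (?X \<times> ?Y)"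
        by (intro bij_betw_map_prod bij_betw_PiE_compose p) (simp add: bij_betw_def)
      from summable_on_reindex_bij_betw[OF this, THEN iffD2, OF 3] show ?thesis
        by (rule summable_on_cong[THEN iffD1, rotated]) (auto intro!: prod.cong)
    qed
    have "(\<lambda>x. \<Sum>p | p permutes J. (case x of (i, n) \<Rightarrow> \<Prod>l\<in>J. (norm (A (i l) (n l)))\<^sup>2) +
        (case x of (i, n) \<Rightarrow> \<Prod>l\<in>J. (norm (B (n l) (i (p l))))\<^sup>2)) summable_on ?X \<times> ?Y"
    proof (rule has_sum_imp_summable, rule has_sum_finite_sum)
      fix p assume "p \<in> {p. p permutes J}"
      then show "((\<lambda>x. (case x of (i, n) \<Rightarrow> \<Prod>l\<in>J. (norm (A (i l) (n l)))\<^sup>2) +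
          (case x of (i, n) \<Rightarrow> \<Prod>l\<in>J. (norm (B (n l) (i (p l))))\<^sup>2)) has_sum
          infsum (\<lambda>(i, n). \<Prod>l\<in>J. (norm (A (i l) (n l)))\<^sup>2) (?X \<times> ?Y) +
          infsum (\<lambda>(i, n). \<Prod>l\<in>J. (norm (B (n l) (i (p l))))\<^sup>2) (?X \<times> ?Y)) (?X \<times> ?Y)"
        by (intro has_sum_add[OF has_sum_infsum[OF 1] has_sum_infsum[OF 2]]) simp
    qed (rule finite_permutations[OF J])
    then show "G summable_on ?X \<times> ?Y"
      by (simp add: G_def case_prod_beta')
    fix x assume "x \<in> ?X \<times> ?Y"
    obtain i n where x: "x = (i, n)" by (cases x)
    have "norm (F x) \<le> (\<Sum>p | p permutes J. norm ((\<Prod>l\<in>J. A (i l) (n l)) *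
        (of_int (sign p) * (\<Prod>l\<in>J. B (n l) (i (p l))))))"
      unfolding F_def x set_det_def by (simp only: prod.case sum_distrib_left) (rule norm_sum)
    also have "\<dots> \<le> G x"
      unfolding G_def x prod.case
    proof (intro sum_mono)
      fix p
      define u where "u = (\<Prod>l\<in>J. norm (A (i l) (n l)))"
      define v where "v = (\<Prod>l\<in>J. norm (B (n l) (i (p l))))"
      have "u \<ge> 0" "v \<ge> 0" by (auto simp: u_def v_def prod_nonneg)
      then have "u * v \<le> u\<^sup>2 + v\<^sup>2"
        using two_mult_le_squares[of u v] mult_nonneg_nonneg[of u v] by linarith
      moreover have "norm (of_int (sign p) :: complex) = 1"
        by (simp add: sign_def)
      ultimately show "norm ((\<Prod>l\<in>J. A (i l) (n l)) * (of_int (sign p) * (\<Prod>l\<in>J. B (n l) (i (p l)))))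
        \<le> (\<Prod>l\<in>J. (norm (A (i l) (n l)))\<^sup>2) + (\<Prod>l\<in>J. (norm (B (n l) (i (p l))))\<^sup>2)"
        by (simp add: norm_mult u_def v_def prod_power_distrib flip: prod_norm)
    qed
    finally show "norm (F x) \<le> G x" .
  qed
  then have "F summable_on ?X \<times> ?Y"
    by (rule abs_summable_summable)
  then obtain t where t: "(F has_sum t) (?X \<times> ?Y)"
    by (auto simp: summable_on_def)
  have "((\<lambda>i. set_det J (\<lambda>l m. AB (i l) (i m))) has_sum t) ?X"
    by (rule has_sum_SigmaD[OF t]) (auto simp: F_def intro!: has_sum_row_det J AB)
  from has_sum_set_det_tuples[OF J this]
  have "((\<lambda>S. set_det S AB) has_sum (t / fact k)) {S. finite S \<and> card S = k}"
    by (simp only: cardJ)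
  have "((\<lambda>n. set_det J (\<lambda>l m. BA (n l) (n m))) has_sum t) ?Y"
    by (rule has_sum_SigmaD[OF t[unfolded has_sum_swap[of F]]])
      (auto simp: F_def intro!: has_sum_column_det J BA)
  from has_sum_set_det_tuples[OF J this]
  have "((\<lambda>S. set_det S BA) has_sum (t / fact k)) {S. finite S \<and> card S = k}"
    by (simp only: cardJ)
  with \<open>((\<lambda>S. set_det S AB) has_sum (t / fact k)) {S. finite S \<and> card S = k}\<close> show ?thesis
    by (rule that)
qed

text \<open>An index set splits as \<open>V <+> U\<close>, and its minor vanishes unless both parts
  have the same size. Hence odd degrees contribute nothing, and in degree 2 m the sum over V for
  fixed U is the Cauchy--Binet expansion of the minor of G on U.\<close>

theorem exterior_trace_off_diagonal:
  fixes C :: "'a + 'b \<Rightarrow> 'a + 'b \<Rightarrow> complex"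
  assumes t: "((\<lambda>S. set_det S C) has_sum t) {S. finite S \<and> card S = k}"
    and z1: "\<And>i j. C (Inl i) (Inl j) = 0" and z2: "\<And>i j. C (Inr i) (Inr j) = 0"
    and G: "\<And>u v. ((\<lambda>n. C (Inr u) (Inl n) * C (Inl n) (Inr v)) has_sum G u v) UNIV"
  shows "odd k \<Longrightarrow> t = 0"
    and "k = 2 * m \<Longrightarrow> ((\<lambda>U. set_det U G) has_sum ((-1) ^ m * t)) {U. finite U \<and> card U = m}"
proof -
  have part: "\<exists>V U. S = V <+> U" for S :: "('a + 'b) set"
  proof (intro exI set_eqI)
    show "x \<in> S \<longleftrightarrow> x \<in> Inl -` S <+> Inr -` S" for x by (cases x) auto
  qed
  have zero: "set_det S C = 0" if "finite S" "card S = k" "\<nexists>V U. S = V <+> U \<and> card U = card V" for S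
  proof -
    obtain V U where S: "S = V <+> U" using part by blast
    with that show ?thesis
      using set_det_off_diagonal_zero[of U V C, OF _ _ _ z1 z2] by (auto simp: finite_Plus_iff)
  qed
  {
    assume k: "odd k"
    have "set_det S C = 0" if "S \<in> {S. finite S \<and> card S = k}" for S
    proof (rule zero)
      show "\<nexists>V U. S = V <+> U \<and> card U = card V"
        using that k by (auto simp: card_Plus finite_Plus_iff)
    qed (use that in auto)
    then have "((\<lambda>S. set_det S C) has_sum 0) {S. finite S \<and> card S = k}"
      by (intro has_sum_0) auto
    with t show "t = 0" by (rule has_sum_unique)
  }
  assume k: "k = 2 * m"
  let ?U = "{U. finite U \<and> card U = m} :: 'b set set" and ?V = "{V. finite V \<and> card V = m} :: 'a set set"
  have inner: "((\<lambda>V. set_det (V <+> U) C) has_sum ((-1) ^ m * set_det U G)) ?V" if "U \<in> ?U" for U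
  proof -
    have U: "finite U" "card U = m" using that by auto
    let ?H = "\<lambda>n. set_det U (\<lambda>u v. C (Inr u) (Inl (n v))) * set_det U (\<lambda>u v. C (Inl (n u)) (Inr v))"
    \<comment> \<open>The row expansion has a plain product of entries in place of the first
      determinant of \<open>?H\<close>. Summing over all relabellings of n restores that determinant
      and multiplies the total by \<open>fact m\<close>, which \<open>has_sum_subsets\<close>
      divides out again.\<close>
    let ?Q = "\<lambda>n. (\<Prod>u\<in>U. C (Inr u) (Inl (n u))) * set_det U (\<lambda>u v. C (Inl (n u)) (Inr v))"
    have Q: "(?Q has_sum set_det U G) (PiE U (\<lambda>_. UNIV))"
      by (rule has_sum_row_det[OF U(1) G])
    have "((\<lambda>n. \<Sum>p | p permutes U. ?Q (restrict (n \<circ> p) U)) has_sum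
        (\<Sum>p | p permutes U. set_det U G)) (PiE U (\<lambda>_. UNIV))"
      using Q U(1) by (intro has_sum_finite_sum finite_permutations)
        (simp_all only: has_sum_reindex_bij_betw[OF bij_betw_PiE_compose, where f = ?Q] mem_Collect_eq)
    also have "(\<lambda>n. \<Sum>p | p permutes U. ?Q (restrict (n \<circ> p) U)) = ?H"
    proof
      fix n :: "'b \<Rightarrow> 'a"
      have "?Q (restrict (n \<circ> p) U) = of_int (sign p) * (\<Prod>u\<in>U. C (Inr u) (Inl (n (p u)))) *
          set_det U (\<lambda>u v. C (Inl (n u)) (Inr v))" if p: "p permutes U" for p
      proof -
        have "(\<Prod>u\<in>U. C (Inr u) (Inl (restrict (n \<circ> p) U u))) = (\<Prod>u\<in>U. C (Inr u) (Inl (n (p u))))"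
          by (rule prod.cong) auto
        moreover have "set_det U (\<lambda>u v. C (Inl (restrict (n \<circ> p) U u)) (Inr v)) =
            set_det U (\<lambda>u v. C (Inl (n (p u))) (Inr v))"
          by (rule set_det_cong) auto
        moreover note set_det_permute_rows[OF p U(1), of "\<lambda>u v. C (Inl (n u)) (Inr v)"]
        ultimately show ?thesis by (simp only: mult_ac)
      qed
      then have "(\<Sum>p | p permutes U. ?Q (restrict (n \<circ> p) U)) =
          (\<Sum>p | p permutes U. of_int (sign p) * (\<Prod>u\<in>U. C (Inr u) (Inl (n (p u)))) *
          set_det U (\<lambda>u v. C (Inl (n u)) (Inr v)))"
        by (intro sum.cong) auto
      then show "(\<Sum>p | p permutes U. ?Q (restrict (n \<circ> p) U)) = ?H n"
        by (simp only: set_det_def[of U "\<lambda>u v. C (Inr u) (Inl (n v))"] sum_distrib_right)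
    qed
    finally have "(?H has_sum (fact m * set_det U G)) (PiE U (\<lambda>_. UNIV))"
      using card_permutations[OF U(2,1)] by simp
    then have "((\<lambda>V. (-1) ^ m * set_det (V <+> U) C) has_sum ((fact m * set_det U G) / fact (card U)))
        {V. finite V \<and> card V = card U}"
    proof (rule has_sum_subsets[OF U(1)])
      fix n :: "'b \<Rightarrow> 'a" assume "\<not> inj_on n U"
      then obtain a b where "a \<in> U" "b \<in> U" "a \<noteq> b" "n a = n b"
        by (auto simp: inj_on_def)
      then show "?H n = 0"
        using U by (auto intro!: set_det_equal_columns[of U a b])
    next
      fix n :: "'b \<Rightarrow> 'a" assume "inj_on n U"
      then show "?H n = (-1) ^ m * set_det (n ` U <+> U) C"
        using set_det_off_diagonal[OF U(1) inj_on_imp_bij_betw, of n C] z1 z2 U(2) by simp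
    qed
    from has_sum_cmult_right[OF this, of "(-1) ^ m"] show ?thesis
      using U(2) by simp
  qed
  have "((\<lambda>S. set_det S C) has_sum t) ((\<lambda>(U, V). V <+> U) ` (?U \<times> ?V))"
    using t
  proof (rule has_sum_cong_neutral[THEN iffD1, rotated -1])
    fix S assume S: "S \<in> {S. finite S \<and> card S = k} - (\<lambda>(U, V). V <+> U) ` (?U \<times> ?V)"
    show "set_det S C = 0"
    proof (rule zero)
      show "\<nexists>V U. S = V <+> U \<and> card U = card V"
      proof (intro notI, elim exE conjE)
        fix V U assume "S = V <+> U" "card U = card V"
        moreover from this have "finite V" "finite U" "card V = m"
          using S k by (auto simp: card_Plus finite_Plus_iff)
        ultimately show False using S by (auto simp: image_iff)
      qed
    qed (use S in auto)
  qed (auto simp: k card_Plus)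
  moreover have "inj_on (\<lambda>(U, V). V <+> U) (?U \<times> ?V)"
  proof (intro inj_onI, clarify)
    fix U V U' V' assume "(V :: 'a set) <+> U = V' <+> (U' :: 'b set)"
    then have "Inl -` (V <+> U) = Inl -` (V' <+> U')" "Inr -` (V <+> U) = Inr -` (V' <+> U')"
      by simp_all
    moreover have "Inl -` (V <+> U) = V" "Inr -` (V <+> U) = U" for V :: "'a set" and U :: "'b set"
      by auto
    ultimately show "U = U' \<and> V = V'" by simp
  qed
  ultimately have "((\<lambda>(U, V). set_det (V <+> U) C) has_sum t) (?U \<times> ?V)"
    by (subst (asm) has_sum_reindex) (auto simp: o_def case_prod_beta')
  then have "((\<lambda>U. (-1) ^ m * set_det U G) has_sum t) ?U"
    by (rule has_sum_SigmaD) (use inner in simp)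
  from has_sum_cmult_right[OF this, of "(-1) ^ m"]
  show "((\<lambda>U. set_det U G) has_sum ((-1) ^ m * t)) ?U" by simp
qed

section \<open>Orthonormal systems in L2 spaces\<close>

definition l2_sq :: "'a measure \<Rightarrow> ('a \<Rightarrow> complex) \<Rightarrow> real" where
  "l2_sq M f = (\<integral>x. (norm (f x))\<^sup>2 \<partial>M)"

lemma l2_spaceI [intro?]:
  "f \<in> borel_measurable M \<Longrightarrow> integrable M (\<lambda>x. (norm (f x))\<^sup>2) \<Longrightarrow> f \<in> l2_space M"
  by (simp add: l2_space_def)

lemma l2_measurable [measurable_dest]: "f \<in> l2_space M \<Longrightarrow> f \<in> borel_measurable M"
  by (simp add: l2_space_def)

lemma l2_integrable: "f \<in> l2_space M \<Longrightarrow> integrable M (\<lambda>x. (norm (f x))\<^sup>2)"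
  by (simp add: l2_space_def)

lemma norm_mult_le_squares: "norm (a * b :: complex) \<le> (norm a)\<^sup>2 + (norm b)\<^sup>2"
proof -
  have "2 * (norm a * norm b) \<le> (norm a)\<^sup>2 + (norm b)\<^sup>2"
    using sum_squares_bound[of "norm a" "norm b"] by (simp add: mult.assoc)
  moreover have "0 \<le> norm a * norm b" by simp
  ultimately show ?thesis unfolding norm_mult by linarith
qed

lemma borel_measurable_cnj [measurable (raw)]:
  "f \<in> borel_measurable M \<Longrightarrow> (\<lambda>x. cnj (f x)) \<in> borel_measurable M"
  by (rule measurable_compose[OF _ borel_measurable_continuous_onI[OF continuous_on_cnj[OF continuous_on_id]]])

lemma l2_integrable_mult:
  assumes "f \<in> l2_space M" "g \<in> l2_space M"
  shows "integrable M (\<lambda>x. f x * g x)"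
proof (rule Bochner_Integration.integrable_bound)
  show "integrable M (\<lambda>x. (norm (f x))\<^sup>2 + (norm (g x))\<^sup>2)"
    using assms by (intro Bochner_Integration.integrable_add l2_integrable)
  show "AE x in M. norm (f x * g x) \<le> norm ((norm (f x))\<^sup>2 + (norm (g x))\<^sup>2)"
    using norm_mult_le_squares[of "f _" "g _"] by (intro AE_I2) (metis abs_ge_self order_trans real_norm_def)
qed (use assms in measurable)

lemma l2_cnj: "f \<in> l2_space M \<Longrightarrow> (\<lambda>x. cnj (f x)) \<in> l2_space M"
  unfolding l2_space_def by auto

lemma l2_scale: "f \<in> l2_space M \<Longrightarrow> (\<lambda>x. c * f x) \<in> l2_space M"
  unfolding l2_space_def by (auto simp: norm_mult power_mult_distrib)

lemma l2_zero [simp]: "(\<lambda>_. 0) \<in> l2_space M"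
  by (simp add: l2_space_def)

lemma l2_add:
  assumes "f \<in> l2_space M" "g \<in> l2_space M"
  shows "(\<lambda>x. f x + g x) \<in> l2_space M"
proof
  show "integrable M (\<lambda>x. (norm (f x + g x))\<^sup>2)"
  proof (rule Bochner_Integration.integrable_bound)
    show "integrable M (\<lambda>x. 2 * (norm (f x))\<^sup>2 + 2 * (norm (g x))\<^sup>2)"
      using assms by (intro Bochner_Integration.integrable_add integrable_mult_right l2_integrable)
    have "(norm (a + b))\<^sup>2 \<le> 2 * (norm a)\<^sup>2 + 2 * (norm b)\<^sup>2" for a b :: complex
    proof -
      have "(norm (a + b))\<^sup>2 \<le> (norm a + norm b)\<^sup>2"
        by (intro power_mono norm_triangle_ineq) auto
      also have "\<dots> \<le> 2 * (norm a)\<^sup>2 + 2 * (norm b)\<^sup>2"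
        using sum_squares_bound[of "norm a" "norm b"] by (simp add: power2_sum)
      finally show ?thesis .
    qed
    then show "AE x in M. norm ((norm (f x + g x))\<^sup>2) \<le> norm (2 * (norm (f x))\<^sup>2 + 2 * (norm (g x))\<^sup>2)"
      by (intro AE_I2) simp
  qed (use assms in measurable)
qed (use assms in measurable)

lemma l2_sum: "(\<And>i. i \<in> I \<Longrightarrow> f i \<in> l2_space M) \<Longrightarrow> (\<lambda>x. \<Sum>i\<in>I. f i x) \<in> l2_space M"
  by (induction I rule: infinite_finite_induct) (auto intro: l2_add)

lemma l2_diff: "f \<in> l2_space M \<Longrightarrow> g \<in> l2_space M \<Longrightarrow> (\<lambda>x. f x - g x) \<in> l2_space M"
  using l2_add[of f M "\<lambda>x. -1 * g x"] l2_scale[of g M "-1"] by simp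

lemma l2_cong_AE:
  assumes "f \<in> l2_space M" "g \<in> borel_measurable M" "AE x in M. f x = g x"
  shows "g \<in> l2_space M"
proof
  show "integrable M (\<lambda>x. (norm (g x))\<^sup>2)"
    using l2_integrable[OF assms(1)]
    by (rule integrable_cong_AE[THEN iffD1, rotated -1]) (use assms in auto)
qed fact

lemma l2_inner_integrable:
  "f \<in> l2_space M \<Longrightarrow> g \<in> l2_space M \<Longrightarrow> integrable M (\<lambda>x. f x * cnj (g x))"
  by (intro l2_integrable_mult l2_cnj)

lemma l2_inner_add_left:
  "f \<in> l2_space M \<Longrightarrow> g \<in> l2_space M \<Longrightarrow> h \<in> l2_space M \<Longrightarrow>
    l2_inner M (\<lambda>x. f x + g x) h = l2_inner M f h + l2_inner M g h"
  unfolding l2_inner_def by (simp add: distrib_right l2_inner_integrable)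

lemma l2_inner_diff_left:
  "f \<in> l2_space M \<Longrightarrow> g \<in> l2_space M \<Longrightarrow> h \<in> l2_space M \<Longrightarrow>
    l2_inner M (\<lambda>x. f x - g x) h = l2_inner M f h - l2_inner M g h"
  unfolding l2_inner_def by (simp add: left_diff_distrib l2_inner_integrable)

lemma l2_inner_scale_left: "l2_inner M (\<lambda>x. c * f x) h = c * l2_inner M f h"
  unfolding l2_inner_def by (simp add: mult.assoc)

lemma l2_inner_cnj: "cnj (l2_inner M f g) = l2_inner M g f"
  unfolding l2_inner_def by (subst Bochner_Integration.integral_cnj[symmetric]) (simp add: mult.commute)

lemma l2_inner_scale_right: "l2_inner M f (\<lambda>x. c * g x) = cnj c * l2_inner M f g"
  using arg_cong[OF l2_inner_scale_left[of M c g f], of cnj] by (simp add: l2_inner_cnj)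

lemma l2_inner_diff_right:
  "f \<in> l2_space M \<Longrightarrow> g \<in> l2_space M \<Longrightarrow> h \<in> l2_space M \<Longrightarrow>
    l2_inner M h (\<lambda>x. f x - g x) = l2_inner M h f - l2_inner M h g"
  using arg_cong[OF l2_inner_diff_left[of f M g h], of cnj] by (simp add: l2_inner_cnj)

lemma l2_inner_zero [simp]: "l2_inner M (\<lambda>_. 0) g = 0" "l2_inner M g (\<lambda>_. 0) = 0"
  by (simp_all add: l2_inner_def)

lemma l2_inner_sum_left:
  assumes "\<And>i. i \<in> I \<Longrightarrow> f i \<in> l2_space M" "h \<in> l2_space M"
  shows "l2_inner M (\<lambda>x. \<Sum>i\<in>I. c i * f i x) h = (\<Sum>i\<in>I. c i * l2_inner M (f i) h)"
  using assms
proof (induction I rule: infinite_finite_induct)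
  case (insert i I)
  have "l2_inner M (\<lambda>x. c i * f i x + (\<Sum>i\<in>I. c i * f i x)) h =
      l2_inner M (\<lambda>x. c i * f i x) h + l2_inner M (\<lambda>x. \<Sum>i\<in>I. c i * f i x) h"
    by (rule l2_inner_add_left) (use insert.prems in \<open>auto intro!: l2_scale l2_sum\<close>)
  with insert show ?case by (simp add: l2_inner_scale_left)
qed auto

lemma l2_inner_sum_right:
  assumes "\<And>i. i \<in> I \<Longrightarrow> f i \<in> l2_space M" "h \<in> l2_space M"
  shows "l2_inner M h (\<lambda>x. \<Sum>i\<in>I. c i * f i x) = (\<Sum>i\<in>I. cnj (c i) * l2_inner M h (f i))"
proof -
  have "l2_inner M h (\<lambda>x. \<Sum>i\<in>I. c i * f i x) = cnj (\<Sum>i\<in>I. c i * l2_inner M (f i) h)"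
    using assms by (simp flip: l2_inner_sum_left add: l2_inner_cnj)
  then show ?thesis by (simp add: l2_inner_cnj)
qed

lemma l2_inner_cong_AE:
  assumes "AE x in M. f x = f' x" "f \<in> borel_measurable M" "f' \<in> borel_measurable M"
    and "g \<in> borel_measurable M"
  shows "l2_inner M f g = l2_inner M f' g"
  unfolding l2_inner_def by (rule integral_cong_AE) (use assms in auto)

lemma l2_inner_self: "l2_inner M f f = of_real (l2_sq M f)"
  unfolding l2_inner_def l2_sq_def
  by (simp only: integral_complex_of_real[symmetric] complex_norm_square)

lemma l2_sq_nonneg [simp]: "0 \<le> l2_sq M f"
  by (simp add: l2_sq_def)

lemma l2_sq_zero_iff:
  assumes "f \<in> l2_space M"
  shows "l2_sq M f = 0 \<longleftrightarrow> (AE x in M. f x = 0)"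
  unfolding l2_sq_def
  by (subst integral_nonneg_eq_0_iff_AE) (use l2_integrable[OF assms] in auto)

lemma l2_sq_scale: "l2_sq M (\<lambda>x. c * f x) = (norm c)\<^sup>2 * l2_sq M f"
  by (simp add: l2_sq_def norm_mult power_mult_distrib)

lemma l2_sq_cnj: "l2_sq M (\<lambda>x. cnj (f x)) = l2_sq M f"
  by (simp add: l2_sq_def)

lemma l2_norm_eq: "l2_norm M f = sqrt (l2_sq M f)"
  by (simp add: l2_norm_def l2_sq_def)

section \<open>Bessel, Riesz--Fischer and Parseval\<close>

definition orthonormal_on :: "'a measure \<Rightarrow> 'i set \<Rightarrow> ('i \<Rightarrow> 'a \<Rightarrow> complex) \<Rightarrow> bool" where
  "orthonormal_on M I e \<longleftrightarrow> (\<forall>i\<in>I. e i \<in> l2_space M) \<and>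
    (\<forall>i\<in>I. \<forall>j\<in>I. l2_inner M (e i) (e j) = (if i = j then 1 else 0))"

lemma orthonormal_seq_on: "orthonormal_seq M e \<Longrightarrow> orthonormal_on M I e"
  by (simp add: orthonormal_seq_def orthonormal_on_def)

lemma l2_sq_orthonormal_sum:
  assumes "orthonormal_on M I e" "finite I"
  shows "l2_sq M (\<lambda>x. \<Sum>i\<in>I. c i * e i x) = (\<Sum>i\<in>I. (norm (c i))\<^sup>2)"
proof -
  let ?s = "\<lambda>x. \<Sum>i\<in>I. c i * e i x"
  have e: "e i \<in> l2_space M" if "i \<in> I" for i
    using assms(1) that by (simp add: orthonormal_on_def)
  have s: "?s \<in> l2_space M"
    by (intro l2_sum l2_scale e)
  have "l2_inner M ?s ?s = (\<Sum>i\<in>I. c i * (\<Sum>j\<in>I. cnj (c j) * l2_inner M (e i) (e j)))"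
    using e s by (simp add: l2_inner_sum_left l2_inner_sum_right cong: sum.cong)
  also have "\<dots> = (\<Sum>i\<in>I. c i * cnj (c i))"
  proof (intro sum.cong refl)
    fix i assume i: "i \<in> I"
    have "(\<Sum>j\<in>I. cnj (c j) * l2_inner M (e i) (e j)) = (\<Sum>j\<in>I. if j = i then cnj (c j) else 0)"
      using assms(1) i by (intro sum.cong) (auto simp: orthonormal_on_def)
    then show "c i * (\<Sum>j\<in>I. cnj (c j) * l2_inner M (e i) (e j)) = c i * cnj (c i)"
      using i assms(2) by simp
  qed
  finally have "complex_of_real (l2_sq M ?s) = complex_of_real (\<Sum>i\<in>I. (norm (c i))\<^sup>2)"
    unfolding l2_inner_self by (simp only: of_real_sum complex_norm_square)
  then show ?thesis by (simp only: of_real_eq_iff)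
qed

lemma l2_sq_projection:
  assumes e: "orthonormal_on M I e" and I: "finite I" and h: "h \<in> l2_space M"
  shows "l2_sq M (\<lambda>x. h x - (\<Sum>i\<in>I. l2_inner M h (e i) * e i x)) =
    l2_sq M h - (\<Sum>i\<in>I. (norm (l2_inner M h (e i)))\<^sup>2)"
proof -
  let ?c = "\<lambda>i. l2_inner M h (e i)"
  let ?s = "\<lambda>x. \<Sum>i\<in>I. ?c i * e i x"
  let ?B = "\<Sum>i\<in>I. (norm (?c i))\<^sup>2"
  have e': "e i \<in> l2_space M" if "i \<in> I" for i
    using e that by (simp add: orthonormal_on_def)
  have s: "?s \<in> l2_space M"
    by (intro l2_sum l2_scale e')
  have "l2_inner M h ?s = (\<Sum>i\<in>I. cnj (?c i) * ?c i)"
    using e' h by (rule l2_inner_sum_right)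
  then have hs: "l2_inner M h ?s = of_real ?B"
    by (simp only: of_real_sum complex_norm_square mult.commute)
  then have sh: "l2_inner M ?s h = of_real ?B"
    by (metis complex_cnj_complex_of_real l2_inner_cnj)
  have ss: "l2_inner M ?s ?s = of_real ?B"
    unfolding l2_inner_self using l2_sq_orthonormal_sum[OF e I, of ?c] by (rule arg_cong)
  have "complex_of_real (l2_sq M (\<lambda>x. h x - ?s x)) = l2_inner M (\<lambda>x. h x - ?s x) (\<lambda>x. h x - ?s x)"
    by (rule l2_inner_self[symmetric])
  also have "\<dots> = l2_inner M h h - l2_inner M ?s h - (l2_inner M h ?s - l2_inner M ?s ?s)"
    using h s by (simp add: l2_inner_diff_left l2_inner_diff_right l2_diff)
  also have "\<dots> = complex_of_real (l2_sq M h - ?B)"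
    unfolding hs sh ss unfolding l2_inner_self by simp
  finally show ?thesis by (simp only: of_real_eq_iff)
qed

lemma bessel:
  assumes "orthonormal_on M I e" "finite I" "h \<in> l2_space M"
  shows "(\<Sum>i\<in>I. (norm (l2_inner M h (e i)))\<^sup>2) \<le> l2_sq M h"
  using l2_sq_projection[OF assms] l2_sq_nonneg[of M "\<lambda>x. h x - (\<Sum>i\<in>I. l2_inner M h (e i) * e i x)"]
  by linarith

text \<open>Bessel's inequality for the one-element system consisting of g divided by its norm; a
  null g is orthogonal to everything.\<close>

lemma l2_cauchy_schwarz:
  assumes f: "f \<in> l2_space M" and g: "g \<in> l2_space M"
  shows "(norm (l2_inner M f g))\<^sup>2 \<le> l2_sq M f * l2_sq M g"
proof (cases "l2_sq M g = 0")
  case True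
  then have "AE x in M. g x = 0" using l2_sq_zero_iff[OF g] by simp
  then have "l2_inner M g f = l2_inner M (\<lambda>_. 0) f"
    by (rule l2_inner_cong_AE) (use f g in measurable)
  then have "l2_inner M f g = 0"
    by (metis complex_cnj_zero l2_inner_cnj l2_inner_zero(1))
  then show ?thesis by simp
next
  case False
  then have pos: "l2_sq M g > 0" by (simp add: order_less_le)
  define a where "a = complex_of_real (1 / sqrt (l2_sq M g))"
  have a: "(norm a)\<^sup>2 = 1 / l2_sq M g"
    using pos by (simp add: a_def norm_divide power_divide)
  have on: "orthonormal_on M {()} (\<lambda>_ x. a * g x)"
    unfolding orthonormal_on_def
    using pos g by (simp add: l2_scale l2_inner_self l2_sq_scale a)
  have "(norm (l2_inner M f (\<lambda>x. a * g x)))\<^sup>2 \<le> l2_sq M f"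
    using bessel[OF on _ f] by simp
  then have "(norm (l2_inner M f g))\<^sup>2 / l2_sq M g \<le> l2_sq M f"
    unfolding l2_inner_scale_right by (simp add: norm_mult power_mult_distrib a)
  then show ?thesis using pos by (simp add: divide_le_eq)
qed

lemma bessel_summable:
  assumes "orthonormal_seq M e" "h \<in> l2_space M"
  shows "summable (\<lambda>i. (norm (l2_inner M h (e i)))\<^sup>2)"
proof (rule bounded_imp_summable)
  show "(\<Sum>i\<le>n. (norm (l2_inner M h (e i)))\<^sup>2) \<le> l2_sq M h" for n
    using bessel[OF orthonormal_seq_on[OF assms(1)] _ assms(2)] by simp
qed simp

text \<open>Completeness of L2 in the weak form that Parseval asks for. Partial sums along a fast
  subsequence r converge almost everywhere, and Fatou's lemma bounds their mean square distance from
  the limit. Convergence along r is enough, because \<open>parseval\<close> compares it with a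
  series that converges anyway.\<close>

lemma riesz_fischer:
  assumes e: "orthonormal_seq M e" and c: "summable (\<lambda>i. (norm (c i :: complex))\<^sup>2)"
  obtains f r where "f \<in> l2_space M" "filterlim r at_top (sequentially :: nat filter)"
    "\<And>g. g \<in> l2_space M \<Longrightarrow>
      (\<lambda>K. \<Sum>i<r K. c i * l2_inner M (e i) g) \<longlonglongrightarrow> l2_inner M f g"
proof -
  have eI: "orthonormal_on M I e" for I using e by (rule orthonormal_seq_on)
  have el: "e i \<in> l2_space M" for i using e by (simp add: orthonormal_seq_def)
  have "\<exists>N. \<forall>m\<ge>N. \<forall>n. (\<Sum>i\<in>{m..<n}. (norm (c i))\<^sup>2) < (1/4) ^ k" for k :: nat
  proof -
    obtain N where "\<forall>m\<ge>N. \<forall>n. norm (\<Sum>i\<in>{m..<n}. (norm (c i))\<^sup>2) < (1/4) ^ k"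
      using c[unfolded summable_Cauchy, rule_format, of "(1/4) ^ k"] by auto
    then show ?thesis by (intro exI[of _ N]) (auto intro: order_le_less_trans[OF abs_ge_self])
  qed
  then obtain N where N: "\<And>k m n. m \<ge> N k \<Longrightarrow> (\<Sum>i\<in>{m..<n}. (norm (c i))\<^sup>2) < (1/4) ^ k"
    by metis
  define r where "r k = k + (\<Sum>j\<le>k. N j)" for k
  have rN: "N k \<le> r k" for k
    using member_le_sum[of k "{..k}" N] by (simp add: r_def)
  have r_mono: "r j \<le> r k" if "j \<le> k" for j k
    using that unfolding r_def by (intro add_mono sum_mono2) auto
  have r_lim: "filterlim r at_top sequentially"
    by (rule filterlim_at_top_mono[OF filterlim_ident]) (simp add: r_def)
  define s where "s k x = (\<Sum>i<r k. c i * e i x)" for k x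
  have sl: "s k \<in> l2_space M" for k
    unfolding s_def by (intro l2_sum l2_scale el)
  have s_diff: "l2_sq M (\<lambda>x. s n x - s k x) \<le> (1/4) ^ k" if "k \<le> n" for k n
  proof -
    have split: "{..<r n} = {..<r k} \<union> {r k..<r n}"
      using r_mono[OF that] by auto
    have "s n x - s k x = (\<Sum>i\<in>{r k..<r n}. c i * e i x)" for x
      unfolding s_def split by (subst sum.union_disjoint) auto
    then have "l2_sq M (\<lambda>x. s n x - s k x) = (\<Sum>i\<in>{r k..<r n}. (norm (c i))\<^sup>2)"
      using l2_sq_orthonormal_sum[OF eI, of "{r k..<r n}" c] by simp
    also have "\<dots> \<le> (1/4) ^ k"
      using N[OF rN, of k "r n"] by simp
    finally show ?thesis .
  qed
  \<comment> \<open>The increments have squared norms at most (1/4) ^ k. Weighted by 2 ^ k these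
    still form a geometric series, so the weighted squares have a finite sum almost
    everywhere.\<close>
  define d where "d k x = s (Suc k) x - s k x" for k x
  have dl: "d k \<in> l2_space M" for k
    unfolding d_def by (intro l2_diff sl)
  have meas: "d k \<in> borel_measurable M" "s k \<in> borel_measurable M" for k
    using dl sl by (auto simp: l2_space_def)
  note [measurable] = meas
  have "(\<integral>\<^sup>+x. (\<Sum>k. ennreal (2 ^ k * (norm (d k x))\<^sup>2)) \<partial>M) = (\<Sum>k. \<integral>\<^sup>+x. ennreal (2 ^ k * (norm (d k x))\<^sup>2) \<partial>M)"
    by (rule nn_integral_suminf) measurable
  also have "\<dots> = (\<Sum>k. ennreal (2 ^ k * l2_sq M (d k)))"
    unfolding l2_sq_def using l2_integrable[OF dl]
    by (subst nn_integral_eq_integral) auto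
  also have "\<dots> \<le> (\<Sum>k. ennreal ((1/2) ^ k))"
  proof (intro suminf_le ennreal_leI)
    fix k
    have "2 ^ k * l2_sq M (d k) \<le> 2 ^ k * (1/4) ^ k"
      unfolding d_def by (intro mult_left_mono s_diff) auto
    also have "\<dots> = (1/2 :: real) ^ k"
      by (simp flip: power_mult_distrib)
    finally show "2 ^ k * l2_sq M (d k) \<le> (1/2) ^ k" .
  qed auto
  also have "\<dots> < \<infinity>"
    by (subst suminf_ennreal2) (auto simp: summable_geometric)
  finally have "AE x in M. (\<Sum>k. ennreal (2 ^ k * (norm (d k x))\<^sup>2)) \<noteq> \<infinity>"
    by (intro nn_integral_PInf_AE) auto
  then have sum_d: "AE x in M. summable (\<lambda>k. d k x)"
  proof eventually_elim
    case (elim x)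
    then have H: "summable (\<lambda>k. 2 ^ k * (norm (d k x))\<^sup>2)"
      by (intro summable_suminf_not_top) auto
    show ?case
    proof (rule summable_comparison_test')
      show "summable (\<lambda>k. (1/2) ^ k + 2 ^ k * (norm (d k x))\<^sup>2)"
        using H by (intro summable_add summable_geometric) auto
      \<comment> \<open>Either the increment is below (1/2) ^ k, or 2 ^ k times its norm is at least
        1 and the weighted square is at least the norm.\<close>
      show "norm (d k x) \<le> (1/2) ^ k + 2 ^ k * (norm (d k x))\<^sup>2" for k
      proof (cases "norm (d k x) \<le> (1/2) ^ k")
        case True
        then show ?thesis by (simp add: add_increasing2)
      next
        case False
        then have "1 \<le> 2 ^ k * norm (d k x)"
          by (simp add: power_divide field_simps)
        then have "norm (d k x) \<le> 2 ^ k * norm (d k x) * norm (d k x)"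
          using mult_right_mono[of 1 "2 ^ k * norm (d k x)" "norm (d k x)"] by simp
        then show ?thesis by (simp add: power2_eq_square mult.assoc add_increasing)
      qed
    qed
  qed
  define f where "f x = s 0 x + (\<Sum>k. d k x)" for x
  have [measurable]: "f \<in> borel_measurable M"
    unfolding f_def by measurable
  have conv: "AE x in M. (\<lambda>n. s n x) \<longlonglongrightarrow> f x"
    using sum_d
  proof eventually_elim
    case (elim x)
    have s_eq: "(\<lambda>n. s n x) = (\<lambda>n. s 0 x + (\<Sum>k<n. d k x))"
      using sum_lessThan_telescope[of "\<lambda>k. s k x"] by (simp add: d_def)
    show ?case
      unfolding f_def by (subst s_eq) (rule tendsto_add[OF tendsto_const summable_LIMSEQ[OF elim]])
  qed
  have fatou: "(\<integral>\<^sup>+x. ennreal ((norm (f x - s K x))\<^sup>2) \<partial>M) \<le> ennreal ((1/4) ^ K)" for K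
  proof -
    have "(\<integral>\<^sup>+x. ennreal ((norm (f x - s K x))\<^sup>2) \<partial>M) =
        (\<integral>\<^sup>+x. liminf (\<lambda>n. ennreal ((norm (s n x - s K x))\<^sup>2)) \<partial>M)"
    proof (rule nn_integral_cong_AE)
      show "AE x in M. ennreal ((norm (f x - s K x))\<^sup>2) = liminf (\<lambda>n. ennreal ((norm (s n x - s K x))\<^sup>2))"
        using conv
      proof eventually_elim
        case (elim x)
        have "(\<lambda>n. ennreal ((norm (s n x - s K x))\<^sup>2)) \<longlonglongrightarrow> ennreal ((norm (f x - s K x))\<^sup>2)"
          by (intro tendsto_ennrealI tendsto_power tendsto_norm tendsto_diff elim tendsto_const)
        then show ?case
          by (rule lim_imp_Liminf[OF sequentially_bot, symmetric])
      qed
    qed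
    also have "\<dots> \<le> liminf (\<lambda>n. \<integral>\<^sup>+x. ennreal ((norm (s n x - s K x))\<^sup>2) \<partial>M)"
      by (rule nn_integral_liminf) measurable
    also have "\<dots> = liminf (\<lambda>n. ennreal (l2_sq M (\<lambda>x. s n x - s K x)))"
      unfolding l2_sq_def by (subst nn_integral_eq_integral) (auto intro!: l2_integrable l2_diff sl)
    also have "\<dots> \<le> ennreal ((1/4) ^ K)"
    proof -
      have "\<forall>\<^sub>F n in sequentially. ennreal (l2_sq M (\<lambda>x. s n x - s K x)) \<le> ennreal ((1/4) ^ K)"
        by (intro eventually_sequentiallyI[of K] ennreal_leI s_diff)
      from Liminf_mono[OF this] show ?thesis by (simp add: Liminf_const)
    qed
    finally show ?thesis .
  qed
  have fs: "(\<lambda>x. f x - s K x) \<in> l2_space M" for K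
  proof
    show "integrable M (\<lambda>x. (norm (f x - s K x))\<^sup>2)"
      using fatou[of K] by (intro integrableI_nonneg) (auto intro: order_le_less_trans)
  qed measurable
  have f: "f \<in> l2_space M"
    using l2_add[OF fs[of 0] sl[of 0]] by simp
  have f_close: "l2_sq M (\<lambda>x. f x - s K x) \<le> (1/4) ^ K" for K
    using fatou[of K] nn_integral_eq_integral[OF l2_integrable[OF fs[of K]]]
    by (simp add: l2_sq_def)
  show thesis
  proof (rule that[OF f r_lim])
    fix g assume g: "g \<in> l2_space M"
    have "(\<lambda>K. l2_inner M f g - l2_inner M (s K) g) \<longlonglongrightarrow> 0"
    proof (rule tendsto_norm_zero_cancel, rule tendsto_sandwich[OF _ _ tendsto_const])
      show "\<forall>\<^sub>F K in sequentially. norm (l2_inner M f g - l2_inner M (s K) g) \<le>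
          sqrt ((1/4) ^ K * l2_sq M g)"
      proof (intro always_eventually allI real_le_rsqrt)
        fix K
        have "(norm (l2_inner M f g - l2_inner M (s K) g))\<^sup>2 = (norm (l2_inner M (\<lambda>x. f x - s K x) g))\<^sup>2"
          by (simp add: l2_inner_diff_left f g sl)
        also have "\<dots> \<le> l2_sq M (\<lambda>x. f x - s K x) * l2_sq M g"
          by (rule l2_cauchy_schwarz[OF fs g])
        also have "\<dots> \<le> (1/4) ^ K * l2_sq M g"
          by (intro mult_right_mono f_close) simp
        finally show "(norm (l2_inner M f g - l2_inner M (s K) g))\<^sup>2 \<le> (1/4) ^ K * l2_sq M g" .
      qed
      have "(\<lambda>K. sqrt ((1/4) ^ K * l2_sq M g)) \<longlonglongrightarrow> sqrt (0 * l2_sq M g)"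
        by (intro tendsto_real_sqrt tendsto_mult LIMSEQ_realpow_zero tendsto_const) auto
      then show "(\<lambda>K. sqrt ((1/4) ^ K * l2_sq M g)) \<longlonglongrightarrow> 0" by simp
    qed auto
    then have "(\<lambda>K. l2_inner M (s K) g) \<longlonglongrightarrow> l2_inner M f g"
      using tendsto_diff[OF tendsto_const, of "\<lambda>K. l2_inner M f g - l2_inner M (s K) g" 0 sequentially
          "l2_inner M f g"] by simp
    then show "(\<lambda>K. \<Sum>i<r K. c i * l2_inner M (e i) g) \<longlonglongrightarrow> l2_inner M f g"
      unfolding s_def by (subst (asm) l2_inner_sum_left) (auto intro: el g)
  qed
qed

text \<open>The vector rebuilt by \<open>riesz_fischer\<close> from the coefficients of h differs
  from h by something orthogonal to the basis, hence null. Its inner product with g is a limit of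
  partial sums along r; absolute summability, from Bessel for h and for g, identifies that limit
  with the full sum.\<close>

theorem parseval:
  assumes e: "orthonormal_basis M e" and h: "h \<in> l2_space M" and g: "g \<in> l2_space M"
  shows "((\<lambda>i. l2_inner M h (e i) * l2_inner M (e i) g) has_sum l2_inner M h g) UNIV"
proof -
  have on: "orthonormal_seq M e" using e by (simp add: orthonormal_basis_def)
  have el: "e i \<in> l2_space M" for i using on by (simp add: orthonormal_seq_def)
  define c where "c i = l2_inner M h (e i)" for i
  have c: "summable (\<lambda>i. (norm (c i))\<^sup>2)"
    unfolding c_def by (rule bessel_summable[OF on h])
  obtain f r where f: "f \<in> l2_space M" and r: "filterlim r at_top (sequentially :: nat filter)"
    and lim: "\<And>g. g \<in> l2_space M \<Longrightarrow>
      (\<lambda>K. \<Sum>i<r K. c i * l2_inner M (e i) g) \<longlonglongrightarrow> l2_inner M f g"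
    using riesz_fischer[OF on c] by blast
  have "l2_inner M f (e n) = c n" for n
  proof (rule LIMSEQ_unique[OF lim[OF el]])
    have "\<forall>\<^sub>F K in sequentially. n < r K"
      using r eventually_gt_at_top[of n] unfolding filterlim_iff by blast
    then have "\<forall>\<^sub>F K in sequentially. (\<Sum>i<r K. c i * l2_inner M (e i) (e n)) = c n"
    proof eventually_elim
      case (elim K)
      have "(\<Sum>i<r K. c i * l2_inner M (e i) (e n)) = (\<Sum>i<r K. if i = n then c i else 0)"
        using on by (intro sum.cong) (auto simp: orthonormal_seq_def)
      then show ?case using elim by simp
    qed
    then show "(\<lambda>K. \<Sum>i<r K. c i * l2_inner M (e i) (e n)) \<longlonglongrightarrow> c n"
      by (rule tendsto_eventually)
  qed
  then have "\<forall>n. l2_inner M (\<lambda>x. h x - f x) (e n) = 0"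
    by (simp add: l2_inner_diff_left h f el c_def)
  then have "AE x in M. h x - f x = 0"
    using e l2_diff[OF h f] unfolding orthonormal_basis_def by blast
  then have hf: "l2_inner M h g = l2_inner M f g"
    by (intro l2_inner_cong_AE) (use h f g in auto)
  have "summable (\<lambda>i. norm (c i * l2_inner M (e i) g))"
  proof (rule summable_comparison_test')
    show "summable (\<lambda>i. (norm (c i))\<^sup>2 + (norm (l2_inner M g (e i)))\<^sup>2)"
      by (intro summable_add c bessel_summable on g)
    show "norm (norm (c i * l2_inner M (e i) g)) \<le> (norm (c i))\<^sup>2 + (norm (l2_inner M g (e i)))\<^sup>2" for i
    proof -
      have "norm (l2_inner M (e i) g) = norm (l2_inner M g (e i))"
        by (metis complex_mod_cnj l2_inner_cnj)
      then show ?thesis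
        using norm_mult_le_squares[of "c i" "l2_inner M (e i) g"] by simp
    qed
  qed
  then have sums: "((\<lambda>i. c i * l2_inner M (e i) g) has_sum (\<Sum>i. c i * l2_inner M (e i) g)) UNIV"
    by (intro norm_summable_imp_has_sum) (auto intro: summable_norm_cancel)
  have "(\<lambda>n. \<Sum>i<n. c i * l2_inner M (e i) g) \<longlonglongrightarrow> (\<Sum>i. c i * l2_inner M (e i) g)"
    using has_sum_imp_sums[OF sums] by (simp add: sums_def)
  from LIMSEQ_unique[OF filterlim_compose[OF this r] lim[OF g]] sums show ?thesis
    by (simp add: hf c_def)
qed

section \<open>Gram--Schmidt orthonormalization and the existence of bases\<close>

definition l2_normalize :: "'a measure \<Rightarrow> ('a \<Rightarrow> complex) \<Rightarrow> 'a \<Rightarrow> complex" where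
  "l2_normalize M f = (\<lambda>x. (if l2_sq M f = 0 then 0 else complex_of_real (1 / sqrt (l2_sq M f))) * f x)"

text \<open>Vectors that depend on their predecessors are mapped to 0 instead of being dropped, which
  keeps the recursion plain.\<close>

fun gram_schmidt :: "'a measure \<Rightarrow> (nat \<Rightarrow> 'a \<Rightarrow> complex) \<Rightarrow> nat \<Rightarrow> 'a \<Rightarrow> complex" where
  "gram_schmidt M v n =
    l2_normalize M (\<lambda>x. v n x - (\<Sum>i<n. l2_inner M (v n) (gram_schmidt M v i) * gram_schmidt M v i x))"

declare gram_schmidt.simps [simp del]

lemma l2_sq_normalize: "l2_sq M (l2_normalize M f) = (if l2_sq M f = 0 then 0 else 1)"
  using l2_sq_nonneg[of M f] unfolding l2_normalize_def l2_sq_scale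
  by (auto simp: norm_divide power_divide)

lemma gram_schmidt_l2:
  assumes "\<And>n. v n \<in> l2_space M"
  shows "gram_schmidt M v n \<in> l2_space M"
proof (induction n rule: less_induct)
  case (less n)
  then show ?case
    by (subst gram_schmidt.simps, unfold l2_normalize_def) (intro l2_scale l2_diff l2_sum assms, simp)
qed

lemma gram_schmidt_sq: "l2_sq M (gram_schmidt M v n) \<in> {0, 1}"
  by (subst gram_schmidt.simps) (simp add: l2_sq_normalize)

lemma gram_schmidt_orthogonal:
  assumes v: "\<And>n. v n \<in> l2_space M" and "i \<noteq> j"
  shows "l2_inner M (gram_schmidt M v i) (gram_schmidt M v j) = 0"
proof -
  let ?w = "gram_schmidt M v"
  note w = gram_schmidt_l2[of v M, OF v]
  have lt: "\<forall>m<n. l2_inner M (?w n) (?w m) = 0" for n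
  proof (induction n rule: less_induct)
    case (less n)
    show ?case
    proof (intro allI impI)
      fix m assume m: "m < n"
      have orth: "l2_inner M (?w i) (?w m) = 0" if "i < n" "i \<noteq> m" for i
        using less[OF that(1)] less[OF m] that
        by (metis complex_cnj_zero l2_inner_cnj linorder_neqE_nat)
      have "l2_inner M (\<lambda>x. v n x - (\<Sum>i<n. l2_inner M (v n) (?w i) * ?w i x)) (?w m) =
          l2_inner M (v n) (?w m) - (\<Sum>i<n. l2_inner M (v n) (?w i) * l2_inner M (?w i) (?w m))"
        using w v by (subst l2_inner_diff_left) (auto intro!: l2_sum l2_scale simp: l2_inner_sum_left)
      also have "(\<Sum>i<n. l2_inner M (v n) (?w i) * l2_inner M (?w i) (?w m)) =
          (\<Sum>i<n. if i = m then l2_inner M (v n) (?w m) * l2_inner M (?w m) (?w m) else 0)"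
        using orth by (intro sum.cong) auto
      also have "\<dots> = l2_inner M (v n) (?w m) * of_real (l2_sq M (?w m))"
        using m by (simp add: l2_inner_self)
      finally have "l2_inner M (\<lambda>x. v n x - (\<Sum>i<n. l2_inner M (v n) (?w i) * ?w i x)) (?w m) =
          l2_inner M (v n) (?w m) * (1 - of_real (l2_sq M (?w m)))"
        by (simp add: algebra_simps)
      \<comment> \<open>A null \<open>?w m\<close> has norm factor 0 instead of 1 in the formula
        above, but by Cauchy--Schwarz the inner product itself vanishes.\<close>
      moreover have "l2_inner M (v n) (?w m) = 0" if "l2_sq M (?w m) = 0"
        using l2_cauchy_schwarz[OF v[of n] w[of m]] that by simp
      ultimately have "l2_inner M (\<lambda>x. v n x - (\<Sum>i<n. l2_inner M (v n) (?w i) * ?w i x)) (?w m) = 0"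
        using gram_schmidt_sq[of M v m] by auto
      then show "l2_inner M (?w n) (?w m) = 0"
        by (subst gram_schmidt.simps) (simp only: l2_normalize_def l2_inner_scale_left mult_zero_right)
    qed
  qed
  show ?thesis
  proof (cases "i < j")
    case True
    then show ?thesis using lt[of j] by (metis complex_cnj_zero l2_inner_cnj)
  next
    case False
    then show ?thesis using lt[of i] assms(2) by simp
  qed
qed

text \<open>The n-th residual u is a multiple of the n-th output, or null and then covered by
  Cauchy--Schwarz. Thus nothing is lost by mapping dependent vectors to 0.\<close>

lemma gram_schmidt_orthogonal_complement:
  assumes v: "\<And>n. v n \<in> l2_space M" and h: "h \<in> l2_space M"
    and orth: "\<And>n. l2_inner M h (gram_schmidt M v n) = 0"
  shows "l2_inner M h (v n) = 0"
proof -
  let ?w = "gram_schmidt M v"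
  note w = gram_schmidt_l2[of v M, OF v]
  define u where "u = (\<lambda>x. v n x - (\<Sum>i<n. l2_inner M (v n) (?w i) * ?w i x))"
  have u: "u \<in> l2_space M"
    unfolding u_def by (intro l2_diff l2_sum l2_scale v w)
  have "l2_inner M h u = 0"
  proof (cases "l2_sq M u = 0")
    case True
    then show ?thesis using l2_cauchy_schwarz[OF h u] by simp
  next
    case False
    have "?w n = l2_normalize M u"
      unfolding u_def by (rule gram_schmidt.simps)
    then have "l2_inner M h (l2_normalize M u) = 0"
      using orth[of n] by simp
    then show ?thesis using False l2_sq_nonneg[of M u]
      unfolding l2_normalize_def l2_inner_scale_right by simp
  qed
  moreover have "l2_inner M h u = l2_inner M h (v n) -
      (\<Sum>i<n. cnj (l2_inner M (v n) (?w i)) * l2_inner M h (?w i))"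
    unfolding u_def using w v h
    by (subst l2_inner_diff_right) (auto intro!: l2_sum l2_scale simp: l2_inner_sum_right)
  ultimately show ?thesis using orth by simp
qed

text \<open>The nonzero outputs of Gram--Schmidt form a complete orthonormal family. To be
  enumerated by all natural numbers there must be infinitely many, and the given orthonormal
  sequence d excludes a finite number.\<close>

lemma exists_orthonormal_basis_of_total:
  assumes v: "\<And>n :: nat. v n \<in> l2_space M"
    and total: "\<And>h. h \<in> l2_space M \<Longrightarrow> (\<And>n. l2_inner M h (v n) = 0) \<Longrightarrow> AE x in M. h x = 0"
    and d: "orthonormal_seq M d"
  shows "\<exists>e. orthonormal_basis M e"
proof -
  let ?w = "gram_schmidt M v"
  define I where "I = {n. l2_sq M (?w n) = 1}"
  note w = gram_schmidt_l2[of v M, OF v]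
  have on: "orthonormal_on M I ?w"
    unfolding orthonormal_on_def
    using w gram_schmidt_orthogonal[of v M, OF v] by (auto simp: I_def l2_inner_self)
  have zero: "l2_inner M h (?w n) = 0" if "n \<notin> I" "h \<in> l2_space M" for n h
    using gram_schmidt_sq[of M v n] that l2_cauchy_schwarz[OF that(2) w[of n]] by (auto simp: I_def)
  have complete: "AE x in M. h x = 0" if h: "h \<in> l2_space M" and "\<And>n. n \<in> I \<Longrightarrow> l2_inner M h (?w n) = 0" for h
  proof (rule total[OF h])
    show "l2_inner M h (v n) = 0" for n
      by (rule gram_schmidt_orthogonal_complement[of v M, OF v h]) (use that zero in blast)
  qed
  have "infinite I"
  proof
    assume fin: "finite I"
    have dl: "d k \<in> l2_space M" for k using d by (simp add: orthonormal_seq_def)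
    have one: "(\<Sum>i\<in>I. (norm (l2_inner M (d k) (?w i)))\<^sup>2) = 1" for k
    proof -
      let ?r = "\<lambda>x. d k x - (\<Sum>i\<in>I. l2_inner M (d k) (?w i) * ?w i x)"
      have r: "?r \<in> l2_space M"
        by (intro l2_diff l2_sum l2_scale dl w)
      have "l2_inner M ?r (?w n) = 0" if "n \<in> I" for n
      proof -
        have "l2_inner M ?r (?w n) = l2_inner M (d k) (?w n) -
            (\<Sum>i\<in>I. l2_inner M (d k) (?w i) * l2_inner M (?w i) (?w n))"
          using w dl by (subst l2_inner_diff_left) (auto intro!: l2_sum l2_scale simp: l2_inner_sum_left)
        also have "(\<Sum>i\<in>I. l2_inner M (d k) (?w i) * l2_inner M (?w i) (?w n)) =
            (\<Sum>i\<in>I. if i = n then l2_inner M (d k) (?w n) else 0)"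
          using on that by (intro sum.cong) (auto simp: orthonormal_on_def)
        finally show ?thesis using that fin by simp
      qed
      then have "l2_sq M ?r = 0"
        using complete[OF r] l2_sq_zero_iff[OF r] by blast
      moreover have "l2_sq M (d k) = 1"
      proof -
        have "complex_of_real (l2_sq M (d k)) = 1"
          using d unfolding l2_inner_self[symmetric] by (simp add: orthonormal_seq_def)
        then show ?thesis by (simp only: of_real_eq_1_iff)
      qed
      ultimately show ?thesis
        using l2_sq_projection[OF on fin dl[of k]] by linarith
    qed
    \<comment> \<open>One more vector of d than there are nonzero outputs: each has coefficients of
      total square 1, while Bessel's inequality for d, applied to each output, allows at most
      \<open>card I\<close> altogether.\<close>
    define K where "K = Suc (card I)"
    have "real K = (\<Sum>k<K. \<Sum>i\<in>I. (norm (l2_inner M (d k) (?w i)))\<^sup>2)"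
      using one by simp
    also have "\<dots> = (\<Sum>i\<in>I. \<Sum>k<K. (norm (l2_inner M (?w i) (d k)))\<^sup>2)"
    proof -
      have "norm (l2_inner M (d k) (?w i)) = norm (l2_inner M (?w i) (d k))" for k i
        by (metis complex_mod_cnj l2_inner_cnj)
      then show ?thesis by (subst sum.swap) (simp only:)
    qed
    also have "\<dots> \<le> (\<Sum>i\<in>I. l2_sq M (?w i))"
      by (intro sum_mono bessel orthonormal_seq_on d w) simp
    also have "\<dots> = real (card I)"
      by (simp add: I_def)
    finally show False by (simp add: K_def)
  qed
  define e where "e k = ?w (enumerate I k)" for k
  have en: "enumerate I k \<in> I" for k
    using \<open>infinite I\<close> by (rule enumerate_in_set)
  have "orthonormal_seq M e"
    unfolding orthonormal_seq_def e_def
    using on en w strict_mono_enumerate[OF \<open>infinite I\<close>]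
    by (auto simp: orthonormal_on_def strict_mono_eq)
  moreover have "AE x in M. h x = 0" if h: "h \<in> l2_space M" and "\<forall>n. l2_inner M h (e n) = 0" for h
  proof (rule complete[OF h])
    fix n assume "n \<in> I"
    then obtain k where "enumerate I k = n"
      using enumerate_Ex[OF \<open>infinite I\<close>] by auto
    then show "l2_inner M h (?w n) = 0" using that(2) by (auto simp: e_def)
  qed
  ultimately show ?thesis
    unfolding orthonormal_basis_def by blast
qed

lemma l2_indicator:
  assumes "A \<in> sets M" "emeasure M A < \<infinity>"
  shows "(\<lambda>x. indicator A x :: complex) \<in> l2_space M"
proof
  have "(\<lambda>x. (norm (indicator A x :: complex))\<^sup>2) = (\<lambda>x. indicator A x :: real)"
    by (auto simp: indicator_def)
  then show "integrable M (\<lambda>x. (norm (indicator A x :: complex))\<^sup>2)"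
    using assms by (simp add: integrable_indicator_iff)
qed (use assms in measurable)

text \<open>The indicators of A \<inter> B n are total, with A from the countable generator and B n
  from a cover by sets of finite measure: a function orthogonal to all of them has vanishing
  integrals over an intersection-stable generator, hence over all measurable sets.\<close>

lemma exists_orthonormal_basis:
  assumes sf: "sigma_finite_measure M" and gen: "sets M = sigma_sets (space M) E"
    and E: "countable E" "Int_stable E" "E \<subseteq> Pow (space M)" "space M \<in> E"
    and d: "orthonormal_seq M d"
  shows "\<exists>e. orthonormal_basis M e"
proof -
  interpret sigma_finite_measure M by fact
  obtain B :: "nat \<Rightarrow> 'a set" where B: "range B \<subseteq> sets M" "(\<Union>i. B i) = space M"
    "\<And>i. emeasure M (B i) \<noteq> \<infinity>"
    using sigma_finite by blast
  have Bs: "B n \<in> sets M" for n using B(1) by auto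
  define F where "F = (\<lambda>(A, n). A \<inter> B n) ` (E \<times> UNIV)"
  have F: "countable F" "F \<noteq> {}"
    using E by (auto simp: F_def)
  have Es: "A \<in> sets M" if "A \<in> E" for A
    unfolding gen using that by (rule sigma_sets.Basic)
  have FM: "A \<in> sets M \<and> emeasure M A < \<infinity>" if "A \<in> F" for A
  proof -
    from that obtain p where "p \<in> E \<times> UNIV" "A = (\<lambda>(A, n). A \<inter> B n) p"
      unfolding F_def by (rule imageE)
    then have A: "A = fst p \<inter> B (snd p)" "fst p \<in> E"
      by (auto simp: case_prod_beta)
    have "emeasure M A \<le> emeasure M (B (snd p))"
      unfolding A(1) using Bs by (intro emeasure_mono) auto
    then show ?thesis using A Es Bs B(3)[of "snd p"] by (auto simp: less_top[symmetric] top_unique)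
  qed
  define v where "v n = (\<lambda>x. indicator (from_nat_into F n) x :: complex)" for n
  have vl: "v n \<in> l2_space M" for n
    unfolding v_def using FM[OF from_nat_into[OF F(2)]] by (intro l2_indicator) auto
  show ?thesis
  proof (rule exists_orthonormal_basis_of_total[OF vl _ d])
    fix h assume h: "h \<in> l2_space M" and orth: "\<And>n. l2_inner M h (v n) = 0"
    have h0: "(\<integral>x. h x * indicator A x \<partial>M) = 0" if A: "A \<in> F" for A
    proof -
      obtain n where "from_nat_into F n = A"
        using from_nat_into_surj[OF F(1) A] by blast
      then have "v n = (\<lambda>x. indicator A x)" by (simp add: v_def)
      moreover have "cnj (indicator A x) = indicator A x" for x by (simp add: indicator_def)
      ultimately show ?thesis using orth[of n] by (simp add: l2_inner_def)
    qed
    have "AE x in M. indicator (B n) x *\<^sub>R h x = 0" for n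
    proof -
      \<comment> \<open>h is only square integrable; cutting it off to a set of finite measure makes
        it integrable.\<close>
      let ?g = "\<lambda>x. indicator (B n) x *\<^sub>R h x"
      have fin: "emeasure M (B n) < \<infinity>" using B(3)[of n] by (simp add: less_top)
      have int: "integrable M ?g"
        using l2_integrable_mult[OF l2_indicator[OF Bs fin] h]
        by (rule Bochner_Integration.integrable_cong[THEN iffD1, OF refl, rotated]) (auto simp: indicator_def)
      have si: "set_integrable M A ?g" if "A \<in> sets M" for A
        unfolding set_integrable_def using that int by (rule integrable_mult_indicator)
      have eq: "set_lebesgue_integral M A ?g = (\<integral>x. h x * indicator (A \<inter> B n) x \<partial>M)" for A
        unfolding set_lebesgue_integral_def
        by (intro Bochner_Integration.integral_cong) (auto simp: indicator_def)
      have sp: "set_lebesgue_integral M (space M) ?g = 0"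
        unfolding eq by (intro h0) (use E(4) in \<open>auto simp: F_def\<close>)
      have "set_lebesgue_integral M A ?g = 0" if "A \<in> sets M" for A
        using E(2,3) that[unfolded gen]
      proof (induction rule: sigma_sets_induct_disjoint)
        case (basic A)
        then show ?case unfolding eq by (intro h0) (auto simp: F_def)
      next
        case empty
        show ?case by (simp add: set_lebesgue_integral_def)
      next
        case (compl A)
        then have A: "A \<in> sets M" by (simp add: gen)
        have "set_lebesgue_integral M (A \<union> (space M - A)) ?g =
            set_lebesgue_integral M A ?g + set_lebesgue_integral M (space M - A) ?g"
          by (rule set_integral_Un) (use A in \<open>auto intro!: si\<close>)
        moreover have "A \<union> (space M - A) = space M"
          using sets.sets_into_space[OF A] by auto
        ultimately show ?case using sp compl by simp
      next
        case (union A)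
        then have "\<And>i. A i \<in> sets M" by (auto simp: gen)
        then have "set_lebesgue_integral M (\<Union>i. A i) ?g = (\<Sum>i. set_lebesgue_integral M (A i) ?g)"
          using union(1) by (intro lebesgue_integral_countable_add si)
            (auto simp: disjoint_family_on_def)
        then show ?case using union by simp
      qed
      then show ?thesis
        by (intro density_unique_banach[where f = ?g and f' = "\<lambda>_. 0"] int) auto
    qed
    then have "AE x in M. \<forall>n. indicator (B n) x *\<^sub>R h x = 0"
      by (intro AE_all_countable[THEN iffD2] allI)
    then show "AE x in M. h x = 0"
      using AE_space
    proof eventually_elim
      case (elim x)
      then obtain n where "x \<in> B n" using B(2) by auto
      with elim show ?case by (auto simp: indicator_def dest!: spec[of _ n])
    qed
  qed
qed

text \<open>Finite intersections of a countable topological basis; the empty intersection supplies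
  \<open>UNIV\<close>.\<close>

lemma borel_countable_Int_stable_generator:
  obtains E :: "'a :: second_countable_topology set set"
  where "countable E" "Int_stable E" "UNIV \<in> E" "sets borel = sigma_sets UNIV E"
proof -
  obtain B :: "'a set set" where B: "countable B" "topological_basis B"
    using ex_countable_basis by blast
  let ?E = "Inter ` {F. finite F \<and> F \<subseteq> B}"
  have borel: "sets borel = sigma_sets UNIV B"
    by (subst borel_eq_countable_basis[OF B]) simp
  show thesis
  proof (rule that)
    show "countable ?E"
      using B(1) by (intro countable_image countable_Collect_finite_subset)
    show "Int_stable ?E"
    proof (rule Int_stableI_image)
      fix F G assume "F \<in> {F. finite F \<and> F \<subseteq> B}" "G \<in> {F. finite F \<and> F \<subseteq> B}"
      then show "\<exists>k\<in>{F. finite F \<and> F \<subseteq> B}. \<Inter>F \<inter> \<Inter>G = \<Inter>k"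
        by (intro bexI[of _ "F \<union> G"]) auto
    qed
    show "UNIV \<in> ?E" by (intro image_eqI[of _ _ "{}"]) auto
    have "?E \<subseteq> sigma_sets UNIV B"
    proof safe
      fix F assume F: "finite F" "F \<subseteq> B"
      have "F \<subseteq> sets borel" using F(2) borel by auto
      with F(1) have "\<Inter>F \<in> sets borel"
        by (induction F rule: finite_induct) auto
      then show "\<Inter>F \<in> sigma_sets UNIV B" by (simp add: borel)
    qed
    moreover have "B \<subseteq> ?E"
    proof
      fix A assume "A \<in> B"
      then show "A \<in> ?E" by (intro image_eqI[of _ _ "{A}"]) auto
    qed
    ultimately show "sets borel = sigma_sets UNIV ?E"
      unfolding borel by (intro sigma_sets_eqI) auto
  qed
qed

lemma exists_orthonormal_basis_borel:
  fixes M :: "'a :: second_countable_topology measure"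
  assumes "sigma_finite_measure M" "sets M = sets borel" "orthonormal_seq M d"
  shows "\<exists>e. orthonormal_basis M e"
proof -
  obtain E :: "'a set set" where E: "countable E" "Int_stable E" "UNIV \<in> E" "sets borel = sigma_sets UNIV E"
    by (rule borel_countable_Int_stable_generator)
  have "space M = UNIV" using sets_eq_imp_space_eq[OF assms(2)] by simp
  then show ?thesis
    using assms E by (intro exists_orthonormal_basis[of M E d]) auto
qed

lemma exists_orthonormal_basis_restrict:
  fixes M :: "'a :: second_countable_topology measure"
  assumes sf: "sigma_finite_measure M" and M: "sets M = sets borel" and S: "S \<in> sets borel"
    and d: "orthonormal_seq (restrict_space M S) d"
  shows "\<exists>e. orthonormal_basis (restrict_space M S) e"
proof -
  obtain E :: "'a set set" where E: "countable E" "Int_stable E" "UNIV \<in> E" "sets borel = sigma_sets UNIV E"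
    by (rule borel_countable_Int_stable_generator)
  have sp: "space (restrict_space M S) = S"
    using sets_eq_imp_space_eq[OF M] by (simp add: space_restrict_space)
  have "sets (restrict_space M S) = (\<inter>) S ` sigma_sets UNIV E"
    by (simp add: sets_restrict_space M E(4))
  also have "\<dots> = sigma_sets S ((\<inter>) S ` E)"
    by (rule sigma_sets_Int) (use S E in auto)
  finally have gen: "sets (restrict_space M S) = sigma_sets S ((\<inter>) S ` E)" .
  show ?thesis
  proof (rule exists_orthonormal_basis[OF _ _ _ _ _ _ d, of "(\<inter>) S ` E"])
    show "sigma_finite_measure (restrict_space M S)"
      using sf S M by (intro sigma_finite_measure_restrict_space) auto
    show "Int_stable ((\<inter>) S ` E)"
    proof (rule Int_stableI_image)
      fix A B assume "A \<in> E" "B \<in> E"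
      then show "\<exists>C\<in>E. S \<inter> A \<inter> (S \<inter> B) = S \<inter> C"
        using E(2) by (intro bexI[of _ "A \<inter> B"]) (auto simp: Int_stable_def)
    qed
    show "space (restrict_space M S) \<in> (\<inter>) S ` E"
      unfolding sp using E(3) by (intro image_eqI[of _ _ UNIV]) auto
  qed (use E gen sp in auto)
qed

text \<open>Ensures that bases can be indexed by the natural numbers.\<close>

lemma orthonormal_seq_disjoint_sets:
  assumes A: "\<And>n :: nat. A n \<in> sets M" and dis: "disjoint_family A"
    and fin: "\<And>n. emeasure M (A n) < \<infinity>" and pos: "\<And>n. emeasure M (A n) \<noteq> 0"
  shows "\<exists>d. orthonormal_seq M d"
proof
  let ?a = "\<lambda>n. complex_of_real (1 / sqrt (measure M (A n)))"
  let ?f = "\<lambda>n x. indicator (A n) x :: complex"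
  have m: "measure M (A n) > 0" for n
    using fin[of n] pos[of n] by (simp add: measure_def enn2real_positive_iff less_top zero_less_iff_neq_zero)
  have "l2_inner M (\<lambda>x. ?a m * ?f m x) (\<lambda>x. ?a n * ?f n x) = (if m = n then 1 else 0)" for m n
  proof (cases "m = n")
    case True
    have "l2_inner M (?f n) (?f n) = (\<integral>x. complex_of_real (indicator (A n) x) \<partial>M)"
      unfolding l2_inner_def by (intro Bochner_Integration.integral_cong) (auto simp: indicator_def)
    also have "\<dots> = of_real (measure M (A n))"
      using fin[of n] A[of n] sets.sets_into_space[OF A[of n]]
      by (simp only: integral_complex_of_real) (simp add: Int_absorb1 Int_absorb2)
    finally have "l2_inner M (?f n) (?f n) = of_real (measure M (A n))" .
    then show ?thesis
      unfolding l2_inner_scale_left l2_inner_scale_right True using m[of n]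
      by (simp flip: of_real_mult)
  next
    case False
    then have "?f m x * cnj (?f n x) = 0" for x
      using disjoint_family_onD[OF dis, of m n] by (auto simp: indicator_def)
    then have "l2_inner M (?f m) (?f n) = 0"
      unfolding l2_inner_def by (simp only: integral_zero)
    then show ?thesis
      unfolding l2_inner_scale_left l2_inner_scale_right using False by simp
  qed
  then show "orthonormal_seq M (\<lambda>n x. ?a n * ?f n x)"
    unfolding orthonormal_seq_def by (intro conjI allI l2_scale l2_indicator A fin)
qed

section \<open>Dominated kernels\<close>

text \<open>Stronger than square integrability on the product, which would control only almost every
  section. Under this majorant each section is square integrable, so operators and compositions make
  sense at every point, and the class is closed under composition, sums and adjoints.\<close>

definition dominated_kernel :: "'a measure \<Rightarrow> 'b measure \<Rightarrow> ('a \<Rightarrow> 'b \<Rightarrow> complex) \<Rightarrow> bool" where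
  "dominated_kernel A B k \<longleftrightarrow> case_prod k \<in> borel_measurable (A \<Otimes>\<^sub>M B) \<and>
    (\<exists>\<alpha> \<beta>. \<alpha> \<in> l2_space A \<and> \<beta> \<in> l2_space B \<and>
      (\<forall>x\<in>space A. \<forall>y\<in>space B. norm (k x y) \<le> norm (\<alpha> x) * norm (\<beta> y)))"

definition kernel_op :: "'b measure \<Rightarrow> ('a \<Rightarrow> 'b \<Rightarrow> complex) \<Rightarrow> ('b \<Rightarrow> complex) \<Rightarrow> 'a \<Rightarrow> complex" where
  "kernel_op B k h x = (\<integral>y. k x y * h y \<partial>B)"

definition kernel_comp ::
  "'b measure \<Rightarrow> ('a \<Rightarrow> 'b \<Rightarrow> complex) \<Rightarrow> ('b \<Rightarrow> 'c \<Rightarrow> complex) \<Rightarrow> 'a \<Rightarrow> 'c \<Rightarrow> complex" where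
  "kernel_comp B k l x z = (\<integral>y. k x y * l y z \<partial>B)"

text \<open>The output vector comes first, so that \<open>kernel_form A B k (e i) (u n)\<close> is
  the matrix entry in row i and column n.\<close>

definition kernel_form ::
  "'a measure \<Rightarrow> 'b measure \<Rightarrow> ('a \<Rightarrow> 'b \<Rightarrow> complex) \<Rightarrow> ('a \<Rightarrow> complex) \<Rightarrow> ('b \<Rightarrow> complex) \<Rightarrow> complex" where
  "kernel_form A B k g h = l2_inner A (kernel_op B k h) g"

lemma dominated_kernel_measurable:
  "dominated_kernel A B k \<Longrightarrow> case_prod k \<in> borel_measurable (A \<Otimes>\<^sub>M B)"
  by (simp add: dominated_kernel_def)

lemma dominated_kernelE:
  assumes "dominated_kernel A B k"
  obtains \<alpha> \<beta> where "\<alpha> \<in> l2_space A" "\<beta> \<in> l2_space B"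
    "\<And>x y. x \<in> space A \<Longrightarrow> y \<in> space B \<Longrightarrow> norm (k x y) \<le> norm (\<alpha> x) * norm (\<beta> y)"
  using assms unfolding dominated_kernel_def by blast

lemma dominated_kernelI:
  assumes "case_prod k \<in> borel_measurable (A \<Otimes>\<^sub>M B)" "\<alpha> \<in> l2_space A" "\<beta> \<in> l2_space B"
    "\<And>x y. x \<in> space A \<Longrightarrow> y \<in> space B \<Longrightarrow> norm (k x y) \<le> norm (\<alpha> x) * norm (\<beta> y)"
  shows "dominated_kernel A B k"
  using assms unfolding dominated_kernel_def by blast

lemma l2_dominated:
  assumes f: "f \<in> borel_measurable M" and g: "g \<in> l2_space M"
    and le: "\<And>x. x \<in> space M \<Longrightarrow> norm (f x) \<le> norm (c * g x)"
  shows "f \<in> l2_space M" "l2_sq M f \<le> (norm c)\<^sup>2 * l2_sq M g"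
proof -
  have cg: "(\<lambda>x. c * g x) \<in> l2_space M" using g by (rule l2_scale)
  have le': "(norm (f x))\<^sup>2 \<le> (norm (c * g x))\<^sup>2" if "x \<in> space M" for x
    by (intro power_mono le that) simp
  show f: "f \<in> l2_space M"
  proof
    show "integrable M (\<lambda>x. (norm (f x))\<^sup>2)"
      by (rule Bochner_Integration.integrable_bound[OF l2_integrable[OF cg]])
        (use f le' in \<open>auto intro!: AE_I2\<close>)
  qed fact
  have "l2_sq M f \<le> l2_sq M (\<lambda>x. c * g x)"
    unfolding l2_sq_def by (intro integral_mono l2_integrable f cg le')
  then show "l2_sq M f \<le> (norm c)\<^sup>2 * l2_sq M g"
    by (simp add: l2_sq_scale)
qed

lemma dominated_kernel_adjoint:
  assumes "dominated_kernel A B k"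
  shows "dominated_kernel B A (\<lambda>y x. cnj (k x y))"
proof -
  obtain \<alpha> \<beta> where ab: "\<alpha> \<in> l2_space A" "\<beta> \<in> l2_space B"
    "\<And>x y. x \<in> space A \<Longrightarrow> y \<in> space B \<Longrightarrow> norm (k x y) \<le> norm (\<alpha> x) * norm (\<beta> y)"
    using assms by (rule dominated_kernelE) blast
  have [measurable]: "case_prod k \<in> borel_measurable (A \<Otimes>\<^sub>M B)"
    using assms by (rule dominated_kernel_measurable)
  have "(\<lambda>(y, x). cnj (k x y)) \<in> borel_measurable (B \<Otimes>\<^sub>M A)"
    by measurable
  then show ?thesis
    by (rule dominated_kernelI[OF _ ab(2,1)]) (use ab(3) in \<open>auto simp: mult.commute\<close>)
qed

lemma kernel_section_l2:
  assumes k: "dominated_kernel A B k" and x: "x \<in> space A"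
  shows "k x \<in> l2_space B"
proof -
  obtain \<alpha> \<beta> where ab: "\<alpha> \<in> l2_space A" "\<beta> \<in> l2_space B"
    "\<And>x y. x \<in> space A \<Longrightarrow> y \<in> space B \<Longrightarrow> norm (k x y) \<le> norm (\<alpha> x) * norm (\<beta> y)"
    using k by (rule dominated_kernelE) blast
  have [measurable]: "case_prod k \<in> borel_measurable (A \<Otimes>\<^sub>M B)"
    using k by (rule dominated_kernel_measurable)
  have "k x \<in> borel_measurable B" using x by measurable
  then show ?thesis
    by (rule l2_dominated(1)[OF _ ab(2), of _ "\<alpha> x"]) (use ab(3) x in \<open>simp add: norm_mult\<close>)
qed

lemma kernel_bound:
  assumes k: "dominated_kernel A B k"
  obtains \<alpha> where "\<alpha> \<in> l2_space A" "\<And>x. x \<in> space A \<Longrightarrow> l2_sq B (k x) \<le> (norm (\<alpha> x))\<^sup>2"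
proof -
  obtain \<alpha> \<beta> where ab: "\<alpha> \<in> l2_space A" "\<beta> \<in> l2_space B"
    "\<And>x y. x \<in> space A \<Longrightarrow> y \<in> space B \<Longrightarrow> norm (k x y) \<le> norm (\<alpha> x) * norm (\<beta> y)"
    using k by (rule dominated_kernelE) blast
  show thesis
  proof (rule that)
    let ?c = "complex_of_real (sqrt (l2_sq B \<beta>))"
    show "(\<lambda>x. ?c * \<alpha> x) \<in> l2_space A" using ab(1) by (rule l2_scale)
    fix x assume x: "x \<in> space A"
    have "l2_sq B (k x) \<le> (norm (\<alpha> x))\<^sup>2 * l2_sq B \<beta>"
      by (rule l2_dominated(2)[OF l2_measurable[OF kernel_section_l2[OF k x]] ab(2)])
        (use ab(3) x in \<open>simp add: norm_mult\<close>)
    also have "\<dots> = (norm (?c * \<alpha> x))\<^sup>2"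
      by (simp add: norm_mult power_mult_distrib)
    finally show "l2_sq B (k x) \<le> (norm (?c * \<alpha> x))\<^sup>2" .
  qed
qed

lemma kernel_op_eq_inner: "kernel_op B k h x = l2_inner B (k x) (\<lambda>y. cnj (h y))"
  by (simp add: kernel_op_def l2_inner_def)

lemma kernel_op_l2:
  assumes B: "sigma_finite_measure B" and k: "dominated_kernel A B k"
  shows "h \<in> l2_space B \<Longrightarrow> kernel_op B k h \<in> l2_space A"
    and "\<exists>C\<ge>0. \<forall>h\<in>l2_space B. l2_sq A (kernel_op B k h) \<le> C * l2_sq B h"
proof -
  obtain \<alpha> where al: "\<alpha> \<in> l2_space A" "\<And>x. x \<in> space A \<Longrightarrow> l2_sq B (k x) \<le> (norm (\<alpha> x))\<^sup>2"
    using k by (rule kernel_bound) blast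
  interpret sigma_finite_measure B by fact
  have [measurable]: "case_prod k \<in> borel_measurable (A \<Otimes>\<^sub>M B)"
    using k by (rule dominated_kernel_measurable)
  have *: "kernel_op B k h \<in> l2_space A \<and> l2_sq A (kernel_op B k h) \<le> l2_sq A \<alpha> * l2_sq B h"
    if h: "h \<in> l2_space B" for h
  proof -
    have [measurable]: "h \<in> borel_measurable B" using h by (rule l2_measurable)
    have m: "kernel_op B k h \<in> borel_measurable A"
      unfolding kernel_op_def by measurable
    let ?c = "complex_of_real (sqrt (l2_sq B h))"
    have le: "norm (kernel_op B k h x) \<le> norm (?c * \<alpha> x)" if x: "x \<in> space A" for x
    proof (rule power2_le_imp_le)
      have "(norm (kernel_op B k h x))\<^sup>2 \<le> l2_sq B (k x) * l2_sq B (\<lambda>y. cnj (h y))"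
        unfolding kernel_op_eq_inner
        by (rule l2_cauchy_schwarz[OF kernel_section_l2[OF k x] l2_cnj[OF h]])
      also have "\<dots> \<le> (norm (\<alpha> x))\<^sup>2 * l2_sq B h"
        unfolding l2_sq_cnj by (intro mult_right_mono al(2) x) simp
      finally show "(norm (kernel_op B k h x))\<^sup>2 \<le> (norm (?c * \<alpha> x))\<^sup>2"
        by (simp add: norm_mult power_mult_distrib mult.commute)
    qed simp
    show ?thesis
      using l2_dominated[OF m al(1) le] by (simp add: mult.commute)
  qed
  then show "h \<in> l2_space B \<Longrightarrow> kernel_op B k h \<in> l2_space A" by blast
  show "\<exists>C\<ge>0. \<forall>h\<in>l2_space B. l2_sq A (kernel_op B k h) \<le> C * l2_sq B h"
    using * by (intro exI[of _ "l2_sq A \<alpha>"]) auto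
qed

text \<open>After the majorant is inserted the two integrals separate, and each is the finite
  integral of a product of two square integrable functions.\<close>

lemma kernel_fubini:
  assumes A: "sigma_finite_measure A" and B: "sigma_finite_measure B"
    and k: "dominated_kernel A B k" and a: "a \<in> l2_space A" and h: "h \<in> l2_space B"
  shows "(\<integral>x. a x * (\<integral>y. k x y * h y \<partial>B) \<partial>A) = (\<integral>y. (\<integral>x. a x * k x y \<partial>A) * h y \<partial>B)"
proof -
  interpret A: sigma_finite_measure A by fact
  interpret B: sigma_finite_measure B by fact
  interpret pair_sigma_finite A B ..
  obtain \<alpha> \<beta> where ab: "\<alpha> \<in> l2_space A" "\<beta> \<in> l2_space B"
    "\<And>x y. x \<in> space A \<Longrightarrow> y \<in> space B \<Longrightarrow> norm (k x y) \<le> norm (\<alpha> x) * norm (\<beta> y)"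
    using k by (rule dominated_kernelE) blast
  have [measurable]: "case_prod k \<in> borel_measurable (A \<Otimes>\<^sub>M B)"
    using k by (rule dominated_kernel_measurable)
  have [measurable]: "a \<in> borel_measurable A" "h \<in> borel_measurable B"
    using a h by (auto simp: l2_space_def)
  let ?f = "\<lambda>x y. a x * (k x y * h y)"
  have int1: "integrable B (?f x)" if "x \<in> space A" for x
    by (intro integrable_mult_right l2_integrable_mult kernel_section_l2[OF k] that h)
  have aa: "integrable A (\<lambda>x. norm (a x * \<alpha> x))" and bh: "integrable B (\<lambda>y. norm (\<beta> y * h y))"
    by (intro Bochner_Integration.integrable_norm l2_integrable_mult a h ab)+
  define c where "c = (\<integral>y. norm (\<beta> y * h y) \<partial>B)"
  have c: "c \<ge> 0" unfolding c_def by simp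
  have int: "integrable (A \<Otimes>\<^sub>M B) (case_prod ?f)"
  proof (rule Fubini_integrable)
    show "AE x in A. integrable B (\<lambda>y. case_prod ?f (x, y))"
      using int1 by (intro AE_I2) simp
    show "integrable A (\<lambda>x. \<integral>y. norm (case_prod ?f (x, y)) \<partial>B)"
    proof (rule Bochner_Integration.integrable_bound)
      show "integrable A (\<lambda>x. norm (a x * \<alpha> x) * c)"
        using aa by (rule integrable_mult_left)
      show "AE x in A. norm (\<integral>y. norm (case_prod ?f (x, y)) \<partial>B) \<le> norm (norm (a x * \<alpha> x) * c)"
      proof (rule AE_I2)
        fix x assume x: "x \<in> space A"
        have "(\<integral>y. norm (?f x y) \<partial>B) \<le> (\<integral>y. norm (a x * \<alpha> x) * norm (\<beta> y * h y) \<partial>B)"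
        proof (rule integral_mono)
          show "integrable B (\<lambda>y. norm (?f x y))"
            using int1[OF x] by (rule Bochner_Integration.integrable_norm)
          show "integrable B (\<lambda>y. norm (a x * \<alpha> x) * norm (\<beta> y * h y))"
            using bh by (rule integrable_mult_right)
          fix y assume "y \<in> space B"
          then have "norm (a x) * norm (k x y) * norm (h y) \<le> norm (a x) * (norm (\<alpha> x) * norm (\<beta> y)) * norm (h y)"
            by (intro mult_right_mono mult_left_mono ab(3) x) auto
          then show "norm (?f x y) \<le> norm (a x * \<alpha> x) * norm (\<beta> y * h y)"
            by (simp add: norm_mult mult_ac)
        qed
        also have "\<dots> = norm (a x * \<alpha> x) * c"
          unfolding c_def by (rule integral_mult_right_zero)
        finally show "norm (\<integral>y. norm (case_prod ?f (x, y)) \<partial>B) \<le> norm (norm (a x * \<alpha> x) * c)"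
          using c by simp
      qed
    qed measurable
  qed measurable
  have "(\<integral>x. a x * (\<integral>y. k x y * h y \<partial>B) \<partial>A) = (\<integral>x. (\<integral>y. ?f x y \<partial>B) \<partial>A)"
    by simp
  also have "\<dots> = (\<integral>y. (\<integral>x. ?f x y \<partial>A) \<partial>B)"
    using Fubini_integral[OF int] by simp
  also have "\<dots> = (\<integral>y. (\<integral>x. a x * k x y \<partial>A) * h y \<partial>B)"
    by (simp flip: mult.assoc)
  finally show ?thesis .
qed

text \<open>The two middle majorants pair to a finite constant c, which is put into the left outer
  one.\<close>

lemma dominated_kernel_comp:
  assumes B: "sigma_finite_measure B"
    and k: "dominated_kernel A B k" and l: "dominated_kernel B C l"
  shows "dominated_kernel A C (kernel_comp B k l)"
proof -
  interpret B: sigma_finite_measure B by fact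
  obtain \<alpha> \<beta> where ab: "\<alpha> \<in> l2_space A" "\<beta> \<in> l2_space B"
    "\<And>x y. x \<in> space A \<Longrightarrow> y \<in> space B \<Longrightarrow> norm (k x y) \<le> norm (\<alpha> x) * norm (\<beta> y)"
    using k by (rule dominated_kernelE) blast
  obtain \<gamma> \<delta> where cd: "\<gamma> \<in> l2_space B" "\<delta> \<in> l2_space C"
    "\<And>x y. x \<in> space B \<Longrightarrow> y \<in> space C \<Longrightarrow> norm (l x y) \<le> norm (\<gamma> x) * norm (\<delta> y)"
    using l by (rule dominated_kernelE) blast
  have [measurable]: "case_prod k \<in> borel_measurable (A \<Otimes>\<^sub>M B)" "case_prod l \<in> borel_measurable (B \<Otimes>\<^sub>M C)"
    using k l by (auto intro: dominated_kernel_measurable)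
  define c where "c = (\<integral>y. norm (\<beta> y * \<gamma> y) \<partial>B)"
  have bg: "integrable B (\<lambda>y. norm (\<beta> y * \<gamma> y))"
    by (intro Bochner_Integration.integrable_norm l2_integrable_mult ab cd)
  have c: "c \<ge> 0" unfolding c_def by simp
  show ?thesis
  proof (rule dominated_kernelI)
    show "(\<lambda>x. of_real c * \<alpha> x) \<in> l2_space A" using ab(1) by (rule l2_scale)
    show "\<delta> \<in> l2_space C" by fact
    show "case_prod (kernel_comp B k l) \<in> borel_measurable (A \<Otimes>\<^sub>M C)"
      unfolding kernel_comp_def case_prod_beta by measurable
    fix x z assume x: "x \<in> space A" and z: "z \<in> space C"
    have "norm (kernel_comp B k l x z) \<le> (\<integral>y. norm (\<alpha> x) * norm (\<delta> z) * norm (\<beta> y * \<gamma> y) \<partial>B)"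
      unfolding kernel_comp_def
    proof (rule order_trans[OF Bochner_Integration.integral_norm_bound integral_mono])
      show "integrable B (\<lambda>y. norm (k x y * l y z))"
      proof (rule Bochner_Integration.integrable_norm, rule Bochner_Integration.integrable_bound)
        show "integrable B (\<lambda>y. norm (\<alpha> x) * norm (\<delta> z) * norm (\<beta> y * \<gamma> y))"
          using bg by (rule integrable_mult_right)
        show "(\<lambda>y. k x y * l y z) \<in> borel_measurable B" using x z by measurable
        show "AE y in B. norm (k x y * l y z) \<le> norm (norm (\<alpha> x) * norm (\<delta> z) * norm (\<beta> y * \<gamma> y))"
          using mult_mono[OF ab(3)[OF x] cd(3)[OF _ z]]
          by (intro AE_I2) (simp add: norm_mult mult_ac)
      qed
      show "integrable B (\<lambda>y. norm (\<alpha> x) * norm (\<delta> z) * norm (\<beta> y * \<gamma> y))"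
        using bg by (rule integrable_mult_right)
      show "norm (k x y * l y z) \<le> norm (\<alpha> x) * norm (\<delta> z) * norm (\<beta> y * \<gamma> y)" if "y \<in> space B" for y
        using mult_mono[OF ab(3)[OF x that] cd(3)[OF that z]] by (simp add: norm_mult mult_ac)
    qed
    also have "\<dots> = norm (of_real c * \<alpha> x) * norm (\<delta> z)"
      using c by (simp add: norm_mult) (simp add: c_def norm_mult)
    finally show "norm (kernel_comp B k l x z) \<le> norm (of_real c * \<alpha> x) * norm (\<delta> z)" .
  qed
qed

lemma dominated_kernel_add:
  assumes k: "dominated_kernel A B k" and l: "dominated_kernel A B l"
  shows "dominated_kernel A B (\<lambda>x y. k x y + l x y)"
proof -
  obtain \<alpha> \<beta> where ab: "\<alpha> \<in> l2_space A" "\<beta> \<in> l2_space B"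
    "\<And>x y. x \<in> space A \<Longrightarrow> y \<in> space B \<Longrightarrow> norm (k x y) \<le> norm (\<alpha> x) * norm (\<beta> y)"
    using k by (rule dominated_kernelE) blast
  obtain \<gamma> \<delta> where cd: "\<gamma> \<in> l2_space A" "\<delta> \<in> l2_space B"
    "\<And>x y. x \<in> space A \<Longrightarrow> y \<in> space B \<Longrightarrow> norm (l x y) \<le> norm (\<gamma> x) * norm (\<delta> y)"
    using l by (rule dominated_kernelE) blast
  have [measurable]: "case_prod k \<in> borel_measurable (A \<Otimes>\<^sub>M B)" "case_prod l \<in> borel_measurable (A \<Otimes>\<^sub>M B)"
    using k l by (auto intro: dominated_kernel_measurable)
  \<comment> \<open>Norms are taken before the majorants are added, since the complex values
    themselves could cancel.\<close>
  have sum: "(\<lambda>x. of_real (norm (f x)) + of_real (norm (g x)) :: complex) \<in> l2_space M"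
    if "f \<in> l2_space M" "g \<in> l2_space M" for f g :: "'x \<Rightarrow> complex" and M
  proof -
    have "(\<lambda>x. of_real (norm (f x)) :: complex) \<in> l2_space M" if "f \<in> l2_space M" for f
      by (rule l2_dominated(1)[OF _ that, of _ 1]) (use that in \<open>auto simp: l2_space_def\<close>)
    with that show ?thesis by (intro l2_add) auto
  qed
  show ?thesis
  proof (rule dominated_kernelI[OF _ sum[OF ab(1) cd(1)] sum[OF ab(2) cd(2)]])
    fix x y assume xy: "x \<in> space A" "y \<in> space B"
    have "norm (k x y + l x y) \<le> norm (\<alpha> x) * norm (\<beta> y) + norm (\<gamma> x) * norm (\<delta> y)"
      using norm_triangle_ineq[of "k x y" "l x y"] ab(3)[OF xy] cd(3)[OF xy] by linarith
    also have "\<dots> \<le> (norm (\<alpha> x) + norm (\<gamma> x)) * (norm (\<beta> y) + norm (\<delta> y))"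
      by (simp add: algebra_simps)
    finally show "norm (k x y + l x y) \<le> norm (of_real (norm (\<alpha> x)) + of_real (norm (\<gamma> x)) :: complex) *
        norm (of_real (norm (\<beta> y)) + of_real (norm (\<delta> y)) :: complex)"
      by (simp flip: of_real_add)
  qed measurable
qed

lemma kernel_op_comp:
  assumes B: "sigma_finite_measure B" and C: "sigma_finite_measure C"
    and k: "dominated_kernel A B k" and l: "dominated_kernel B C l"
    and h: "h \<in> l2_space C" and x: "x \<in> space A"
  shows "kernel_op C (kernel_comp B k l) h x = kernel_op B k (kernel_op C l h) x"
  unfolding kernel_op_def kernel_comp_def
  by (rule kernel_fubini[OF B C l kernel_section_l2[OF k x] h, symmetric])

lemma kernel_form_adjoint:
  assumes A: "sigma_finite_measure A" and B: "sigma_finite_measure B"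
    and k: "dominated_kernel A B k" and w: "w \<in> l2_space B" and g: "g \<in> l2_space A"
  shows "l2_inner A (kernel_op B k w) g = l2_inner B w (kernel_op A (\<lambda>y x. cnj (k x y)) g)"
proof -
  have "l2_inner A (kernel_op B k w) g = (\<integral>x. cnj (g x) * (\<integral>y. k x y * w y \<partial>B) \<partial>A)"
    by (simp add: l2_inner_def kernel_op_def mult.commute)
  also have "\<dots> = (\<integral>y. (\<integral>x. cnj (g x) * k x y \<partial>A) * w y \<partial>B)"
    by (rule kernel_fubini[OF A B k l2_cnj[OF g] w])
  also have "\<dots> = l2_inner B w (kernel_op A (\<lambda>y x. cnj (k x y)) g)"
    unfolding l2_inner_def kernel_op_def Bochner_Integration.integral_cnj[symmetric]
    by (simp add: mult.commute)
  finally show ?thesis .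
qed

text \<open>Composition becomes multiplication of matrices: moving k to the other side as its
  adjoint turns the form into an inner product in the middle space, where Parseval for u
  applies.\<close>

lemma kernel_form_parseval:
  assumes sf: "sigma_finite_measure A" "sigma_finite_measure B" "sigma_finite_measure C"
    and k: "dominated_kernel A B k" and l: "dominated_kernel B C l"
    and u: "orthonormal_basis B u" and g: "g \<in> l2_space A" and h: "h \<in> l2_space C"
  shows "((\<lambda>n. kernel_form A B k g (u n) * kernel_form B C l (u n) h) has_sum
    kernel_form A C (kernel_comp B k l) g h) UNIV"
proof -
  let ?k = "\<lambda>y x. cnj (k x y)"
  have ul: "u n \<in> l2_space B" for n
    using u by (simp add: orthonormal_basis_def orthonormal_seq_def)
  have lh: "kernel_op C l h \<in> l2_space B"
    by (rule kernel_op_l2(1)[OF sf(3) l h])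
  have kg: "kernel_op A ?k g \<in> l2_space B"
    by (rule kernel_op_l2(1)[OF sf(1) dominated_kernel_adjoint[OF k] g])
  have "kernel_form A C (kernel_comp B k l) g h = l2_inner A (kernel_op B k (kernel_op C l h)) g"
    unfolding kernel_form_def l2_inner_def
    by (intro Bochner_Integration.integral_cong refl)
      (simp add: kernel_op_comp[OF sf(2,3) k l h])
  also have "\<dots> = l2_inner B (kernel_op C l h) (kernel_op A ?k g)"
    by (rule kernel_form_adjoint[OF sf(1,2) k lh g])
  finally have "((\<lambda>n. l2_inner B (kernel_op C l h) (u n) * l2_inner B (u n) (kernel_op A ?k g)) has_sum
      kernel_form A C (kernel_comp B k l) g h) UNIV"
    using parseval[OF u lh kg] by simp
  then show ?thesis
    by (simp add: kernel_form_def kernel_form_adjoint[OF sf(1,2) k ul g] mult.commute)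
qed

lemma kernel_form_add:
  assumes k: "dominated_kernel A B k" and l: "dominated_kernel A B l"
    and B: "sigma_finite_measure B" and g: "g \<in> l2_space A" and h: "h \<in> l2_space B"
  shows "kernel_form A B (\<lambda>x y. k x y + l x y) g h = kernel_form A B k g h + kernel_form A B l g h"
proof -
  have "kernel_form A B (\<lambda>x y. k x y + l x y) g h = l2_inner A (\<lambda>x. kernel_op B k h x + kernel_op B l h x) g"
    unfolding kernel_form_def l2_inner_def
    using l2_integrable_mult[OF kernel_section_l2[OF k] h] l2_integrable_mult[OF kernel_section_l2[OF l] h]
    by (intro Bochner_Integration.integral_cong refl) (simp add: kernel_op_def distrib_right)
  then show ?thesis
    unfolding kernel_form_def
    using l2_inner_add_left[OF kernel_op_l2(1)[OF B k h] kernel_op_l2(1)[OF B l h] g] by simp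
qed

text \<open>Bessel twice: first in A, over e, for the image of each u n; then in B, over u, at fixed
  x with the conjugated section of k as the vector. The resulting bound does not depend on the
  truncation.\<close>

lemma hs_matrix_kernel_form:
  assumes B: "sigma_finite_measure B" and k: "dominated_kernel A B k"
    and e: "orthonormal_seq A e" and u: "orthonormal_seq B u"
  shows "hs_matrix (\<lambda>i n. kernel_form A B k (e i) (u n))"
proof -
  obtain \<alpha> where al: "\<alpha> \<in> l2_space A" "\<And>x. x \<in> space A \<Longrightarrow> l2_sq B (k x) \<le> (norm (\<alpha> x))\<^sup>2"
    using k by (rule kernel_bound) blast
  have ul: "u n \<in> l2_space B" for n using u by (simp add: orthonormal_seq_def)
  note ku = kernel_op_l2(1)[OF B k ul]
  let ?f = "\<lambda>(i, n). (norm (kernel_form A B k (e i) (u n)))\<^sup>2"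
  have "(\<Sum>p\<in>F. ?f p) \<le> l2_sq A \<alpha>" if F: "finite F" for F
  proof -
    define N where "N = Suc (Max (fst ` F \<union> snd ` F))"
    have "F \<subseteq> {..<N} \<times> {..<N}"
      using F by (auto simp: N_def less_Suc_eq_le intro!: Max_ge) (force intro: rev_image_eqI)+
    then have "(\<Sum>p\<in>F. ?f p) \<le> (\<Sum>p\<in>{..<N} \<times> {..<N}. ?f p)"
      by (intro sum_mono2) auto
    also have "\<dots> = (\<Sum>n<N. \<Sum>i<N. (norm (l2_inner A (kernel_op B k (u n)) (e i)))\<^sup>2)"
      unfolding sum.cartesian_product[symmetric] kernel_form_def by (rule sum.swap)
    also have "\<dots> \<le> (\<Sum>n<N. l2_sq A (kernel_op B k (u n)))"
      by (intro sum_mono bessel orthonormal_seq_on e ku) auto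
    also have "\<dots> = (\<integral>x. (\<Sum>n<N. (norm (kernel_op B k (u n) x))\<^sup>2) \<partial>A)"
      unfolding l2_sq_def by (intro Bochner_Integration.integral_sum[symmetric] l2_integrable ku)
    also have "\<dots> \<le> l2_sq A \<alpha>"
      unfolding l2_sq_def
    proof (rule integral_mono)
      show "integrable A (\<lambda>x. \<Sum>n<N. (norm (kernel_op B k (u n) x))\<^sup>2)"
        by (intro Bochner_Integration.integrable_sum l2_integrable ku)
      show "integrable A (\<lambda>x. (norm (\<alpha> x))\<^sup>2)" by (rule l2_integrable[OF al(1)])
      fix x assume x: "x \<in> space A"
      have "norm (kernel_op B k (u n) x) = norm (l2_inner B (\<lambda>y. cnj (k x y)) (u n))" for n
        unfolding kernel_op_def l2_inner_def
        by (subst complex_mod_cnj[symmetric]) (simp flip: Bochner_Integration.integral_cnj)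
      then have "(\<Sum>n<N. (norm (kernel_op B k (u n) x))\<^sup>2) \<le> l2_sq B (\<lambda>y. cnj (k x y))"
        by (simp only:) (intro bessel orthonormal_seq_on u l2_cnj kernel_section_l2[OF k x] finite_lessThan)
      also have "\<dots> \<le> (norm (\<alpha> x))\<^sup>2"
        unfolding l2_sq_cnj by (rule al(2)[OF x])
      finally show "(\<Sum>n<N. (norm (kernel_op B k (u n) x))\<^sup>2) \<le> (norm (\<alpha> x))\<^sup>2" .
    qed
    finally show ?thesis .
  qed
  then show ?thesis
    unfolding hs_matrix_def
    by (intro nonneg_bdd_above_summable_on bdd_aboveI2[of _ _ "l2_sq A \<alpha>"]) auto
qed

text \<open>The double family of products is absolutely summable by |a b| <= |a|^2 + |b|^2. The two
  matrices may be built from different orthonormal sequences, as the definition of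
  \<open>trace_class\<close> demands.\<close>

lemma summable_hs_products:
  fixes A :: "nat \<Rightarrow> 'b \<Rightarrow> complex"
  assumes A: "hs_matrix A" and B: "hs_matrix B"
    and c: "\<And>n. ((\<lambda>l. A n l * B l n) has_sum c n) UNIV"
  shows "summable (\<lambda>n. norm (c n))"
proof -
  have B': "(\<lambda>(n, l). (norm (B l n))\<^sup>2) summable_on UNIV \<times> UNIV"
    using B unfolding hs_matrix_def by (subst summable_on_swap) simp
  have "(\<lambda>p. norm ((\<lambda>(n, l). A n l * B l n) p)) summable_on UNIV \<times> UNIV"
  proof (rule Infinite_Sum.abs_summable_on_comparison_test')
    show "(\<lambda>p. (case p of (n, l) \<Rightarrow> (norm (A n l))\<^sup>2) + (case p of (n, l) \<Rightarrow> (norm (B l n))\<^sup>2))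
        summable_on UNIV \<times> UNIV"
      using A B' by (intro summable_on_add) (simp_all add: hs_matrix_def)
    show "norm ((\<lambda>(n, l). A n l * B l n) p) \<le>
        (case p of (n, l) \<Rightarrow> (norm (A n l))\<^sup>2) + (case p of (n, l) \<Rightarrow> (norm (B l n))\<^sup>2)" for p
      using norm_mult_le_squares by (cases p) simp
  qed
  then have "(\<lambda>(n, l). A n l * B l n) summable_on (SIGMA n:UNIV. UNIV)"
    by (rule abs_summable_summable)
  then obtain s where "((\<lambda>(n, l). A n l * B l n) has_sum s) (SIGMA n:UNIV. UNIV)"
    by (auto simp: summable_on_def)
  then have "(c has_sum s) UNIV"
    by (rule has_sum_SigmaD) (use c in simp)
  then have "(\<lambda>n. norm (c n)) summable_on UNIV"
    by (simp flip: summable_on_iff_abs_summable_on_complex add: has_sum_imp_summable)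
  then show ?thesis by (rule summable_on_imp_summable)
qed

lemma kernel_op_linear:
  assumes k: "dominated_kernel A B k" and x: "x \<in> space A"
    and h: "h \<in> l2_space B" and g: "g \<in> l2_space B"
  shows "kernel_op B k (\<lambda>y. c * h y + d * g y) x = c * kernel_op B k h x + d * kernel_op B k g x"
proof -
  note [simp] = l2_integrable_mult[OF kernel_section_l2[OF k x] h]
    l2_integrable_mult[OF kernel_section_l2[OF k x] g]
  have "kernel_op B k (\<lambda>y. c * h y + d * g y) x = (\<integral>y. c * (k x y * h y) + d * (k x y * g y) \<partial>B)"
    unfolding kernel_op_def by (simp add: algebra_simps)
  then show ?thesis by (simp add: kernel_op_def)
qed

lemma l2_bounded_operator_kernel:
  assumes A: "sigma_finite_measure A" and k: "dominated_kernel A A k"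
    and T: "\<And>h x. h \<in> l2_space A \<Longrightarrow> x \<in> space A \<Longrightarrow> T h x = kernel_op A k h x"
  shows "l2_bounded_operator A T"
proof -
  have Tl: "T h \<in> l2_space A" if h: "h \<in> l2_space A" for h
  proof (rule l2_cong_AE[OF kernel_op_l2(1)[OF A k h]])
    show "T h \<in> borel_measurable A"
      using l2_measurable[OF kernel_op_l2(1)[OF A k h]] T[OF h]
      by (subst measurable_cong) auto
  qed (use T[OF h] in auto)
  obtain C where C: "C \<ge> 0" "\<forall>h\<in>l2_space A. l2_sq A (kernel_op A k h) \<le> C * l2_sq A h"
    using kernel_op_l2(2)[OF A k] by blast
  have "l2_norm A (T h) \<le> sqrt C * l2_norm A h" if h: "h \<in> l2_space A" for h
  proof -
    have "l2_sq A (T h) = l2_sq A (kernel_op A k h)"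
      unfolding l2_sq_def by (intro Bochner_Integration.integral_cong) (auto simp: T[OF h])
    then show ?thesis
      unfolding l2_norm_eq real_sqrt_mult[symmetric] using C h by simp
  qed
  moreover have "AE x in A. T (\<lambda>y. c * h y + d * g y) x = c * T h x + d * T g x"
    if "h \<in> l2_space A" "g \<in> l2_space A" for h g c d
    using that by (intro AE_I2) (simp add: T l2_add l2_scale kernel_op_linear[OF k])
  ultimately show ?thesis
    unfolding l2_bounded_operator_def using Tl by blast
qed

lemma has_sum_UNIV_sum:
  fixes f :: "'a + 'b \<Rightarrow> complex"
  assumes "((\<lambda>i. f (Inl i)) has_sum a) UNIV" "((\<lambda>i. f (Inr i)) has_sum b) UNIV"
  shows "(f has_sum (a + b)) UNIV"
proof -
  have "(f has_sum a) (range Inl)" "(f has_sum b) (range Inr)"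
    using assms by (simp_all add: has_sum_reindex o_def)
  then have "(f has_sum (a + b)) (range Inl \<union> range Inr)"
    by (rule has_sum_Un_disjoint) auto
  then show ?thesis by (simp add: UNIV_sum)
qed

lemma hs_matrix_transpose: "hs_matrix (\<lambda>j i. A i j) \<longleftrightarrow> hs_matrix A"
  unfolding hs_matrix_def UNIV_Times_UNIV[symmetric]
  by (subst summable_on_swap) (simp add: case_prod_beta')

lemma hs_matrix_case_sum:
  assumes "hs_matrix A" "hs_matrix B"
  shows "hs_matrix (\<lambda>i. case_sum (A i) (B i))"
proof -
  let ?f = "\<lambda>(i, n). (norm (case_sum (A i) (B i) n))\<^sup>2"
  have "?f summable_on (UNIV \<times> range Inl)"
  proof -
    have "bij_betw (map_prod id Inl) (UNIV \<times> UNIV) (UNIV \<times> range Inl)"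
      by (intro bij_betw_map_prod) (auto simp: bij_betw_def)
    from summable_on_reindex_bij_betw[OF this, of ?f] assms(1) show ?thesis
      by (simp add: hs_matrix_def case_prod_beta')
  qed
  moreover have "?f summable_on (UNIV \<times> range Inr)"
  proof -
    have "bij_betw (map_prod id Inr) (UNIV \<times> UNIV) (UNIV \<times> range Inr)"
      by (intro bij_betw_map_prod) (auto simp: bij_betw_def)
    from summable_on_reindex_bij_betw[OF this, of ?f] assms(2) show ?thesis
      by (simp add: hs_matrix_def case_prod_beta')
  qed
  ultimately have "?f summable_on (UNIV \<times> range Inl \<union> UNIV \<times> range Inr)"
    by (rule summable_on_Un_disjoint) auto
  then show ?thesis
    unfolding hs_matrix_def
    by (simp only: Sigma_Un_distrib2[symmetric] UNIV_sum[symmetric] UNIV_Times_UNIV)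
qed

section \<open>Fredholm determinants of factored operators\<close>

lemma exterior_trace_eqI:
  assumes "orthonormal_basis M e0"
    and "\<And>e. orthonormal_basis M e \<Longrightarrow>
      ((\<lambda>S. set_det S (\<lambda>i j. l2_inner M (T (e j)) (e i))) has_sum t) {S. finite S \<and> card S = k}"
  shows "exterior_trace M T k = t"
  unfolding exterior_trace_def
proof (rule the_equality)
  fix t' assume "\<forall>e. orthonormal_basis M e \<longrightarrow>
    ((\<lambda>S. set_det S (\<lambda>i j. l2_inner M (T (e j)) (e i))) has_sum t') {S. finite S \<and> card S = k}"
  then show "t' = t" using assms has_sum_unique by blast
qed (use assms in blast)

text \<open>P1 and p side by side form a row A, Q1 above b a column B, with the disjoint union of
  bases of S and Y as middle index. Then A B represents T, while B A has vanishing diagonal blocks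
  by \<open>z1\<close> and \<open>z2\<close>, and the product of its off-diagonal blocks represents
  L.\<close>

theorem fredholm_det_cyclic:
  fixes P1 :: "'x \<Rightarrow> 's \<Rightarrow> complex" and p :: "'x \<Rightarrow> 'y \<Rightarrow> complex"
  assumes sf: "sigma_finite_measure X" "sigma_finite_measure S" "sigma_finite_measure Y"
    and P1: "dominated_kernel X S P1" and Q1: "dominated_kernel S X Q1"
    and p: "dominated_kernel X Y p" and b: "dominated_kernel Y X b"
    and z1: "\<And>s s'. s \<in> space S \<Longrightarrow> s' \<in> space S \<Longrightarrow> kernel_comp X Q1 P1 s s' = 0"
    and z2: "\<And>y y'. y \<in> space Y \<Longrightarrow> y' \<in> space Y \<Longrightarrow> kernel_comp X b p y y' = 0"
    and bases: "\<exists>e. orthonormal_basis X e" "\<exists>u. orthonormal_basis S u" "\<exists>v. orthonormal_basis Y v"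
    and T: "\<And>h x. h \<in> l2_space X \<Longrightarrow> x \<in> space X \<Longrightarrow>
      T h x = kernel_op X (\<lambda>x x'. kernel_comp S P1 Q1 x x' + kernel_comp Y p b x x') h x"
    and L: "\<And>h y. h \<in> l2_space Y \<Longrightarrow> y \<in> space Y \<Longrightarrow>
      L h y = kernel_op Y (kernel_comp S (kernel_comp X b P1) (kernel_comp X Q1 p)) h y"
  shows "trace_class X T" and "fredholm_det X T = fredholm_det Y L"
proof -
  let ?k = "\<lambda>x x'. kernel_comp S P1 Q1 x x' + kernel_comp Y p b x x'"
  let ?l = "kernel_comp S (kernel_comp X b P1) (kernel_comp X Q1 p)"
  obtain e0 where e0: "orthonormal_basis X e0" using bases(1) by blast
  obtain u where u: "orthonormal_basis S u" using bases(2) by blast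
  obtain v0 where v0: "orthonormal_basis Y v0" using bases(3) by blast
  have os: "orthonormal_seq M e" if "orthonormal_basis M e" for M and e :: "nat \<Rightarrow> 'm \<Rightarrow> complex"
    using that by (simp add: orthonormal_basis_def)
  have osl: "e n \<in> l2_space M" if "orthonormal_seq M e" for M and e :: "nat \<Rightarrow> 'm \<Rightarrow> complex" and n
    using that by (simp add: orthonormal_seq_def)
  have k1: "dominated_kernel X X (kernel_comp S P1 Q1)" and k2: "dominated_kernel X X (kernel_comp Y p b)"
    by (intro dominated_kernel_comp sf P1 Q1 p b)+
  have k: "dominated_kernel X X ?k" by (rule dominated_kernel_add[OF k1 k2])
  have bP: "dominated_kernel Y S (kernel_comp X b P1)" and Qp: "dominated_kernel S Y (kernel_comp X Q1 p)"
    by (intro dominated_kernel_comp sf P1 Q1 p b)+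
  have l: "dominated_kernel Y Y ?l" by (rule dominated_kernel_comp[OF sf(2) bP Qp])
  have Tform: "l2_inner X (T h) g = kernel_form X X ?k g h" if "h \<in> l2_space X" for h g
    unfolding kernel_form_def l2_inner_def
    by (intro Bochner_Integration.integral_cong refl) (simp add: T[OF that])
  have Lform: "l2_inner Y (L h) g = kernel_form Y Y ?l g h" if "h \<in> l2_space Y" for h g
    unfolding kernel_form_def l2_inner_def
    by (intro Bochner_Integration.integral_cong refl) (simp add: L[OF that])
  define A where "A e v i = case_sum (\<lambda>n. kernel_form X S P1 (e i) (u n)) (\<lambda>n. kernel_form X Y p (e i) (v n))"
    for e :: "nat \<Rightarrow> 'x \<Rightarrow> complex" and v :: "nat \<Rightarrow> 'y \<Rightarrow> complex" and i
  define B where "B e v n j = case_sum (\<lambda>n. kernel_form S X Q1 (u n) (e j)) (\<lambda>n. kernel_form Y X b (v n) (e j)) n"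
    for e :: "nat \<Rightarrow> 'x \<Rightarrow> complex" and v :: "nat \<Rightarrow> 'y \<Rightarrow> complex" and n j
  have hsA: "hs_matrix (A e v)" if e: "orthonormal_seq X e" and v: "orthonormal_basis Y v" for e v
    unfolding A_def by (intro hs_matrix_case_sum hs_matrix_kernel_form sf P1 p e os[OF u] os[OF v])
  have hsB: "hs_matrix (B e v)" if e: "orthonormal_seq X e" and v: "orthonormal_basis Y v" for e v
    unfolding B_def
    by (subst hs_matrix_transpose[symmetric], intro hs_matrix_case_sum; subst hs_matrix_transpose)
      (intro hs_matrix_kernel_form sf Q1 b e os[OF u] os[OF v])+
  have AB: "((\<lambda>n. A f v i n * B e v n j) has_sum kernel_form X X ?k (f i) (e j)) UNIV"
    if e: "orthonormal_seq X e" and f: "orthonormal_seq X f" and v: "orthonormal_basis Y v" for e f v i j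
    unfolding kernel_form_add[OF k1 k2 sf(1) osl[OF f] osl[OF e]] A_def B_def
    by (rule has_sum_UNIV_sum; unfold sum.case)
      (intro kernel_form_parseval sf P1 Q1 p b u v osl[OF e] osl[OF f])+
  show "trace_class X T"
    unfolding trace_class_def
  proof (intro conjI allI impI)
    show "l2_bounded_operator X T"
      using T by (rule l2_bounded_operator_kernel[OF sf(1) k])
    \<comment> \<open>Two unrelated orthonormal sequences, so e enters through B and f through A;
      completeness is used for the middle bases u and \<open>v0\<close>.\<close>
    fix e f assume e: "orthonormal_seq X e" and f: "orthonormal_seq X f"
    have "summable (\<lambda>n. norm (kernel_form X X ?k (f n) (e n)))"
      by (rule summable_hs_products[OF hsA[OF f v0] hsB[OF e v0] AB[OF e f v0]])
    then show "summable (\<lambda>n. norm (l2_inner X (T (e n)) (f n)))"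
      by (simp only: Tform[OF osl[OF e]])
  qed
  \<comment> \<open>Ties each basis of X to each basis of Y; fixing one of them gives independence
    of the other.\<close>
  have main: "\<exists>t. ((\<lambda>S. set_det S (\<lambda>i j. l2_inner X (T (e j)) (e i))) has_sum t) {S. finite S \<and> card S = k} \<and>
      (odd k \<longrightarrow> t = 0) \<and> (\<forall>m. k = 2 * m \<longrightarrow>
      ((\<lambda>S. set_det S (\<lambda>i j. l2_inner Y (L (v j)) (v i))) has_sum ((-1) ^ m * t)) {S. finite S \<and> card S = m})"
    if e: "orthonormal_basis X e" and v: "orthonormal_basis Y v" for e v k
  proof -
    note oe = os[OF e] and ou = os[OF u] and ov = os[OF v]
    define C where "C = (\<lambda>n m. case n of
      Inl n \<Rightarrow> (case m of Inl m \<Rightarrow> 0 | Inr m \<Rightarrow> kernel_form S Y (kernel_comp X Q1 p) (u n) (v m))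
    | Inr n \<Rightarrow> (case m of Inl m \<Rightarrow> kernel_form Y S (kernel_comp X b P1) (v n) (u m) | Inr m \<Rightarrow> 0))"
    have zero1: "kernel_form S S (kernel_comp X Q1 P1) g h = 0" for g h
      unfolding kernel_form_def l2_inner_def kernel_op_def using z1
      by (simp cong: Bochner_Integration.integral_cong)
    have zero2: "kernel_form Y Y (kernel_comp X b p) g h = 0" for g h
      unfolding kernel_form_def l2_inner_def kernel_op_def using z2
      by (simp cong: Bochner_Integration.integral_cong)
    have BA: "((\<lambda>i. B e v n i * A e v i m) has_sum C n m) UNIV" for n m
    proof (cases n; cases m)
      fix n' m' assume nm: "n = Inl n'" "m = Inl m'"
      show ?thesis
        using kernel_form_parseval[OF sf(2,1,2) Q1 P1 e osl[OF ou, of n'] osl[OF ou, of m']]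
        by (simp add: nm A_def B_def C_def zero1)
    next
      fix n' m' assume nm: "n = Inl n'" "m = Inr m'"
      show ?thesis
        using kernel_form_parseval[OF sf(2,1,3) Q1 p e osl[OF ou, of n'] osl[OF ov, of m']]
        by (simp add: nm A_def B_def C_def)
    next
      fix n' m' assume nm: "n = Inr n'" "m = Inl m'"
      show ?thesis
        using kernel_form_parseval[OF sf(3,1,2) b P1 e osl[OF ov, of n'] osl[OF ou, of m']]
        by (simp add: nm A_def B_def C_def)
    next
      fix n' m' assume nm: "n = Inr n'" "m = Inr m'"
      show ?thesis
        using kernel_form_parseval[OF sf(3,1,3) b p e osl[OF ov, of n'] osl[OF ov, of m']]
        by (simp add: nm A_def B_def C_def zero2)
    qed
    obtain t where t1: "((\<lambda>S. set_det S (\<lambda>i j. kernel_form X X ?k (e i) (e j))) has_sum t)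
        {S. finite S \<and> card S = k}"
      and t2: "((\<lambda>S. set_det S C) has_sum t) {S. finite S \<and> card S = k}"
      by (rule exterior_trace_cyclic[OF hsA[OF oe v] hsB[OF oe v] AB[OF oe oe v] BA])
    have CC: "((\<lambda>n. C (Inr i) (Inl n) * C (Inl n) (Inr j)) has_sum kernel_form Y Y ?l (v i) (v j)) UNIV" for i j
      unfolding C_def sum.case
      by (rule kernel_form_parseval[OF sf(3,2,3) bP Qp u osl[OF ov] osl[OF ov]])
    have C0: "C (Inl i) (Inl j) = 0" "C (Inr i) (Inr j) = 0" for i j
      by (simp_all add: C_def)
    show ?thesis
      using t1 exterior_trace_off_diagonal[OF t2 C0 CC]
      by (intro exI[of _ t]) (simp only: Tform[OF osl[OF oe]] Lform[OF osl[OF ov]], blast)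
  qed
  \<comment> \<open>The sums in e and in \<open>e0\<close> are both compared with the one in
    \<open>v0\<close>: in odd degree both vanish, in even degree both determine the same sum over
    Y.\<close>
  have E: "exterior_trace X T k = t"
    if t: "((\<lambda>S. set_det S (\<lambda>i j. l2_inner X (T (e0 j)) (e0 i))) has_sum t) {S. finite S \<and> card S = k}" for k t
  proof (rule exterior_trace_eqI[OF e0])
    fix e assume e: "orthonormal_basis X e"
    obtain t1 where t1: "((\<lambda>S. set_det S (\<lambda>i j. l2_inner X (T (e j)) (e i))) has_sum t1) {S. finite S \<and> card S = k}"
      "odd k \<longrightarrow> t1 = 0" "\<forall>m. k = 2 * m \<longrightarrow>
      ((\<lambda>S. set_det S (\<lambda>i j. l2_inner Y (L (v0 j)) (v0 i))) has_sum ((-1) ^ m * t1)) {S. finite S \<and> card S = m}"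
      using main[OF e v0] by blast
    obtain t0 where t0: "((\<lambda>S. set_det S (\<lambda>i j. l2_inner X (T (e0 j)) (e0 i))) has_sum t0) {S. finite S \<and> card S = k}"
      "odd k \<longrightarrow> t0 = 0" "\<forall>m. k = 2 * m \<longrightarrow>
      ((\<lambda>S. set_det S (\<lambda>i j. l2_inner Y (L (v0 j)) (v0 i))) has_sum ((-1) ^ m * t0)) {S. finite S \<and> card S = m}"
      using main[OF e0 v0] by blast
    have "t0 = t" using t t0(1) by (rule has_sum_unique[symmetric])
    moreover have "t1 = t0"
    proof (cases "odd k")
      case True
      then show ?thesis using t0(2) t1(2) by simp
    next
      case False
      then obtain m where m: "k = 2 * m" by (auto elim: evenE)
      have "(-1) ^ m * t1 = (-1) ^ m * t0"
        by (rule has_sum_unique[OF t1(3)[rule_format, OF m] t0(3)[rule_format, OF m]])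
      then show ?thesis by simp
    qed
    ultimately show "((\<lambda>S. set_det S (\<lambda>i j. l2_inner X (T (e j)) (e i))) has_sum t) {S. finite S \<and> card S = k}"
      using t1(1) by simp
  qed
  have odd: "exterior_trace X T k = 0" if "odd k" for k
    using main[OF e0 v0, of k] E that by blast
  have even: "exterior_trace Y L m = (-1) ^ m * exterior_trace X T (2 * m)" for m
  proof (rule exterior_trace_eqI[OF v0])
    fix v assume v: "orthonormal_basis Y v"
    obtain t where t: "((\<lambda>S. set_det S (\<lambda>i j. l2_inner X (T (e0 j)) (e0 i))) has_sum t) {S. finite S \<and> card S = 2 * m}"
      "((\<lambda>S. set_det S (\<lambda>i j. l2_inner Y (L (v j)) (v i))) has_sum ((-1) ^ m * t)) {S. finite S \<and> card S = m}"
      using main[OF e0 v, of "2 * m"] by blast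
    then show "((\<lambda>S. set_det S (\<lambda>i j. l2_inner Y (L (v j)) (v i))) has_sum
        ((-1) ^ m * exterior_trace X T (2 * m))) {S. finite S \<and> card S = m}"
      using E[OF t(1)] by simp
  qed
  have "fredholm_det Y L = (\<Sum>m. (-1) ^ (2 * m) * exterior_trace X T (2 * m))"
    unfolding fredholm_det_def even by (simp add: mult.assoc[symmetric] flip: power_mult_distrib)
  \<comment> \<open>The terms of odd degree are 0, so inserting them only repeats partial
    sums.\<close>
  also have "\<dots> = fredholm_det X T"
    unfolding fredholm_det_def
    by (rule suminf_mono_reindex[of "\<lambda>m. 2 * m" "\<lambda>k. (-1) ^ k * exterior_trace X T k"])
      (auto simp: strict_mono_def odd elim!: evenE intro!: odd)
  finally show "fredholm_det X T = fredholm_det Y L" ..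
qed

section \<open>Integrals along curves\<close>

text \<open>The tangent has to be a measurable function of the point, so the parameter must be
  recovered measurably. The image of a closed set is a countable union of compact images of bounded
  pieces, hence Borel, although the inverse need not be continuous.\<close>

lemma borel_left_inverse:
  fixes c :: "real \<Rightarrow> complex"
  assumes cont: "continuous_on UNIV c" and inj: "inj c"
  shows "range c \<in> sets borel" and "\<exists>g. g \<in> borel_measurable borel \<and> (\<forall>t. g (c t) = t)"
proof -
  have image: "c ` S \<in> sets borel" if "closed S" for S
  proof -
    have "c ` S = (\<Union>n. c ` (S \<inter> {- real n..real n}))"
    proof -
      have "\<exists>n. t \<in> {- real n..real n}" for t
      proof -
        obtain n where "\<bar>t\<bar> \<le> real n" using real_arch_simple by blast
        then have "t \<in> {- real n..real n}" by auto
        then show ?thesis ..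
      qed
      then show ?thesis by fastforce
    qed
    moreover have "closed (c ` (S \<inter> {- real n..real n}))" for n
      by (intro compact_imp_closed compact_continuous_image continuous_on_subset[OF cont]
          closed_Int_compact[OF that compact_Icc]) simp
    ultimately show ?thesis by auto
  qed
  show rc: "range c \<in> sets borel" by (rule image) auto
  define g where "g z = (if z \<in> range c then the_inv c z else 0)" for z
  have g: "g (c t) = t" for t
    by (simp add: g_def the_inv_f_f[OF inj])
  have "g \<in> borel_measurable borel"
  proof (rule borel_measurableI)
    fix S :: "real set" assume "open S"
    then have "closed (- S)" by (simp add: closed_def)
    have "g -` S \<inter> space borel = - (g -` (- S))" by auto
    \<comment> \<open>Off the curve g takes the default value 0, so the complement of the curve is
      added exactly when 0 lies in \<open>- S\<close>.\<close>
    also have "g -` (- S) = c ` (- S) \<union> (if 0 \<in> - S then - range c else {})"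
    proof (rule set_eqI)
      fix x show "x \<in> g -` (- S) \<longleftrightarrow> x \<in> c ` (- S) \<union> (if 0 \<in> - S then - range c else {})"
      proof (cases "x \<in> range c")
        case True
        then obtain t where "x = c t" by blast
        then show ?thesis using g by (auto dest: injD[OF inj])
      next
        case False
        then show ?thesis by (auto simp: g_def)
      qed
    qed
    finally show "g -` S \<inter> space borel \<in> sets borel"
      using image[OF \<open>closed (- S)\<close>] rc by (auto split: if_splits)
  qed
  with g show "\<exists>g. g \<in> borel_measurable borel \<and> (\<forall>t. g (c t) = t)" by blast
qed

section \<open>Decay of the exponential weights along unbounded curves\<close>

lemma set_integrable_FTC_atLeast:
  fixes f F :: "real \<Rightarrow> real"
  assumes f: "f \<in> borel_measurable borel" and F: "\<And>t. a \<le> t \<Longrightarrow> (F has_real_derivative f t) (at t)"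
    and nonneg: "\<And>t. a \<le> t \<Longrightarrow> 0 \<le> f t" and lim: "(F \<longlongrightarrow> L) at_top"
  shows "set_integrable lborel {a..} f"
proof -
  have "(\<integral>\<^sup>+t. ennreal (indicator {a..} t * f t) \<partial>lborel) =
      (\<integral>\<^sup>+t. ennreal (f t) * indicator {a..} t \<partial>lborel)"
    by (intro nn_integral_cong) (auto simp: indicator_def)
  also have "\<dots> = ennreal (L - F a)"
    by (rule nn_integral_FTC_atLeast[OF f F nonneg lim])
  finally have "(\<integral>\<^sup>+t. ennreal (indicator {a..} t * f t) \<partial>lborel) < \<infinity>"
    by (simp only: ennreal_less_top infinity_ennreal_def)
  then show ?thesis
    unfolding set_integrable_def real_scaleR_def using f nonneg
    by (intro integrableI_nonneg) (auto simp: indicator_def)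
qed

text \<open>The tangent condition makes \<open>norm c\<close> grow at least half as fast as the arc length, so that
  the weight \<open>exp (- norm c)\<close> is integrable by the fundamental theorem of calculus.\<close>

lemma tail_integrable_exp_norm:
  fixes c c' :: "real \<Rightarrow> complex"
  assumes c: "\<And>t. (c has_vector_derivative c' t) (at t)" and c': "continuous_on UNIV c'"
    and inf: "filterlim (\<lambda>t. norm (c t)) at_top at_top"
    and \<omega>: "((\<lambda>t. sgn (c t)) \<longlongrightarrow> \<omega>) at_top" "((\<lambda>t. sgn (c' t)) \<longlongrightarrow> \<omega>) at_top" "norm \<omega> = 1"
  shows "\<exists>T. \<forall>T'\<ge>T. set_integrable lborel {T'..} (\<lambda>t. norm (c' t) * exp (- norm (c t)))"
proof -
  have [measurable]: "c \<in> borel_measurable borel" "c' \<in> borel_measurable borel"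
    using c c' by (auto intro!: borel_measurable_continuous_onI continuous_at_imp_continuous_on
        has_vector_derivative_continuous)
  have "((\<lambda>t. sgn (c' t) \<bullet> sgn (c t)) \<longlongrightarrow> \<omega> \<bullet> \<omega>) at_top"
    by (intro tendsto_inner \<omega>)
  then have "((\<lambda>t. sgn (c' t) \<bullet> sgn (c t)) \<longlongrightarrow> 1) at_top"
    using \<omega>(3) by (simp add: dot_square_norm)
  then have "\<forall>\<^sub>F t in at_top. 1 / 2 < sgn (c' t) \<bullet> sgn (c t)"
    by (rule order_tendstoD) simp
  moreover have "\<forall>\<^sub>F t in at_top. 0 < norm (c t)"
    using inf unfolding filterlim_at_top_dense by blast
  ultimately have "\<forall>\<^sub>F t in at_top. 1 / 2 < sgn (c' t) \<bullet> sgn (c t) \<and> 0 < norm (c t)"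
    by (rule eventually_conj)
  then obtain T where T: "\<And>t. T \<le> t \<Longrightarrow> 1 / 2 < sgn (c' t) \<bullet> sgn (c t)" "\<And>t. T \<le> t \<Longrightarrow> 0 < norm (c t)"
    by (auto simp: eventually_at_top_linorder)
  \<comment> \<open>Where c does not vanish this is the derivative of
    \<open>- 2 * exp (- norm (c t))\<close>, because \<open>norm (c t)\<close> has derivative
    \<open>c' t \<bullet> sgn (c t)\<close>.\<close>
  define f where "f t = 2 * ((c' t \<bullet> sgn (c t)) * exp (- norm (c t)))" for t
  have le: "norm (c' t) \<le> 2 * (c' t \<bullet> sgn (c t))" if "T \<le> t" for t
  proof -
    have "c' t = norm (c' t) *\<^sub>R sgn (c' t)"
      by (cases "c' t = 0") (simp_all add: sgn_div_norm)
    then have "c' t \<bullet> sgn (c t) = norm (c' t) * (sgn (c' t) \<bullet> sgn (c t))"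
      by (metis inner_scaleR_left)
    moreover have "norm (c' t) * (1 / 2) \<le> norm (c' t) * (sgn (c' t) \<bullet> sgn (c t))"
      using T(1)[OF that] by (intro mult_left_mono) auto
    ultimately show ?thesis by simp
  qed
  have [measurable]: "f \<in> borel_measurable borel"
    unfolding f_def sgn_div_norm by measurable
  show ?thesis
  proof (intro exI[of _ T] allI impI)
    fix T' assume T': "T \<le> T'"
    have int: "set_integrable lborel {T'..} f"
    proof (rule set_integrable_FTC_atLeast)
      fix t assume t: "T' \<le> t"
      then have t: "T \<le> t" using T' by simp
      have "c t \<noteq> 0" using T(2)[OF t] by auto
      have "((\<lambda>t. norm (c t)) has_derivative (\<lambda>h. (h *\<^sub>R c' t) \<bullet> sgn (c t))) (at t)"
        using has_derivative_compose[OF c[of t, unfolded has_vector_derivative_def]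
            has_derivative_norm[OF \<open>c t \<noteq> 0\<close>]] by (simp add: o_def)
      then have "((\<lambda>t. norm (c t)) has_real_derivative (c' t \<bullet> sgn (c t))) (at t)"
        unfolding has_field_derivative_def
        by (rule has_derivative_eq_rhs) (simp add: fun_eq_iff mult.commute)
      then show "((\<lambda>t. - 2 * exp (- norm (c t))) has_real_derivative f t) (at t)"
        unfolding f_def by (auto intro!: derivative_eq_intros)
      show "0 \<le> f t"
        unfolding f_def using order_trans[OF norm_ge_zero le[OF t]] by simp
    next
      have "((\<lambda>t. - 2 * exp (- norm (c t))) \<longlongrightarrow> - 2 * 0) at_top"
        by (intro tendsto_mult tendsto_const filterlim_compose[OF exp_at_bot]
            filterlim_compose[OF filterlim_uminus_at_bot_at_top] inf)
      then show "((\<lambda>t. - 2 * exp (- norm (c t))) \<longlongrightarrow> 0) at_top" by simp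
    qed measurable
    show "set_integrable lborel {T'..} (\<lambda>t. norm (c' t) * exp (- norm (c t)))"
      unfolding set_integrable_def
    proof (rule Bochner_Integration.integrable_bound[OF int[unfolded set_integrable_def]])
      show "AE t in lborel. norm (indicator {T'..} t *\<^sub>R (norm (c' t) * exp (- norm (c t))))
          \<le> norm (indicator {T'..} t *\<^sub>R f t)"
      proof (intro AE_I2)
        fix t
        show "norm (indicator {T'..} t *\<^sub>R (norm (c' t) * exp (- norm (c t)))) \<le> norm (indicator {T'..} t *\<^sub>R f t)"
        proof (cases "T' \<le> t")
          case True
          have "norm (c' t) * exp (- norm (c t)) \<le> 2 * (c' t \<bullet> sgn (c t)) * exp (- norm (c t))"
            using True T' by (intro mult_right_mono le) auto
          also have "\<dots> \<le> norm (f t)" by (simp add: f_def mult.assoc)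
          finally show ?thesis using True by simp
        qed simp
      qed
    qed measurable
  qed
qed

text \<open>The threshold makes r^4/8 at least (A + R + 1) r^2. Since r <= r^2, the three parts pay
  for the quadratic term, the linear term and the - r on the right.\<close>

lemma quartic_dominates:
  fixes r A R :: real
  assumes "r \<ge> 1" "r\<^sup>2 \<ge> 8 * (A + R + 1)" "A \<ge> 0" "R \<ge> 0"
  shows "- (r ^ 4) / 8 + A * r\<^sup>2 + R * r \<le> - r"
proof -
  have "8 * (A + R + 1) * r\<^sup>2 \<le> r\<^sup>2 * r\<^sup>2"
    using assms by (intro mult_right_mono) auto
  moreover have "8 * (A + R + 1) * r\<^sup>2 = 8 * ((A + R + 1) * r\<^sup>2)" "r\<^sup>2 * r\<^sup>2 = r ^ 4"
    by (simp_all flip: power_add)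
  ultimately have "(A + R + 1) * r\<^sup>2 \<le> r ^ 4 / 8"
    by linarith
  moreover have "R * r \<le> R * r\<^sup>2" "r \<le> r\<^sup>2"
    using assms by (auto intro!: mult_left_mono simp: power2_eq_square)
  ultimately show ?thesis by (simp add: algebra_simps)
qed

lemma Re_of_real_mult: "Re (of_real a * w) = a * Re w"
  by simp

text \<open>The sign \<sigma> treats the curves, where exp Theta decays, together with the imaginary
  axis, where exp (- Theta) does. Polar form separates the modulus from the direction, which
  converges at infinity.\<close>

lemma Theta_scaled_le:
  assumes "\<sigma> = 1 \<or> \<sigma> = (-1 :: real)"
  shows "\<sigma> * Re (Theta \<tau> 0 z) \<le> (norm z) ^ 4 * (\<sigma> * Re (sgn z ^ 4)) / 4 + \<bar>\<tau>\<bar> / 2 * (norm z)\<^sup>2"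
proof -
  have z: "z = of_real (norm z) * sgn z"
    by (simp add: sgn_eq)
  then have "z ^ 4 = of_real ((norm z) ^ 4) * sgn z ^ 4"
    by (metis of_real_power power_mult_distrib)
  then have 1: "Re (z ^ 4) = (norm z) ^ 4 * Re (sgn z ^ 4)"
    by (simp only: Re_of_real_mult)
  have "\<bar>Re (z\<^sup>2)\<bar> \<le> (norm z)\<^sup>2"
    using abs_Re_le_cmod[of "z\<^sup>2"] by (simp add: norm_power)
  then have "\<bar>\<sigma> * (\<tau> / 2) * Re (z\<^sup>2)\<bar> \<le> \<bar>\<tau>\<bar> / 2 * (norm z)\<^sup>2"
    using assms by (auto simp: abs_mult intro!: mult_left_mono)
  then have 2: "- (\<sigma> * (\<tau> / 2) * Re (z\<^sup>2)) \<le> \<bar>\<tau>\<bar> / 2 * (norm z)\<^sup>2"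
    by linarith
  have "Re (Theta \<tau> 0 z) = Re (z ^ 4) / 4 - \<tau> / 2 * Re (z\<^sup>2)"
    by (simp add: Theta_def)
  then have "\<sigma> * Re (Theta \<tau> 0 z) = \<sigma> * Re (z ^ 4) / 4 - \<sigma> * (\<tau> / 2) * Re (z\<^sup>2)"
    by (simp add: right_diff_distrib)
  with 1 2 show ?thesis by (simp add: mult_ac)
qed

text \<open>The condition on \<open>\<omega> ^ 4\<close> says that the quartic term is negative in
  the limiting direction. Near infinity at least half of its coefficient 1/4 survives, hence the 1/8
  in \<open>quartic_dominates\<close>, and pushes the exponent below
  \<open>- norm (c t)\<close>.\<close>

lemma tail_integrable_Theta:
  fixes c c' :: "real \<Rightarrow> complex"
  assumes c: "\<And>t. (c has_vector_derivative c' t) (at t)" and c': "continuous_on UNIV c'"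
    and inf: "filterlim (\<lambda>t. norm (c t)) at_top at_top"
    and \<omega>: "((\<lambda>t. sgn (c t)) \<longlongrightarrow> \<omega>) at_top" "((\<lambda>t. sgn (c' t)) \<longlongrightarrow> \<omega>) at_top" "norm \<omega> = 1"
    and \<sigma>: "\<sigma> = 1 \<or> \<sigma> = -1" "of_real \<sigma> * \<omega> ^ 4 = -1" and R: "R \<ge> 0"
  shows "\<exists>T. \<forall>T'\<ge>T. set_integrable lborel {T'..}
    (\<lambda>t. norm (c' t) * exp (\<sigma> * Re (Theta \<tau> 0 (c t)) + R * norm (c t)))"
proof -
  have [measurable]: "c \<in> borel_measurable borel" "c' \<in> borel_measurable borel"
    using c c' by (auto intro!: borel_measurable_continuous_onI continuous_at_imp_continuous_on
        has_vector_derivative_continuous)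
  obtain T1 where T1: "\<And>T'. T1 \<le> T' \<Longrightarrow> set_integrable lborel {T'..} (\<lambda>t. norm (c' t) * exp (- norm (c t)))"
    using tail_integrable_exp_norm[OF c c' inf \<omega>] by blast
  let ?A = "\<bar>\<tau>\<bar> / 2"
  have "((\<lambda>t. Re (of_real \<sigma> * sgn (c t) ^ 4)) \<longlongrightarrow> Re (of_real \<sigma> * \<omega> ^ 4)) at_top"
    by (intro tendsto_intros \<omega>)
  then have "((\<lambda>t. \<sigma> * Re (sgn (c t) ^ 4)) \<longlongrightarrow> -1) at_top"
    by (simp only: \<sigma>(2) Re_of_real_mult) simp
  then have "\<forall>\<^sub>F t in at_top. \<sigma> * Re (sgn (c t) ^ 4) < - 1 / 2"
    by (rule order_tendstoD) simp
  moreover have "\<forall>\<^sub>F t in at_top. max 1 (8 * (?A + R + 1)) \<le> norm (c t)"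
    using inf by (simp only: filterlim_at_top)
  ultimately have "\<forall>\<^sub>F t in at_top. \<sigma> * Re (Theta \<tau> 0 (c t)) + R * norm (c t) \<le> - norm (c t)"
  proof eventually_elim
    case (elim t)
    let ?r = "norm (c t)"
    have r: "?r \<ge> 1" "?r \<ge> 8 * (?A + R + 1)" using elim(2) by auto
    have "?r ^ 4 * (\<sigma> * Re (sgn (c t) ^ 4)) \<le> ?r ^ 4 * (- 1 / 2)"
      using elim(1) by (intro mult_left_mono) auto
    then have "\<sigma> * Re (Theta \<tau> 0 (c t)) + R * ?r \<le> - (?r ^ 4) / 8 + ?A * ?r\<^sup>2 + R * ?r"
      using Theta_scaled_le[OF \<sigma>(1), of \<tau> "c t"] by linarith
    also have "\<dots> \<le> - ?r"
    proof (rule quartic_dominates)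
      have "?r * 1 \<le> ?r * ?r" using r(1) by (intro mult_left_mono) auto
      then show "8 * (?A + R + 1) \<le> ?r\<^sup>2" using r(2) by (simp add: power2_eq_square)
    qed (use r R in auto)
    finally show ?case .
  qed
  then obtain T2 where T2: "\<And>t. T2 \<le> t \<Longrightarrow> \<sigma> * Re (Theta \<tau> 0 (c t)) + R * norm (c t) \<le> - norm (c t)"
    by (auto simp: eventually_at_top_linorder)
  have [measurable]: "(\<lambda>t. Theta \<tau> 0 (c t)) \<in> borel_measurable borel"
    unfolding Theta_def by measurable
  show ?thesis
  proof (intro exI[of _ "max T1 T2"] allI impI)
    fix T' assume T': "max T1 T2 \<le> T'"
    show "set_integrable lborel {T'..} (\<lambda>t. norm (c' t) * exp (\<sigma> * Re (Theta \<tau> 0 (c t)) + R * norm (c t)))"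
      unfolding set_integrable_def
    proof (rule Bochner_Integration.integrable_bound[OF T1[of T', unfolded set_integrable_def]])
      show "AE t in lborel. norm (indicator {T'..} t *\<^sub>R (norm (c' t) * exp (\<sigma> * Re (Theta \<tau> 0 (c t)) + R * norm (c t))))
          \<le> norm (indicator {T'..} t *\<^sub>R (norm (c' t) * exp (- norm (c t))))"
        using T2 T' by (intro AE_I2) (auto simp: indicator_def abs_mult intro!: mult_left_mono)
    qed (use T' in \<open>auto\<close>)
  qed
qed

lemma curve_integrable_Theta:
  fixes c c' :: "real \<Rightarrow> complex"
  assumes c: "\<And>t. (c has_vector_derivative c' t) (at t)" and c': "continuous_on UNIV c'"
    and inf: "filterlim (\<lambda>t. norm (c t)) at_top at_top" "filterlim (\<lambda>t. norm (c t)) at_top at_bot"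
    and \<omega>: "((\<lambda>t. sgn (c t)) \<longlongrightarrow> \<omega>) at_top" "((\<lambda>t. sgn (c' t)) \<longlongrightarrow> \<omega>) at_top" "norm \<omega> = 1"
    and \<nu>: "((\<lambda>t. sgn (c t)) \<longlongrightarrow> \<nu>) at_bot" "((\<lambda>t. sgn (c' t)) \<longlongrightarrow> - \<nu>) at_bot" "norm \<nu> = 1"
    and \<sigma>: "\<sigma> = 1 \<or> \<sigma> = -1" "of_real \<sigma> * \<omega> ^ 4 = -1" "of_real \<sigma> * \<nu> ^ 4 = -1" and R: "R \<ge> 0"
  shows "integrable lborel (\<lambda>t. norm (c' t) * exp (\<sigma> * Re (Theta \<tau> 0 (c t)) + R * norm (c t)))"
proof -
  let ?f = "\<lambda>t. norm (c' t) * exp (\<sigma> * Re (Theta \<tau> 0 (c t)) + R * norm (c t))"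
  have cc: "continuous_on UNIV c"
    using c by (auto intro!: continuous_at_imp_continuous_on has_vector_derivative_continuous)
  have cont: "continuous_on UNIV ?f"
    unfolding Theta_def by (intro continuous_intros cc c') auto
  have [measurable]: "?f \<in> borel_measurable borel"
    using cont by (rule borel_measurable_continuous_onI)
  obtain T1 where T1: "\<And>T'. T1 \<le> T' \<Longrightarrow> set_integrable lborel {T'..} ?f"
    using tail_integrable_Theta[OF c c' inf(1) \<omega> \<sigma>(1,2) R] by blast
  \<comment> \<open>The end at minus infinity becomes the other one by reversing the parameter. This
    changes the sign of the tangent, hence the limit \<open>- \<nu>\<close> in the
    hypothesis.\<close>
  let ?d = "\<lambda>t. c (- t)" and ?d' = "\<lambda>t. - c' (- t)"
  have flip: "filterlim (uminus :: real \<Rightarrow> real) at_bot at_top" by (rule filterlim_uminus_at_bot_at_top)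
  have "\<exists>T. \<forall>T'\<ge>T. set_integrable lborel {T'..}
      (\<lambda>t. norm (?d' t) * exp (\<sigma> * Re (Theta \<tau> 0 (?d t)) + R * norm (?d t)))"
  proof (rule tail_integrable_Theta)
    show "(?d has_vector_derivative ?d' t) (at t)" for t
      using vector_diff_chain_at[OF has_vector_derivative_minus[OF has_vector_derivative_id] c]
      by (simp add: o_def)
    show "continuous_on UNIV ?d'"
      by (intro continuous_intros continuous_on_compose2[OF c']) auto
    show "filterlim (\<lambda>t. norm (?d t)) at_top at_top"
      by (rule filterlim_compose[OF inf(2) flip])
    show "((\<lambda>t. sgn (?d t)) \<longlongrightarrow> \<nu>) at_top"
      by (rule filterlim_compose[OF \<nu>(1) flip])
    have "((\<lambda>t. - sgn (c' (- t))) \<longlongrightarrow> - (- \<nu>)) at_top"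
      by (intro tendsto_minus filterlim_compose[OF \<nu>(2) flip])
    then show "((\<lambda>t. sgn (?d' t)) \<longlongrightarrow> \<nu>) at_top"
      by (simp add: sgn_minus)
  qed (use \<nu>(3) \<sigma> R in auto)
  then obtain T2 where T2: "\<And>T'. T2 \<le> T' \<Longrightarrow> set_integrable lborel {T'..} (\<lambda>t. ?f (- t))"
    by auto
  define T where "T = max 0 (max T1 T2)"
  have "integrable lborel (\<lambda>t. indicator {T..} (0 + (-1) * t) *\<^sub>R ?f (- (0 + (-1) * t)))"
    using T2[of T] by (subst lborel_integrable_real_affine_iff) (auto simp: set_integrable_def T_def)
  also have "(\<lambda>t. indicator {T..} (0 + (-1) * t) *\<^sub>R ?f (- (0 + (-1) * t))) = (\<lambda>t. indicator {..-T} t *\<^sub>R ?f t)"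
    by (auto simp: indicator_def fun_eq_iff)
  finally have "set_integrable lborel {..-T} ?f"
    by (simp add: set_integrable_def)
  moreover have "set_integrable lborel {-T..T} ?f"
    by (rule borel_integrable_atLeastAtMost') (rule continuous_on_subset[OF cont], simp)
  moreover have "set_integrable lborel {T..} ?f"
    by (rule T1) (simp add: T_def)
  ultimately have "set_integrable lborel ({..-T} \<union> {-T..T} \<union> {T..}) ?f"
    by (intro set_integrable_Un) auto
  moreover have "{..-T} \<union> {-T..T} \<union> {T..} = UNIV" by auto
  ultimately show ?thesis by (simp add: set_integrable_def)
qed

lemma exp_half_line_integral:
  fixes w :: complex
  assumes w: "Re w > 0"
  shows "set_integrable lborel {0<..} (\<lambda>s. exp (- of_real s * w))"
    and "(\<integral>s. indicator {0<..} s *\<^sub>R exp (- of_real s * w) \<partial>lborel) = 1 / w"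
proof -
  have "filterlim (\<lambda>s. Re w * s) at_top at_top"
    by (rule filterlim_tendsto_pos_mult_at_top[OF tendsto_const w filterlim_ident])
  then have bot: "filterlim (\<lambda>s. - s * Re w) at_bot at_top"
    unfolding filterlim_uminus_at_bot by (simp add: mult.commute)
  have "set_integrable lborel {0..} (\<lambda>s. exp (- s * Re w) :: real)"
  proof (rule set_integrable_FTC_atLeast)
    show "((\<lambda>s. - exp (- s * Re w) / Re w) has_real_derivative exp (- s * Re w)) (at s)" for s
      using w by (auto intro!: derivative_eq_intros)
    have "((\<lambda>s. - exp (- s * Re w) / Re w) \<longlongrightarrow> - 0 / Re w) at_top"
      using w by (intro tendsto_divide tendsto_minus tendsto_const filterlim_compose[OF exp_at_bot bot]) auto
    then show "((\<lambda>s. - exp (- s * Re w) / Re w) \<longlongrightarrow> 0) at_top" by simp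
  qed auto
  then have r: "set_integrable lborel {0<..} (\<lambda>s. exp (- s * Re w) :: real)"
    by (rule set_integrable_subset) auto
  show int: "set_integrable lborel {0<..} (\<lambda>s. exp (- of_real s * w))"
    unfolding set_integrable_def
    by (rule Bochner_Integration.integrable_bound[OF r[unfolded set_integrable_def]])
      (auto intro!: AE_I2 simp: norm_exp_eq_Re)
  have "(LBINT s=0..\<infinity>. exp (- of_real s * w)) = 0 - (- 1 / w)"
  proof (rule interval_integral_FTC_integrable)
    have "w \<noteq> 0" using w by auto
    then have "((\<lambda>z. - exp (- z * w) / w) has_field_derivative exp (- z * w)) (at z)" for z
      by (auto intro!: derivative_eq_intros)
    from has_vector_derivative_real_field[OF this]
    show "((\<lambda>s. - exp (- of_real s * w) / w) has_vector_derivative exp (- of_real s * w)) (at s)" for s .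
    show "set_integrable lborel (einterval 0 \<infinity>) (\<lambda>s. exp (- of_real s * w))"
      using int by (simp add: einterval_def zero_ereal_def greaterThan_def)
    have "((\<lambda>s. - exp (- of_real s * w) / w) \<longlongrightarrow> - exp (- of_real 0 * w) / w) (at_right 0)"
      by (intro tendsto_intros) (use w in auto)
    then show "(((\<lambda>s. - exp (- of_real s * w) / w) \<circ> real_of_ereal) \<longlongrightarrow> - 1 / w) (at_right 0)"
      unfolding zero_ereal_def ereal_tendsto_simps by simp
    have "((\<lambda>s. norm (exp (- of_real s * w))) \<longlongrightarrow> 0) at_top"
      using filterlim_compose[OF exp_at_bot bot] by (simp add: norm_exp_eq_Re)
    then have "((\<lambda>s. exp (- of_real s * w)) \<longlongrightarrow> 0) at_top"
      by (rule tendsto_norm_zero_cancel)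
    then have "((\<lambda>s. - exp (- of_real s * w) / w) \<longlongrightarrow> - 0 / w) at_top"
      using w by (intro tendsto_divide tendsto_minus tendsto_const) auto
    then show "(((\<lambda>s. - exp (- of_real s * w) / w) \<circ> real_of_ereal) \<longlongrightarrow> 0) (at_left \<infinity>)"
      unfolding ereal_tendsto_simps by simp
  qed (auto intro!: continuous_intros)
  then show "(\<integral>s. indicator {0<..} s *\<^sub>R exp (- of_real s * w) \<partial>lborel) = 1 / w"
    by (simp add: interval_lebesgue_integral_def set_lebesgue_integral_def einterval_def zero_ereal_def
        greaterThan_def)
qed

section \<open>Integration with respect to arc length\<close>

declare sets_arc_length [measurable_cong]

lemma space_arc_length [simp]: "space (arc_length cs) = UNIV"
  using sets_eq_imp_space_eq[OF sets_arc_length[of cs]] by simp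

lemma emeasure_curve_measure:
  assumes [measurable]: "c \<in> borel_measurable borel"
    "(\<lambda>t. vector_derivative c (at t)) \<in> borel_measurable borel" and A [measurable]: "A \<in> sets borel"
  shows "emeasure (curve_measure c) A =
    (\<integral>\<^sup>+t. ennreal (norm (vector_derivative c (at t))) * indicator A (c t) \<partial>lborel)"
proof -
  have "emeasure (curve_measure c) A =
      (\<integral>\<^sup>+t. ennreal (norm (vector_derivative c (at t))) * indicator (c -` A \<inter> UNIV) t \<partial>lborel)"
    using measurable_sets[OF assms(1) A]
    unfolding curve_measure_def by (simp add: emeasure_distr emeasure_density)
  also have "\<dots> = (\<integral>\<^sup>+t. ennreal (norm (vector_derivative c (at t))) * indicator A (c t) \<partial>lborel)"
    by (intro nn_integral_cong) (auto simp: indicator_def)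
  finally show ?thesis .
qed

text \<open>A region containing c and missing all other curves singles out one summand in the sum of
  measures. In this way integrals over the contour reduce to integrals over one parameter at a
  time.\<close>

lemma density_arc_length_region:
  assumes cs: "cs = xs @ c # ys"
    and meas: "\<And>d. d \<in> set cs \<Longrightarrow> d \<in> borel_measurable borel"
      "\<And>d. d \<in> set cs \<Longrightarrow> (\<lambda>t. vector_derivative d (at t)) \<in> borel_measurable borel"
    and R: "R \<in> sets borel" "\<And>t. c t \<in> R" "\<And>d t. d \<in> set xs \<union> set ys \<Longrightarrow> d t \<notin> R"
  shows "density (arc_length cs) (\<lambda>z. ennreal (indicator R z)) = curve_measure c"
proof (rule measure_eqI)
  show "sets (density (arc_length cs) (\<lambda>z. ennreal (indicator R z))) = sets (curve_measure c)"
    by (simp add: curve_measure_def)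
  fix A assume "A \<in> sets (density (arc_length cs) (\<lambda>z. ennreal (indicator R z)))"
  then have A: "A \<in> sets borel" by simp
  have RA: "R \<inter> A \<in> sets borel" using A R(1) by auto
  have zero: "emeasure (curve_measure d) (R \<inter> A) = 0" if "d \<in> set xs \<union> set ys" for d
  proof -
    have "indicator (R \<inter> A) (d t) = (0 :: ennreal)" for t
      using R(3)[OF that, of t] by (simp add: indicator_def)
    then show ?thesis
      using that cs by (subst emeasure_curve_measure[OF meas RA]) auto
  qed
  have one: "emeasure (curve_measure c) (R \<inter> A) = emeasure (curve_measure c) A"
  proof -
    have "indicator (R \<inter> A) (c t) = (indicator A (c t) :: ennreal)" for t
      using R(2)[of t] by (simp add: indicator_def)
    moreover have "c \<in> set cs" by (simp add: cs)
    ultimately show ?thesis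
      by (simp add: emeasure_curve_measure[OF meas RA] emeasure_curve_measure[OF meas A])
  qed
  have sum0: "(\<Sum>d\<leftarrow>zs. emeasure (curve_measure d) (R \<inter> A)) = 0" if "set zs \<subseteq> set xs \<union> set ys" for zs
    using that by (induction zs) (auto simp: zero)
  have "emeasure (density (arc_length cs) (\<lambda>z. ennreal (indicator R z))) A =
      (\<integral>\<^sup>+z. ennreal (indicator R z) * indicator A z \<partial>arc_length cs)"
    using A R(1) by (intro emeasure_density) auto
  also have "\<dots> = (\<integral>\<^sup>+z. indicator (R \<inter> A) z \<partial>arc_length cs)"
    by (intro nn_integral_cong) (auto simp: indicator_def)
  also have "\<dots> = emeasure (arc_length cs) (R \<inter> A)"
    by (rule nn_integral_indicator) (simp add: RA)
  also have "\<dots> = emeasure (curve_measure c) A"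
    unfolding emeasure_arc_length[OF RA] by (simp add: cs sum0 one)
  finally show "emeasure (density (arc_length cs) (\<lambda>z. ennreal (indicator R z))) A = emeasure (curve_measure c) A" .
qed

lemma curve_measure_integral:
  fixes f :: "complex \<Rightarrow> 'b :: {banach, second_countable_topology}"
  assumes [measurable]: "c \<in> borel_measurable borel"
    "(\<lambda>t. vector_derivative c (at t)) \<in> borel_measurable borel" "f \<in> borel_measurable borel"
  shows "integrable (curve_measure c) f \<longleftrightarrow>
      integrable lborel (\<lambda>t. norm (vector_derivative c (at t)) *\<^sub>R f (c t))"
    and "(\<integral>z. f z \<partial>curve_measure c) = (\<integral>t. norm (vector_derivative c (at t)) *\<^sub>R f (c t) \<partial>lborel)"
  unfolding curve_measure_def
  by (simp_all add: integrable_distr_eq integrable_density integral_distr integral_density)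

lemma arc_length_region_integral:
  fixes f :: "complex \<Rightarrow> 'b :: {banach, second_countable_topology}"
  assumes cs: "cs = xs @ c # ys"
    and meas: "\<And>d. d \<in> set cs \<Longrightarrow> d \<in> borel_measurable borel"
      "\<And>d. d \<in> set cs \<Longrightarrow> (\<lambda>t. vector_derivative d (at t)) \<in> borel_measurable borel"
    and R: "R \<in> sets borel" "\<And>t. c t \<in> R" "\<And>d t. d \<in> set xs \<union> set ys \<Longrightarrow> d t \<notin> R"
    and f: "f \<in> borel_measurable borel"
  shows "integrable (arc_length cs) (\<lambda>z. indicator R z *\<^sub>R f z) \<longleftrightarrow>
      integrable lborel (\<lambda>t. norm (vector_derivative c (at t)) *\<^sub>R f (c t))"
    and "(\<integral>z. indicator R z *\<^sub>R f z \<partial>arc_length cs) =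
      (\<integral>t. norm (vector_derivative c (at t)) *\<^sub>R f (c t) \<partial>lborel)"
proof -
  have c: "c \<in> set cs" by (simp add: cs)
  have [measurable]: "R \<in> sets (arc_length cs)" "f \<in> borel_measurable (arc_length cs)"
    using R(1) f by auto
  have 1: "integrable (arc_length cs) (\<lambda>z. indicator R z *\<^sub>R f z) \<longleftrightarrow>
      integrable (density (arc_length cs) (\<lambda>z. ennreal (indicator R z))) f"
    by (subst integrable_density) auto
  have 2: "(\<integral>z. indicator R z *\<^sub>R f z \<partial>arc_length cs) =
      (\<integral>z. f z \<partial>density (arc_length cs) (\<lambda>z. ennreal (indicator R z)))"
    by (subst integral_density) auto
  have 3: "density (arc_length cs) (\<lambda>z. ennreal (indicator R z)) = curve_measure c"
    by (rule density_arc_length_region[of cs xs c ys R]; fact)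
  show "integrable (arc_length cs) (\<lambda>z. indicator R z *\<^sub>R f z) \<longleftrightarrow>
      integrable lborel (\<lambda>t. norm (vector_derivative c (at t)) *\<^sub>R f (c t))"
    unfolding 1 3 by (rule curve_measure_integral(1)[OF meas[OF c] f])
  show "(\<integral>z. indicator R z *\<^sub>R f z \<partial>arc_length cs) =
      (\<integral>t. norm (vector_derivative c (at t)) *\<^sub>R f (c t) \<partial>lborel)"
    unfolding 2 3 by (rule curve_measure_integral(2)[OF meas[OF c] f])
qed

text \<open>By Markov's inequality the sets where n \<phi> >= 1 have finite measure; they exhaust
  everything but the zero set of \<phi>.\<close>

lemma sigma_finite_of_integrable:
  fixes \<phi> :: "'a \<Rightarrow> real"
  assumes \<phi>: "integrable M \<phi>" "\<And>x. x \<in> space M \<Longrightarrow> 0 \<le> \<phi> x"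
    and null: "emeasure M {x\<in>space M. \<phi> x = 0} < \<infinity>"
  shows "sigma_finite_measure M"
proof
  have [measurable]: "\<phi> \<in> borel_measurable M" using \<phi>(1) by auto
  define A where "A n = {x\<in>space M. 1 \<le> of_nat n * ennreal (\<phi> x)}" for n :: nat
  let ?Z = "{x\<in>space M. \<phi> x = 0}"
  have fin: "emeasure M (A n) \<noteq> \<infinity>" for n
  proof -
    have "emeasure M (A n) \<le> of_nat n * (\<integral>\<^sup>+x. ennreal (\<phi> x) * indicator (space M) x \<partial>M)"
      unfolding A_def by (rule nn_integral_Markov_inequality) auto
    also have "(\<integral>\<^sup>+x. ennreal (\<phi> x) * indicator (space M) x \<partial>M) = (\<integral>\<^sup>+x. ennreal (\<phi> x) \<partial>M)"
      by (intro nn_integral_cong) auto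
    also have "\<dots> = ennreal (\<integral>x. \<phi> x \<partial>M)"
      using \<phi> by (intro nn_integral_eq_integral) auto
    finally show ?thesis
      by (auto simp: ennreal_of_nat_eq_real_of_nat top_unique ennreal_mult_eq_top_iff)
  qed
  have cover: "x \<in> \<Union>(insert ?Z (range A))" if "x \<in> space M" for x
  proof (cases "\<phi> x = 0")
    case False
    then have pos: "\<phi> x > 0" using \<phi>(2)[OF that] by simp
    obtain n where "1 / \<phi> x \<le> real n" using real_arch_simple by blast
    then have "1 \<le> real n * \<phi> x" using pos by (simp add: divide_le_eq)
    then have "ennreal 1 \<le> ennreal (real n * \<phi> x)" by (rule ennreal_leI)
    then have "x \<in> A n"
      using that pos by (simp add: A_def ennreal_mult ennreal_of_nat_eq_real_of_nat)
    then show ?thesis by blast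
  qed (use that in auto)
  show "\<exists>A. countable A \<and> A \<subseteq> sets M \<and> \<Union> A = space M \<and> (\<forall>a\<in>A. emeasure M a \<noteq> \<infinity>)"
  proof (intro exI[of _ "insert ?Z (range A)"] conjI)
    show "\<Union>(insert ?Z (range A)) = space M"
      using cover by (auto simp: A_def)
    show "insert ?Z (range A) \<subseteq> sets M"
      unfolding A_def by auto
    show "\<forall>a\<in>insert ?Z (range A). emeasure M a \<noteq> \<infinity>"
      using fin null by auto
  qed auto
qed

section \<open>The oriented contour and its weights\<close>

locale pearcey_contour =
  fixes \<gamma> :: "real \<Rightarrow> complex"
  assumes right_contour: "right_contour \<gamma>"
begin

abbreviation "d\<gamma> t \<equiv> vector_derivative \<gamma> (at t)"
abbreviation "M \<equiv> arc_length (full_contour \<gamma>)"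
abbreviation "LR \<equiv> curve_support (left_right \<gamma>)"
abbreviation "IM \<equiv> range imaginary_axis"

lemma smooth: "smooth_curve \<gamma>"
  using right_contour by (simp add: right_contour_def)

lemma has_derivative: "(\<gamma> has_vector_derivative d\<gamma> t) (at t)"
proof -
  have "((\<lambda>f s. vector_derivative f (at s)) ^^ 0) \<gamma> differentiable (at t)"
    using smooth unfolding smooth_curve_def by blast
  then show ?thesis by (simp add: vector_derivative_works)
qed

lemma continuous_derivative: "continuous_on UNIV (\<lambda>t. d\<gamma> t)"
proof -
  have "((\<lambda>f s. vector_derivative f (at s)) ^^ 1) \<gamma> differentiable (at t)" for t
    using smooth unfolding smooth_curve_def by blast
  then have "(\<lambda>s. d\<gamma> s) differentiable (at t)" for t by simp
  then show ?thesis
    by (intro continuous_at_imp_continuous_on ballI differentiable_imp_continuous_within)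
qed

lemma derivative_nonzero: "d\<gamma> t \<noteq> 0"
  using smooth by (simp add: smooth_curve_def)

lemma continuous: "continuous_on UNIV \<gamma>"
  using has_derivative by (auto intro!: continuous_at_imp_continuous_on has_vector_derivative_continuous)

lemma measurable_curves [measurable]:
  "\<gamma> \<in> borel_measurable borel" "(\<lambda>t. d\<gamma> t) \<in> borel_measurable borel"
  "imaginary_axis \<in> borel_measurable borel"
  using continuous continuous_derivative
  by (auto intro!: borel_measurable_continuous_onI continuous_intros simp: imaginary_axis_def[abs_def])

lemma derivative_left: "vector_derivative (\<lambda>t. - \<gamma> t) (at t) = - d\<gamma> t"
  by (intro vector_derivative_at has_vector_derivative_minus has_derivative)

lemma imaginary_axis_has_derivative: "(imaginary_axis has_vector_derivative \<i>) (at t)"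
  unfolding imaginary_axis_def[abs_def]
  by (auto intro!: derivative_eq_intros has_vector_derivative_real_field)

lemma derivative_imaginary: "vector_derivative imaginary_axis (at t) = \<i>"
  by (rule vector_derivative_at[OF imaginary_axis_has_derivative])

lemma Re_imaginary_axis [simp]: "Re (imaginary_axis t) = 0"
  by (simp add: imaginary_axis_def)

lemma IM_eq: "IM = {z. Re z = 0}"
proof
  show "{z. Re z = 0} \<subseteq> IM"
    by (auto simp: imaginary_axis_def complex_eq_iff intro!: image_eqI[of _ _ "Im _"])
qed auto

lemma exists_gap: "\<exists>c>0. \<forall>t. 2 * c \<le> Re (\<gamma> t)"
proof -
  obtain \<delta> where "\<delta> > 0" "\<forall>t. \<delta> \<le> Re (\<gamma> t)"
    using right_contour by (auto simp: right_contour_def)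
  then show ?thesis by (intro exI[of _ "\<delta> / 2"]) auto
qed

text \<open>The real parts on the right curve are at least twice this number: one half is spent on
  the factor exp (gap |s|) in \<open>curve_to_line\<close>, the other remains as decay in s.\<close>

definition gap where "gap = (SOME c. c > 0 \<and> (\<forall>t. 2 * c \<le> Re (\<gamma> t)))"

lemma gap_pos: "gap > 0" and gap_le: "2 * gap \<le> Re (\<gamma> t)"
  using someI_ex[OF exists_gap] by (auto simp: gap_def)

lemma Re_pos: "0 < Re (\<gamma> t)"
  using gap_pos gap_le[of t] by linarith

definition parameter where
  "parameter = (SOME g. g \<in> borel_measurable borel \<and> (\<forall>t. g (\<gamma> t) = t))"

lemma parameter_measurable [measurable]: "parameter \<in> borel_measurable borel"
  and parameter_curve [simp]: "parameter (\<gamma> t) = t"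
proof -
  have "inj \<gamma>" using smooth by (simp add: smooth_curve_def)
  from someI_ex[OF borel_left_inverse(2)[OF continuous this]]
  show "parameter \<in> borel_measurable borel" "parameter (\<gamma> t) = t"
    by (auto simp: parameter_def)
qed

text \<open>Multiplication by it turns arc length into the complex line element. The left curve is t
  -> - \<gamma> t, whence the parameter of - z and the minus sign. Off the contour the value is some
  unit number, so that the modulus is 1 everywhere.\<close>

definition tangent :: "complex \<Rightarrow> complex" where
  "tangent z = (if Re z = 0 then \<i> else if Re z > 0 then sgn (d\<gamma> (parameter z))
    else - sgn (d\<gamma> (parameter (- z))))"

lemma tangent_measurable [measurable]: "tangent \<in> borel_measurable borel"
proof -
  have [measurable]: "(\<lambda>z. d\<gamma> (parameter z)) \<in> borel_measurable borel"
    using measurable_compose[OF parameter_measurable measurable_curves(2)] by simp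
  show ?thesis
    unfolding tangent_def[abs_def] sgn_div_norm by measurable
qed

lemma norm_tangent [simp]: "norm (tangent z) = 1"
  using derivative_nonzero by (simp add: tangent_def norm_sgn)

lemma tangent_curves:
  "norm (d\<gamma> t) *\<^sub>R tangent (\<gamma> t) = d\<gamma> t" "norm (d\<gamma> t) *\<^sub>R tangent (- \<gamma> t) = - d\<gamma> t"
  "tangent (imaginary_axis t) = \<i>"
  using Re_pos[of t] derivative_nonzero[of t] by (auto simp: tangent_def sgn_div_norm)

lemma LR_eq: "LR = range \<gamma> \<union> uminus ` range \<gamma>"
  by (auto simp: curve_support_def left_right_def)

lemma LR_borel [measurable]: "LR \<in> sets borel"
proof -
  have "inj \<gamma>" using smooth by (simp add: smooth_curve_def)
  moreover from this have "inj (\<lambda>t. - \<gamma> t)" by (auto simp: inj_def)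
  ultimately have "range \<gamma> \<in> sets borel" "range (\<lambda>t. - \<gamma> t) \<in> sets borel"
    by (intro borel_left_inverse(1) continuous continuous_intros; simp)+
  then show ?thesis by (simp add: LR_eq image_image)
qed

lemma IM_borel [measurable]: "IM \<in> sets borel"
  unfolding IM_eq by measurable

lemma LR_gap:
  assumes "z \<in> LR"
  shows "2 * gap \<le> \<bar>Re z\<bar>"
proof -
  obtain t where "z = \<gamma> t \<or> z = - \<gamma> t"
    using assms by (auto simp: LR_eq)
  then show ?thesis using gap_le[of t] gap_pos by auto
qed

lemma LR_IM_disjoint: "z \<in> LR \<Longrightarrow> z \<notin> IM"
  using LR_gap[of z] gap_pos by (auto simp: IM_eq)

lemma full_contour_eq:
  "full_contour \<gamma> = [] @ (\<lambda>t. - \<gamma> t) # [\<gamma>, imaginary_axis]"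
  "full_contour \<gamma> = [\<lambda>t. - \<gamma> t] @ \<gamma> # [imaginary_axis]"
  "full_contour \<gamma> = [\<lambda>t. - \<gamma> t, \<gamma>] @ imaginary_axis # []"
  by (simp_all add: full_contour_def left_right_def)

lemma full_contour_measurable:
  "d \<in> set (full_contour \<gamma>) \<Longrightarrow> d \<in> borel_measurable borel"
  "d \<in> set (full_contour \<gamma>) \<Longrightarrow> (\<lambda>t. vector_derivative d (at t)) \<in> borel_measurable borel"
  by (auto simp: full_contour_eq(1) derivative_left derivative_imaginary)

text \<open>The open half-planes and the axis are the separating regions for the three
  curves.\<close>

lemma contour_integral_pieces:
  fixes f :: "complex \<Rightarrow> 'b :: {banach, second_countable_topology}"
  assumes f: "f \<in> borel_measurable borel"
  shows "integrable M (\<lambda>z. indicator {z. Re z < 0} z *\<^sub>R f z) \<longleftrightarrow>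
      integrable lborel (\<lambda>t. norm (d\<gamma> t) *\<^sub>R f (- \<gamma> t))" (is ?i1)
    and "(\<integral>z. indicator {z. Re z < 0} z *\<^sub>R f z \<partial>M) = (\<integral>t. norm (d\<gamma> t) *\<^sub>R f (- \<gamma> t) \<partial>lborel)" (is ?e1)
    and "integrable M (\<lambda>z. indicator {z. 0 < Re z} z *\<^sub>R f z) \<longleftrightarrow>
      integrable lborel (\<lambda>t. norm (d\<gamma> t) *\<^sub>R f (\<gamma> t))" (is ?i2)
    and "(\<integral>z. indicator {z. 0 < Re z} z *\<^sub>R f z \<partial>M) = (\<integral>t. norm (d\<gamma> t) *\<^sub>R f (\<gamma> t) \<partial>lborel)" (is ?e2)
    and "integrable M (\<lambda>z. indicator IM z *\<^sub>R f z) \<longleftrightarrow> integrable lborel (\<lambda>t. f (imaginary_axis t))" (is ?i3)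
    and "(\<integral>z. indicator IM z *\<^sub>R f z \<partial>M) = (\<integral>t. f (imaginary_axis t) \<partial>lborel)" (is ?e3)
proof -
  have pos: "0 < Re (\<gamma> t)" "\<not> Re (\<gamma> t) < 0" "Re (\<gamma> t) \<noteq> 0" for t
    using Re_pos[of t] by auto
  have sets: "{z. Re z < 0} \<in> sets borel" "{z. 0 < Re z} \<in> sets borel"
    by measurable
  have mem: "- \<gamma> t \<in> {z. Re z < 0}" "\<gamma> t \<in> {z. 0 < Re z}" "imaginary_axis t \<in> IM" for t
    by (simp_all add: pos)
  have 1: "d t \<notin> {z. Re z < 0}" if "d \<in> set [] \<union> set [\<gamma>, imaginary_axis]" for d t
    using that pos by auto
  have 2: "d t \<notin> {z. 0 < Re z}" if "d \<in> set [\<lambda>t. - \<gamma> t] \<union> set [imaginary_axis]" for d t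
    using that pos(1)[of t] by auto
  have 3: "d t \<notin> IM" if "d \<in> set [\<lambda>t. - \<gamma> t, \<gamma>] \<union> set []" for d t
    using that pos by (auto simp: IM_eq)
  have "integrable M (\<lambda>z. indicator {z. Re z < 0} z *\<^sub>R f z) \<longleftrightarrow>
      integrable lborel (\<lambda>t. norm (vector_derivative (\<lambda>t. - \<gamma> t) (at t)) *\<^sub>R f ((\<lambda>t. - \<gamma> t) t))"
    by (rule arc_length_region_integral(1)[OF full_contour_eq(1)])
      (erule full_contour_measurable 1 | rule sets mem IM_borel f)+
  moreover have "(\<integral>z. indicator {z. Re z < 0} z *\<^sub>R f z \<partial>M) =
      (\<integral>t. norm (vector_derivative (\<lambda>t. - \<gamma> t) (at t)) *\<^sub>R f ((\<lambda>t. - \<gamma> t) t) \<partial>lborel)"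
    by (rule arc_length_region_integral(2)[OF full_contour_eq(1)])
      (erule full_contour_measurable 1 | rule sets mem IM_borel f)+
  ultimately show ?i1 ?e1
    by (simp_all add: derivative_left derivative_imaginary)
  have "integrable M (\<lambda>z. indicator {z. 0 < Re z} z *\<^sub>R f z) \<longleftrightarrow>
      integrable lborel (\<lambda>t. norm (vector_derivative (\<gamma>) (at t)) *\<^sub>R f ((\<gamma>) t))"
    by (rule arc_length_region_integral(1)[OF full_contour_eq(2)])
      (erule full_contour_measurable 2 | rule sets mem IM_borel f)+
  moreover have "(\<integral>z. indicator {z. 0 < Re z} z *\<^sub>R f z \<partial>M) =
      (\<integral>t. norm (vector_derivative (\<gamma>) (at t)) *\<^sub>R f ((\<gamma>) t) \<partial>lborel)"
    by (rule arc_length_region_integral(2)[OF full_contour_eq(2)])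
      (erule full_contour_measurable 2 | rule sets mem IM_borel f)+
  ultimately show ?i2 ?e2
    by (simp_all add: derivative_left derivative_imaginary)
  have "integrable M (\<lambda>z. indicator IM z *\<^sub>R f z) \<longleftrightarrow>
      integrable lborel (\<lambda>t. norm (vector_derivative (imaginary_axis) (at t)) *\<^sub>R f ((imaginary_axis) t))"
    by (rule arc_length_region_integral(1)[OF full_contour_eq(3)])
      (erule full_contour_measurable 3 | rule sets mem IM_borel f)+
  moreover have "(\<integral>z. indicator IM z *\<^sub>R f z \<partial>M) =
      (\<integral>t. norm (vector_derivative (imaginary_axis) (at t)) *\<^sub>R f ((imaginary_axis) t) \<partial>lborel)"
    by (rule arc_length_region_integral(2)[OF full_contour_eq(3)])
      (erule full_contour_measurable 3 | rule sets mem IM_borel f)+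
  ultimately show ?i3 ?e3
    by (simp_all add: derivative_left derivative_imaginary)
qed

lemma line_integral_LR:
  assumes int: "integrable M (\<lambda>z. indicator LR z * tangent z * F z)"
  shows "line_integral (left_right \<gamma>) F = (\<integral>z. indicator LR z * tangent z * F z \<partial>M)"
proof -
  let ?H = "\<lambda>z. indicator LR z * tangent z * F z"
  have H: "?H \<in> borel_measurable borel"
    using borel_measurable_integrable[OF int] by (simp cong: measurable_cong_sets)
  have sets: "{z. Re z < 0} \<in> sets M" "{z. 0 < Re z} \<in> sets M"
    by simp_all
  have split: "?H z = indicator {z. Re z < 0} z *\<^sub>R ?H z + indicator {z. 0 < Re z} z *\<^sub>R ?H z" for z
    using LR_gap[of z] gap_pos by (auto simp: indicator_def)
  have "(\<integral>z. ?H z \<partial>M) = (\<integral>z. indicator {z. Re z < 0} z *\<^sub>R ?H z + indicator {z. 0 < Re z} z *\<^sub>R ?H z \<partial>M)"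
    by (rule Bochner_Integration.integral_cong[OF refl split])
  also have "\<dots> = (\<integral>z. indicator {z. Re z < 0} z *\<^sub>R ?H z \<partial>M) + (\<integral>z. indicator {z. 0 < Re z} z *\<^sub>R ?H z \<partial>M)"
    by (intro Bochner_Integration.integral_add integrable_mult_indicator sets int)
  also have "(\<integral>z. indicator {z. Re z < 0} z *\<^sub>R ?H z \<partial>M) = (\<integral>t. F (- \<gamma> t) * (- d\<gamma> t) \<partial>lborel)"
  proof (unfold contour_integral_pieces(2)[OF H], rule Bochner_Integration.integral_cong[OF refl])
    fix t
    have "- \<gamma> t \<in> LR" by (auto simp: LR_eq)
    then show "norm (d\<gamma> t) *\<^sub>R ?H (- \<gamma> t) = F (- \<gamma> t) * - d\<gamma> t"
      by (simp flip: tangent_curves(2) add: mult_ac)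
  qed
  also have "(\<integral>z. indicator {z. 0 < Re z} z *\<^sub>R ?H z \<partial>M) = (\<integral>t. F (\<gamma> t) * d\<gamma> t \<partial>lborel)"
  proof (unfold contour_integral_pieces(4)[OF H], rule Bochner_Integration.integral_cong[OF refl])
    fix t
    have "\<gamma> t \<in> LR" by (auto simp: LR_eq)
    then have "norm (d\<gamma> t) *\<^sub>R ?H (\<gamma> t) = F (\<gamma> t) * (norm (d\<gamma> t) *\<^sub>R tangent (\<gamma> t))"
      by (simp add: mult_ac)
    then show "norm (d\<gamma> t) *\<^sub>R ?H (\<gamma> t) = F (\<gamma> t) * d\<gamma> t"
      by (simp only: tangent_curves)
  qed
  finally show ?thesis
    by (simp add: line_integral_def left_right_def derivative_left)
qed

lemma line_integral_IM:
  assumes int: "integrable M (\<lambda>z. indicator IM z * tangent z * F z)"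
  shows "line_integral [imaginary_axis] F = (\<integral>z. indicator IM z * tangent z * F z \<partial>M)"
proof -
  let ?H = "\<lambda>z. indicator IM z * tangent z * F z"
  have H: "?H \<in> borel_measurable borel"
    using borel_measurable_integrable[OF int] by (simp cong: measurable_cong_sets)
  have "(\<integral>z. ?H z \<partial>M) = (\<integral>z. indicator IM z *\<^sub>R ?H z \<partial>M)"
    by (intro Bochner_Integration.integral_cong refl) (simp add: indicator_def)
  also have "\<dots> = (\<integral>t. F (imaginary_axis t) * \<i> \<partial>lborel)"
    unfolding contour_integral_pieces(6)[OF H]
    by (simp add: tangent_curves mult.commute)
  finally show ?thesis
    by (simp add: line_integral_def derivative_imaginary)
qed

text \<open>Theta is halved because the square of the weight is integrated. The term R |z| is there
  to absorb exp (- x z) for |x| <= R.\<close>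

definition weight_LR :: "real \<Rightarrow> real \<Rightarrow> complex \<Rightarrow> complex" where
  "weight_LR \<tau> R z = indicator LR z * of_real (exp (Re (Theta \<tau> 0 z) / 2 + R * norm z))"

definition weight_IM :: "real \<Rightarrow> complex \<Rightarrow> complex" where
  "weight_IM \<tau> z = indicator IM z * of_real (exp (- Re (Theta \<tau> 0 z) / 2))"

lemma Theta_measurable [measurable]: "Theta \<tau> x \<in> borel_measurable borel"
  unfolding Theta_def[abs_def] by measurable

lemma weight_LR_l2:
  assumes R: "R \<ge> 0"
  shows "weight_LR \<tau> R \<in> l2_space M"
proof
  let ?f = "\<lambda>z. (norm (weight_LR \<tau> R z))\<^sup>2"
  show "weight_LR \<tau> R \<in> borel_measurable M"
    unfolding weight_LR_def[abs_def] by measurable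
  have [measurable]: "?f \<in> borel_measurable borel"
    unfolding weight_LR_def[abs_def] by measurable
  have int: "integrable lborel (\<lambda>t. norm (d\<gamma> t) * exp (1 * Re (Theta \<tau> 0 (\<gamma> t)) + 2 * R * norm (\<gamma> t)))"
  proof (rule curve_integrable_Theta[OF has_derivative continuous_derivative])
    show "((\<lambda>t. sgn (\<gamma> t)) \<longlongrightarrow> cis (- pi / 4)) at_top" "((\<lambda>t. sgn (\<gamma> t)) \<longlongrightarrow> cis (pi / 4)) at_bot"
      "((\<lambda>t. sgn (d\<gamma> t)) \<longlongrightarrow> cis (- pi / 4)) at_top" "((\<lambda>t. sgn (d\<gamma> t)) \<longlongrightarrow> - cis (pi / 4)) at_bot"
      "filterlim (\<lambda>t. norm (\<gamma> t)) at_top at_bot" "filterlim (\<lambda>t. norm (\<gamma> t)) at_top at_top"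
      using right_contour by (auto simp: right_contour_def)
    show "of_real 1 * cis (- pi / 4) ^ 4 = -1" "of_real 1 * cis (pi / 4) ^ 4 = -1"
      by (simp_all add: Complex.DeMoivre complex_eq_iff)
  qed (use R in auto)
  have f1: "?f (\<gamma> t) = exp (1 * Re (Theta \<tau> 0 (\<gamma> t)) + 2 * R * norm (\<gamma> t))" for t
  proof -
    have "\<gamma> t \<in> LR" by (auto simp: LR_eq)
    then show ?thesis
      by (simp add: weight_LR_def norm_mult exp_double[symmetric] distrib_left)
  qed
  \<comment> \<open>For x = 0 Theta is even, so the left curve repeats the integral over the right
    one.\<close>
  have f2: "?f (- \<gamma> t) = ?f (\<gamma> t)" for t
  proof -
    have "\<gamma> t \<in> LR" "- \<gamma> t \<in> LR" by (auto simp: LR_eq)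
    then show ?thesis by (simp add: weight_LR_def Theta_def)
  qed
  have "integrable M (\<lambda>z. indicator {z. Re z < 0} z *\<^sub>R ?f z)"
    by (subst contour_integral_pieces(1)) (use int in \<open>simp_all add: f2 f1\<close>)
  moreover have "integrable M (\<lambda>z. indicator {z. 0 < Re z} z *\<^sub>R ?f z)"
    by (subst contour_integral_pieces(3)) (use int in \<open>simp_all add: f1\<close>)
  ultimately have "integrable M (\<lambda>z. indicator {z. Re z < 0} z *\<^sub>R ?f z + indicator {z. 0 < Re z} z *\<^sub>R ?f z)"
    by (rule Bochner_Integration.integrable_add)
  also have "(\<lambda>z. indicator {z. Re z < 0} z *\<^sub>R ?f z + indicator {z. 0 < Re z} z *\<^sub>R ?f z) = ?f"
    using LR_gap gap_pos by (fastforce simp: indicator_def weight_LR_def)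
  finally show "integrable M ?f" .
qed

lemma weight_IM_l2: "weight_IM \<tau> \<in> l2_space M"
proof
  let ?f = "\<lambda>z. (norm (weight_IM \<tau> z))\<^sup>2"
  show "weight_IM \<tau> \<in> borel_measurable M"
    unfolding weight_IM_def[abs_def] by measurable
  have [measurable]: "?f \<in> borel_measurable borel"
    unfolding weight_IM_def[abs_def] by measurable
  have norm_axis: "norm (imaginary_axis t) = \<bar>t\<bar>" for t
    by (simp add: imaginary_axis_def norm_mult)
  have sgn_axis: "sgn (imaginary_axis t) = (if t > 0 then \<i> else if t < 0 then - \<i> else 0)" for t
    by (simp add: imaginary_axis_def sgn_mult sgn_of_real sgn_eq[of \<i>])
  have "integrable lborel (\<lambda>t. norm \<i> * exp (-1 * Re (Theta \<tau> 0 (imaginary_axis t)) + 0 * norm (imaginary_axis t)))"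
  proof (rule curve_integrable_Theta[OF imaginary_axis_has_derivative])
    show "filterlim (\<lambda>t. norm (imaginary_axis t)) at_top at_top" "filterlim (\<lambda>t. norm (imaginary_axis t)) at_top at_bot"
    proof -
      have "\<forall>\<^sub>F t in at_top. Z \<le> \<bar>t\<bar>" for Z :: real
        using eventually_ge_at_top[of Z] by eventually_elim linarith
      moreover have "\<forall>\<^sub>F t in at_bot. Z \<le> \<bar>t\<bar>" for Z :: real
        using eventually_le_at_bot[of "- Z"] by eventually_elim linarith
      ultimately show "filterlim (\<lambda>t. norm (imaginary_axis t)) at_top at_top"
        "filterlim (\<lambda>t. norm (imaginary_axis t)) at_top at_bot"
        unfolding norm_axis filterlim_at_top by simp_all
    qed
    show "((\<lambda>t. sgn (imaginary_axis t)) \<longlongrightarrow> \<i>) at_top"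
      by (rule tendsto_eventually, rule eventually_mono[OF eventually_gt_at_top[of 0]]) (simp add: sgn_axis)
    show "((\<lambda>t. sgn (imaginary_axis t)) \<longlongrightarrow> - \<i>) at_bot"
      by (rule tendsto_eventually, rule eventually_mono[OF eventually_gt_at_bot[of 0]]) (simp add: sgn_axis)
    show "of_real (- 1) * \<i> ^ 4 = (-1 :: complex)" "of_real (- 1) * (- \<i>) ^ 4 = (-1 :: complex)"
      by (simp_all add: power4_eq_xxxx)
  qed (auto simp: sgn_div_norm)
  moreover have "?f (imaginary_axis t) = exp (- Re (Theta \<tau> 0 (imaginary_axis t)))" for t
    by (simp add: weight_IM_def norm_mult exp_double[symmetric])
  ultimately have "integrable M (\<lambda>z. indicator IM z *\<^sub>R ?f z)"
    by (subst contour_integral_pieces(5)) simp_all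
  also have "(\<lambda>z. indicator IM z *\<^sub>R ?f z) = ?f"
    by (auto simp: indicator_def weight_IM_def)
  finally show "integrable M ?f" .
qed

text \<open>The squared weights are integrable and their sum is positive exactly on the contour,
  which carries all of the measure.\<close>

lemma sigma_finite_M: "sigma_finite_measure M"
proof (rule sigma_finite_of_integrable)
  show "integrable M (\<lambda>z. (norm (weight_LR 0 0 z))\<^sup>2 + (norm (weight_IM 0 z))\<^sup>2)"
    by (intro Bochner_Integration.integrable_add l2_integrable weight_LR_l2 weight_IM_l2) simp
  let ?Z = "{z \<in> space M. (norm (weight_LR 0 0 z))\<^sup>2 + (norm (weight_IM 0 z))\<^sup>2 = 0}"
  have Z: "?Z = - (LR \<union> IM)"
    by (auto simp: weight_LR_def weight_IM_def sum_power2_eq_zero_iff indicator_def split: if_splits)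
  have notin: "d t \<notin> - (LR \<union> IM)" if "d \<in> set (full_contour \<gamma>)" for d t
    using that by (auto simp: full_contour_eq(1) LR_eq)
  have meas: "- (LR \<union> IM) \<in> sets borel" by measurable
  have "emeasure (curve_measure d) (- (LR \<union> IM)) = 0" if d: "d \<in> set (full_contour \<gamma>)" for d
  proof -
    have "indicator (- (LR \<union> IM)) (d t) = (0 :: ennreal)" for t
      using notin[OF d, of t] by (simp add: indicator_def)
    then show ?thesis
      unfolding emeasure_curve_measure[OF full_contour_measurable[OF d] meas] by simp
  qed
  then have "emeasure M (- (LR \<union> IM)) = 0"
    unfolding emeasure_arc_length[OF meas] by (simp add: full_contour_eq(1))
  then show "emeasure M ?Z < \<infinity>" by (simp only: Z) simp
qed simp

lemma exists_basis_M: "\<exists>e. orthonormal_basis M e"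
proof -
  \<comment> \<open>Disjoint unit segments of the imaginary axis; they witness infinite
    dimension.\<close>
  define A where "A n = {z. Re z = 0 \<and> real n \<le> Im z \<and> Im z < real n + 1}" for n
  have A: "A n \<in> sets borel" for n unfolding A_def by measurable
  have em: "emeasure M (A n) = 1" for n
  proof -
    have "emeasure (curve_measure (\<lambda>t. - \<gamma> t)) (A n) = 0" "emeasure (curve_measure \<gamma>) (A n) = 0"
      using Re_pos by (subst emeasure_curve_measure;
        simp add: A A_def derivative_left indicator_def order_less_imp_not_eq2)+
    moreover have "emeasure (curve_measure imaginary_axis) (A n) = 1"
    proof -
      have "emeasure (curve_measure imaginary_axis) (A n) =
          (\<integral>\<^sup>+t. ennreal (norm (vector_derivative imaginary_axis (at t))) * indicator (A n) (imaginary_axis t) \<partial>lborel)"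
        by (rule emeasure_curve_measure) (simp_all add: A derivative_imaginary)
      also have "\<dots> = (\<integral>\<^sup>+t. indicator {real n..<real n + 1} t \<partial>lborel)"
        by (intro nn_integral_cong) (auto simp: derivative_imaginary A_def imaginary_axis_def indicator_def)
      also have "\<dots> = emeasure lborel {real n..<real n + 1}"
        by (rule nn_integral_indicator) simp
      also have "\<dots> = 1" by simp
      finally show ?thesis .
    qed
    ultimately show ?thesis
      unfolding emeasure_arc_length[OF A] by (simp add: full_contour_eq(1))
  qed
  have "disjoint_family A"
    unfolding disjoint_family_on_def A_def by (auto; linarith)
  then have "\<exists>d. orthonormal_seq M d"
    using A em by (intro orthonormal_seq_disjoint_sets[of A]) auto
  then show ?thesis
    using exists_orthonormal_basis_borel[OF sigma_finite_M] by auto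
qed

end

section \<open>Factorization of the kernels\<close>

lemma interval_union_Suc:
  "interval_union (Suc N) a = interval_union N a \<union> {a (2 * N + 1)..a (2 * N + 2)}"
proof -
  have "{1..Suc N} = insert (Suc N) {1..N}" by auto
  then show ?thesis by (auto simp: interval_union_def)
qed

lemma interval_union_borel: "interval_union N a \<in> sets borel"
  by (auto simp: interval_union_def)

lemma interval_union_subset:
  assumes "strict_mono_on {1..2 * N} a" "x \<in> interval_union N a"
  shows "a 1 \<le> x" "x \<le> a (2 * N)"
proof -
  obtain k where k: "k \<in> {1..N}" "a (2 * k - 1) \<le> x" "x \<le> a (2 * k)"
    using assms(2) by (auto simp: interval_union_def)
  have mono: "a i \<le> a j" if "1 \<le> i" "i \<le> j" "j \<le> 2 * N" for i j
    using strict_mono_on_leD[OF assms(1), of i j] that by auto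
  show "a 1 \<le> x" using mono[of 1 "2 * k - 1"] k by (simp; linarith)
  show "x \<le> a (2 * N)" using mono[of "2 * k" "2 * N"] k by (simp; linarith)
qed

text \<open>The endpoint exponentials of \<open>f_vec\<close> and \<open>g_vec\<close> arise from this integral.\<close>

lemma integral_exp_interval_union:
  fixes w :: complex
  assumes w: "w \<noteq> 0"
  shows "strict_mono_on {1..2 * N} a \<Longrightarrow>
    set_integrable lborel (interval_union N a) (\<lambda>x. exp (of_real x * w)) \<and>
    - (LINT x:interval_union N a|lborel. exp (of_real x * w)) =
      (\<Sum>j\<in>{1..2 * N}. (-1) ^ (j + 1) * exp (of_real (a j) * w)) / w"
proof (induction N)
  case 0
  then show ?case
    by (simp add: interval_union_def set_lebesgue_integral_def set_integrable_def)
next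
  case (Suc N)
  let ?f = "\<lambda>x :: real. exp (of_real x * w)"
  let ?u = "a (2 * N + 1)" and ?v = "a (2 * N + 2)"
  have mono: "strict_mono_on {1..2 * N} a"
    using Suc.prems by (rule monotone_on_subset) auto
  note IH = Suc.IH[OF mono]
  have uv: "?u \<le> ?v"
    using strict_mono_onD[OF Suc.prems, of "2 * N + 1" "2 * N + 2"] by simp
  have cont: "continuous_on {?u..?v} ?f" by (intro continuous_intros)
  have int: "set_integrable lborel {?u..?v} ?f"
    using cont by (rule borel_integrable_atLeastAtMost')
  have "(\<integral>x. indicator {?u..?v} x *\<^sub>R ?f x \<partial>lborel) = ?f ?v / w - ?f ?u / w"
  proof (rule integral_FTC_atLeastAtMost[OF uv _ cont])
    have "((\<lambda>z. exp (z * w) / w) has_field_derivative exp (z * w)) (at z)" for z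
      using w by (auto intro!: derivative_eq_intros)
    from has_vector_derivative_real_field[OF this]
    show "((\<lambda>x. ?f x / w) has_vector_derivative ?f x) (at x within {?u..?v})" for x
      by (rule has_vector_derivative_at_within)
  qed
  then have val: "(LINT x:{?u..?v}|lborel. ?f x) = (?f ?v - ?f ?u) / w"
    by (simp add: set_lebesgue_integral_def diff_divide_distrib)
  have disj: "interval_union N a \<inter> {?u..?v} = {}"
  proof (cases "N = 0")
    case False
    then have "a (2 * N) < ?u"
      using strict_mono_onD[OF Suc.prems, of "2 * N" "2 * N + 1"] by simp
    then show ?thesis using interval_union_subset(2)[OF mono] by force
  qed (simp add: interval_union_def)
  have "(LINT x:interval_union (Suc N) a|lborel. ?f x) =
      (LINT x:interval_union N a|lborel. ?f x) + (?f ?v - ?f ?u) / w"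
    unfolding interval_union_Suc val[symmetric] using IH int disj by (intro set_integral_Un) auto
  then have "- (LINT x:interval_union (Suc N) a|lborel. ?f x) =
      - (LINT x:interval_union N a|lborel. ?f x) + (?f ?u - ?f ?v) / w"
    by (simp add: diff_divide_distrib)
  also have "- (LINT x:interval_union N a|lborel. ?f x) =
      (\<Sum>j\<in>{1..2 * N}. (-1) ^ (j + 1) * ?f (a j)) / w"
    using IH by blast
  also have "(\<Sum>j\<in>{1..2 * N}. (-1) ^ (j + 1) * ?f (a j)) / w + (?f ?u - ?f ?v) / w =
      (\<Sum>j\<in>{1..2 * Suc N}. (-1) ^ (j + 1) * ?f (a j)) / w"
  proof -
    have "{1..2 * Suc N} = {1..2 * N} \<union> {2 * N + 1, 2 * N + 2}" by auto
    then have "(\<Sum>j\<in>{1..2 * Suc N}. (-1) ^ (j + 1) * ?f (a j)) =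
        (\<Sum>j\<in>{1..2 * N}. (-1) ^ (j + 1) * ?f (a j)) + (?f ?u - ?f ?v)"
      by (simp add: sum.union_disjoint)
    then show ?thesis by (simp only: add_divide_distrib)
  qed
  finally show ?case
    unfolding interval_union_Suc using IH int
    by (intro conjI set_integrable_Un) (auto simp: interval_union_borel)
qed

lemma kernel_comp_assoc:
  assumes B: "sigma_finite_measure B" and C: "sigma_finite_measure C"
    and k: "dominated_kernel A B k" and l: "dominated_kernel B C l" and m: "dominated_kernel C D m"
    and x: "x \<in> space A" and y: "y \<in> space D"
  shows "kernel_comp C (kernel_comp B k l) m x y = kernel_comp B k (kernel_comp C l m) x y"
proof -
  have "(\<lambda>z. m z y) \<in> l2_space C"
    using l2_cnj[OF kernel_section_l2[OF dominated_kernel_adjoint[OF m] y]] by simp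
  then show ?thesis
    unfolding kernel_comp_def
    by (rule kernel_fubini[OF B C l kernel_section_l2[OF k x], symmetric])
qed

lemma exp_abs_l2:
  assumes "c > 0"
  shows "(\<lambda>s. complex_of_real (exp (- c * \<bar>s\<bar>))) \<in> l2_space lborel"
proof
  have pos: "set_integrable lborel {0<..} (\<lambda>s. exp (- 2 * c * s) :: real)"
  proof -
    have "set_integrable lborel {0<..} (\<lambda>s. exp (- of_real s * (2 * of_real c)) :: complex)"
      using assms by (intro exp_half_line_integral) auto
    then have "integrable lborel (\<lambda>s. norm (indicator {0<..} s *\<^sub>R (exp (- of_real s * (2 * of_real c)) :: complex)))"
      unfolding set_integrable_def by (rule Bochner_Integration.integrable_norm)
    then show ?thesis
      unfolding set_integrable_def by (simp add: norm_exp_eq_Re mult_ac)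
  qed
  have "integrable lborel (\<lambda>s. indicator {0<..} (0 + (-1) * s) *\<^sub>R exp (- 2 * c * (0 + (-1) * s)) :: real)"
    by (subst lborel_integrable_real_affine_iff) (use pos in \<open>auto simp: set_integrable_def\<close>)
  \<comment> \<open>The point 0 belongs to neither half line; its indicator makes the next equation
    hold everywhere.\<close>
  then have "integrable lborel (\<lambda>s. indicator {0<..} s *\<^sub>R exp (- 2 * c * s) +
      indicator {0<..} (0 + (-1) * s) *\<^sub>R exp (- 2 * c * (0 + (-1) * s)) + indicator {0 :: real} s :: real)"
    using pos unfolding set_integrable_def
    by (intro Bochner_Integration.integrable_add) auto
  also have "(\<lambda>s. indicator {0<..} s *\<^sub>R exp (- 2 * c * s) +
      indicator {0<..} (0 + (-1) * s) *\<^sub>R exp (- 2 * c * (0 + (-1) * s)) + indicator {0 :: real} s :: real) =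
      (\<lambda>s. (norm (complex_of_real (exp (- c * \<bar>s\<bar>))))\<^sup>2)"
    by (auto simp: fun_eq_iff indicator_def exp_double[symmetric])
  finally show "integrable lborel (\<lambda>s. (norm (complex_of_real (exp (- c * \<bar>s\<bar>))))\<^sup>2)" .
qed auto

lemma exists_basis_lborel: "\<exists>u. orthonormal_basis (lborel :: real measure) u"
proof -
  have "disjoint_family (\<lambda>n :: nat. {real n..<real n + 1})"
    unfolding disjoint_family_on_def by (auto; linarith)
  then have "\<exists>d. orthonormal_seq (lborel :: real measure) d"
    by (intro orthonormal_seq_disjoint_sets[of "\<lambda>n. {real n..<real n + 1}"]) auto
  then show ?thesis
    using exists_orthonormal_basis_borel[of "lborel :: real measure"]
    by (auto simp: lborel.sigma_finite_measure_axioms)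
qed

lemma exists_basis_interval_union:
  assumes N: "N \<ge> 1" and mono: "strict_mono_on {1..2 * N} a"
  shows "\<exists>v. orthonormal_basis (restrict_space lborel (interval_union N a)) v"
proof -
  let ?I = "interval_union N a"
  have lt: "a 1 < a 2" using strict_mono_onD[OF mono, of 1 2] N by simp
  \<comment> \<open>Points decreasing from a 2 towards a 1; they cut infinitely many disjoint pieces
    out of the first interval.\<close>
  define q where "q n = a 1 + (a 2 - a 1) / (real n + 1)" for n
  have q_less: "q n < q m" if "m < n" for m n
    unfolding q_def using that lt by (intro add_strict_left_mono divide_strict_left_mono) auto
  have q_in: "a 1 < q n" "q n \<le> a 2" for n
  proof -
    show "a 1 < q n" using lt by (simp add: q_def)
    have "(a 2 - a 1) / (real n + 1) \<le> (a 2 - a 1) / 1"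
      using lt by (intro divide_left_mono) auto
    then show "q n \<le> a 2" by (simp add: q_def)
  qed
  define A where "A n = {q (Suc n)..<q n}" for n
  have sub: "A n \<subseteq> ?I" for n
  proof
    fix x assume "x \<in> A n"
    then have "x \<in> {a (2 * 1 - 1)..a (2 * 1)}"
      using q_in[of n] q_in[of "Suc n"] by (auto simp: A_def)
    then show "x \<in> ?I" using N unfolding interval_union_def by (intro UN_I[of 1]) auto
  qed
  have A: "A n \<in> sets (restrict_space lborel ?I)" for n
    unfolding sets_restrict_space using sub[of n] by (intro image_eqI[of _ _ "A n"]) (auto simp: A_def)
  have em: "emeasure (restrict_space lborel ?I) (A n) = emeasure lborel (A n)" for n
    using sub by (intro emeasure_restrict_space) (auto simp: interval_union_borel)
  have dis: "disjoint_family A"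
    unfolding disjoint_family_on_def
  proof (intro ballI impI)
    fix m n :: nat assume "m \<noteq> n"
    then consider "Suc m \<le> n" | "Suc n \<le> m" by linarith
    then show "A m \<inter> A n = {}"
    proof cases
      case 1
      then have "q n \<le> q (Suc m)" using q_less[of "Suc m" n] by (cases "n = Suc m") auto
      then show ?thesis by (auto simp: A_def)
    next
      case 2
      then have "q m \<le> q (Suc n)" using q_less[of "Suc n" m] by (cases "m = Suc n") auto
      then show ?thesis by (auto simp: A_def)
    qed
  qed
  have len: "emeasure lborel (A n) = ennreal (q n - q (Suc n))" for n
    unfolding A_def using q_less[of n "Suc n"] by simp
  have "\<exists>d. orthonormal_seq (restrict_space lborel ?I) d"
    by (rule orthonormal_seq_disjoint_sets[OF A dis])
      (use q_less in \<open>auto simp: em len ennreal_eq_0_iff not_le\<close>)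
  then show ?thesis
    using exists_orthonormal_basis_restrict[of "lborel :: real measure" ?I]
    by (auto simp: lborel.sigma_finite_measure_axioms interval_union_borel)
qed

section \<open>The four factors and the kernels they compose to\<close>

context pearcey_contour
begin

abbreviation "two_pi_i \<equiv> 2 * complex_of_real pi * \<i>"

text \<open>The factorization splits \<open>1 / (z - \<mu>)\<close>, for \<open>z\<close> on the curves and \<open>\<mu>\<close> on the
  imaginary axis, into an integral of \<open>exp (- s * z) * exp (s * \<mu>)\<close> over \<open>s\<close>; the terms
  \<open>gap * \<bar>s\<bar>\<close> move part of the decay in \<open>s\<close> from the first factor to the second, so that both
  become square integrable.\<close>

definition curve_to_line :: "real \<Rightarrow> complex \<Rightarrow> real \<Rightarrow> complex" where
  "curve_to_line \<tau> z s = indicator LR z * of_real (if 0 < s * Re z then sgn s else 0) *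
    exp (Theta \<tau> 0 z / 2 - of_real s * z + of_real (gap * \<bar>s\<bar>)) / two_pi_i"

definition line_to_axis :: "real \<Rightarrow> real \<Rightarrow> complex \<Rightarrow> complex" where
  "line_to_axis \<tau> s z = indicator IM z * tangent z *
    exp (- Theta \<tau> 0 z / 2 - of_real (gap * \<bar>s\<bar>) + of_real s * z)"

text \<open>The minus sign serves twice: it turns upper minus lower endpoint into the alternating
  signs of \<open>g_vec\<close>, which start with + at a 1, and it accounts for 1 / (l - \<mu>) in
  the Pearcey kernel against 1 / (\<mu> - l) from \<open>curve_to_axis\<close>.\<close>

definition axis_to_interval :: "real \<Rightarrow> complex \<Rightarrow> real \<Rightarrow> complex" where
  "axis_to_interval \<tau> z x = - (indicator IM z * exp (- Theta \<tau> 0 z / 2 + of_real x * z)) / two_pi_i"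

definition interval_to_curve :: "real \<Rightarrow> real \<Rightarrow> complex \<Rightarrow> complex" where
  "interval_to_curve \<tau> x z = indicator LR z * tangent z * exp (Theta \<tau> 0 z / 2 - of_real x * z)"

lemma curve_to_line_dominated: "dominated_kernel M lborel (curve_to_line \<tau>)"
proof (rule dominated_kernelI)
  show "case_prod (curve_to_line \<tau>) \<in> borel_measurable (M \<Otimes>\<^sub>M lborel)"
    unfolding curve_to_line_def case_prod_beta by measurable
  show "(\<lambda>z. (1 / two_pi_i) * weight_LR \<tau> 0 z) \<in> l2_space M"
    by (intro l2_scale weight_LR_l2) simp
  show "(\<lambda>s. complex_of_real (exp (- gap * \<bar>s\<bar>))) \<in> l2_space lborel"
    by (rule exp_abs_l2[OF gap_pos])
  fix z s
  show "norm (curve_to_line \<tau> z s) \<le>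
      norm ((1 / two_pi_i) * weight_LR \<tau> 0 z) * norm (complex_of_real (exp (- gap * \<bar>s\<bar>)))"
  proof (cases "z \<in> LR \<and> 0 < s * Re z")
    case True
    then have "s * Re z = \<bar>s\<bar> * \<bar>Re z\<bar>" by (simp flip: abs_mult)
    moreover have "\<bar>s\<bar> * (2 * gap) \<le> \<bar>s\<bar> * \<bar>Re z\<bar>"
      using True by (intro mult_left_mono LR_gap) auto
    ultimately have le: "- (s * Re z) + gap * \<bar>s\<bar> \<le> - gap * \<bar>s\<bar>" by (simp add: mult_ac)
    have "s \<noteq> 0" using True by auto
    then have "norm (curve_to_line \<tau> z s) = exp (Re (Theta \<tau> 0 z) / 2 + (- (s * Re z) + gap * \<bar>s\<bar>)) / (2 * pi)"
      using True by (simp add: curve_to_line_def norm_mult norm_divide norm_exp_eq_Re abs_sgn_eq)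
    also have "\<dots> \<le> exp (Re (Theta \<tau> 0 z) / 2 + - gap * \<bar>s\<bar>) / (2 * pi)"
      using le by (intro divide_right_mono) auto
    also have "\<dots> = norm ((1 / two_pi_i) * weight_LR \<tau> 0 z) * norm (complex_of_real (exp (- gap * \<bar>s\<bar>)))"
      using True by (simp add: weight_LR_def norm_mult norm_divide flip: exp_add)
    finally show ?thesis .
  next
    case False
    then have "curve_to_line \<tau> z s = 0" by (auto simp: curve_to_line_def)
    then show ?thesis by simp
  qed
qed

lemma line_to_axis_dominated: "dominated_kernel lborel M (line_to_axis \<tau>)"
proof (rule dominated_kernelI)
  show "case_prod (line_to_axis \<tau>) \<in> borel_measurable (lborel \<Otimes>\<^sub>M M)"
    unfolding line_to_axis_def case_prod_beta by measurable
  show "(\<lambda>s. complex_of_real (exp (- gap * \<bar>s\<bar>))) \<in> l2_space lborel"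
    by (rule exp_abs_l2[OF gap_pos])
  show "weight_IM \<tau> \<in> l2_space M" by (rule weight_IM_l2)
  fix s z
  show "norm (line_to_axis \<tau> s z) \<le> norm (complex_of_real (exp (- gap * \<bar>s\<bar>))) * norm (weight_IM \<tau> z)"
  proof (cases "z \<in> IM")
    case True
    then have "Re z = 0" by (simp add: IM_eq)
    with True show ?thesis
      by (simp add: line_to_axis_def weight_IM_def norm_mult norm_exp_eq_Re flip: exp_add)
  qed (simp add: line_to_axis_def)
qed

lemma l2_one_restrict:
  assumes "S \<in> sets borel" "S \<subseteq> {u..v}"
  shows "(\<lambda>_. 1) \<in> l2_space (restrict_space lborel S :: real measure)"
proof
  have "emeasure lborel S \<le> emeasure lborel {u..v}"
    using assms by (intro emeasure_mono) auto
  also have "\<dots> < \<infinity>" by (auto simp: emeasure_lborel_Icc_eq)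
  finally have "emeasure (restrict_space lborel S) (space (restrict_space lborel S)) < \<infinity>"
    using assms by (simp add: emeasure_restrict_space space_restrict_space)
  then have "finite_measure (restrict_space lborel S)"
    by (intro finite_measureI) auto
  then show "integrable (restrict_space lborel S) (\<lambda>_. (norm (1 :: complex))\<^sup>2)"
    by (rule finite_measure.integrable_const)
qed simp

lemma axis_to_interval_dominated:
  assumes S: "S \<in> sets borel" "S \<subseteq> {u..v}"
  shows "dominated_kernel M (restrict_space lborel S) (axis_to_interval \<tau>)"
proof (rule dominated_kernelI)
  show "case_prod (axis_to_interval \<tau>) \<in> borel_measurable (M \<Otimes>\<^sub>M restrict_space lborel S)"
  proof -
    have [measurable]: "fst \<in> borel_measurable (M \<Otimes>\<^sub>M restrict_space lborel S)"
      by (rule measurable_compose[OF measurable_fst, of "\<lambda>z. z"]) simp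
    have [measurable]: "snd \<in> borel_measurable (M \<Otimes>\<^sub>M restrict_space lborel S)"
      by (rule measurable_compose[OF measurable_snd, of "\<lambda>x. x"]) (rule measurable_restrict_space1, simp)
    show ?thesis
      unfolding axis_to_interval_def case_prod_beta by measurable
  qed
  show "(\<lambda>z. (1 / two_pi_i) * weight_IM \<tau> z) \<in> l2_space M"
    by (intro l2_scale weight_IM_l2)
  show "(\<lambda>_. 1) \<in> l2_space (restrict_space lborel S)"
    by (rule l2_one_restrict[OF S])
  fix z x
  show "norm (axis_to_interval \<tau> z x) \<le> norm ((1 / two_pi_i) * weight_IM \<tau> z) * norm (1 :: complex)"
  proof (cases "z \<in> IM")
    case True
    then have "Re z = 0" by (simp add: IM_eq)
    with True show ?thesis
      by (simp add: axis_to_interval_def weight_IM_def norm_mult norm_divide norm_exp_eq_Re)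
  qed (simp add: axis_to_interval_def)
qed

text \<open>The factor exp (- x z) may be unbounded on the curves, but for x in [u, v] it grows at
  most like exp (R |z|), which the quartic decay of the weight absorbs.\<close>

lemma interval_to_curve_dominated:
  assumes S: "S \<in> sets borel" "S \<subseteq> {u..v}"
  shows "dominated_kernel (restrict_space lborel S) M (interval_to_curve \<tau>)"
proof (rule dominated_kernelI)
  show "case_prod (interval_to_curve \<tau>) \<in> borel_measurable (restrict_space lborel S \<Otimes>\<^sub>M M)"
  proof -
    have [measurable]: "snd \<in> borel_measurable (restrict_space lborel S \<Otimes>\<^sub>M M)"
      by (rule measurable_compose[OF measurable_snd, of "\<lambda>z. z"]) simp
    have [measurable]: "fst \<in> borel_measurable (restrict_space lborel S \<Otimes>\<^sub>M M)"
      by (rule measurable_compose[OF measurable_fst, of "\<lambda>x. x"]) (rule measurable_restrict_space1, simp)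
    show ?thesis
      unfolding interval_to_curve_def case_prod_beta by measurable
  qed
  show "(\<lambda>_. 1) \<in> l2_space (restrict_space lborel S)"
    by (rule l2_one_restrict[OF S])
  let ?R = "max \<bar>u\<bar> \<bar>v\<bar>"
  show "weight_LR \<tau> ?R \<in> l2_space M"
    by (rule weight_LR_l2) simp
  fix x z assume "x \<in> space (restrict_space lborel S)"
  then have "u \<le> x" "x \<le> v" using S(2) by (auto simp: space_restrict_space)
  then have x: "\<bar>x\<bar> \<le> ?R" by linarith
  have "- (x * Re z) \<le> \<bar>x\<bar> * \<bar>Re z\<bar>" by (metis abs_ge_minus_self abs_mult)
  also have "\<dots> \<le> ?R * norm z"
    using x by (intro mult_mono abs_Re_le_cmod) auto
  finally show "norm (interval_to_curve \<tau> x z) \<le> norm (1 :: complex) * norm (weight_LR \<tau> ?R z)"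
    by (cases "z \<in> LR") (simp_all add: interval_to_curve_def weight_LR_def norm_mult norm_exp_eq_Re)
qed

text \<open>Since \<mu> lies on the axis, z - \<mu> has the real part of z; so the half line of s
  chosen by the sign of Re z is the one on which exp (- s (z - \<mu>)) decays. The terms with
  \<open>gap\<close> cancel.\<close>

lemma curve_to_axis:
  "kernel_comp lborel (curve_to_line \<tau>) (line_to_axis \<tau>) z \<mu> =
    indicator LR z * indicator IM \<mu> * tangent \<mu> * exp (Theta \<tau> 0 z / 2 - Theta \<tau> 0 \<mu> / 2) / (z - \<mu>) / two_pi_i"
proof (cases "z \<in> LR \<and> \<mu> \<in> IM")
  case False
  then show ?thesis
    by (auto simp: kernel_comp_def curve_to_line_def line_to_axis_def)
next
  case True
  define w where "w = z - \<mu>"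
  have Re_w: "Re w = Re z" using True by (simp add: w_def IM_eq)
  have nz: "Re z \<noteq> 0" using LR_gap[of z] gap_pos True by auto
  define E where "E = tangent \<mu> * exp (Theta \<tau> 0 z / 2 - Theta \<tau> 0 \<mu> / 2) / two_pi_i"
  define \<phi> where "\<phi> s = of_real (if 0 < s * Re z then sgn s else 0) * exp (- of_real s * w)" for s :: real
  have "curve_to_line \<tau> z s * line_to_axis \<tau> s \<mu> = E * \<phi> s" for s
  proof -
    have "exp (Theta \<tau> 0 z / 2 - of_real s * z + of_real (gap * \<bar>s\<bar>)) *
        exp (- Theta \<tau> 0 \<mu> / 2 - of_real (gap * \<bar>s\<bar>) + of_real s * \<mu>) =
        exp (Theta \<tau> 0 z / 2 - Theta \<tau> 0 \<mu> / 2) * exp (- of_real s * w)"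
      unfolding exp_add[symmetric] by (rule arg_cong[of _ _ exp]) (simp add: w_def algebra_simps)
    then show ?thesis
      using True by (simp add: curve_to_line_def line_to_axis_def E_def \<phi>_def mult_ac)
  qed
  then have "kernel_comp lborel (curve_to_line \<tau>) (line_to_axis \<tau>) z \<mu> = E * (\<integral>s. \<phi> s \<partial>lborel)"
    by (simp add: kernel_comp_def)
  also have "(\<integral>s. \<phi> s \<partial>lborel) = 1 / w"
  proof (cases "0 < Re z")
    case True
    then have "\<phi> = (\<lambda>s. indicator {0<..} s *\<^sub>R exp (- of_real s * w))"
      by (auto simp: \<phi>_def fun_eq_iff indicator_def zero_less_mult_iff)
    then show ?thesis using exp_half_line_integral(2)[of w] True Re_w by simp
  next
    case False
    \<comment> \<open>Here the Laplace integral runs over negative s; \<open>sgn s\<close> supplies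
      the sign that turns 1 / (- w) into 1 / w.\<close>
    then have neg: "Re z < 0" using nz by simp
    have "(\<integral>s. \<phi> s \<partial>lborel) = (\<integral>s. \<phi> (0 + (-1) * s) \<partial>lborel)"
      using lborel_integral_real_affine[of "-1" \<phi> 0] by simp
    also have "(\<lambda>s. \<phi> (0 + (-1) * s)) = (\<lambda>s. - (indicator {0<..} s *\<^sub>R exp (- of_real s * (- w))))"
      using neg by (auto simp: \<phi>_def fun_eq_iff indicator_def mult_less_0_iff zero_less_mult_iff)
    also have "(\<integral>s. - (indicator {0<..} s *\<^sub>R exp (- of_real s * (- w))) \<partial>lborel) = - (1 / (- w))"
      using exp_half_line_integral(2)[of "- w"] neg Re_w by (subst Bochner_Integration.integral_minus) simp
    finally show ?thesis by simp
  qed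
  finally show ?thesis
    using True by (simp add: E_def w_def)
qed

lemma axis_to_curve:
  assumes mono: "strict_mono_on {1..2 * N} a"
  shows "kernel_comp (restrict_space lborel (interval_union N a)) (axis_to_interval \<tau>) (interval_to_curve \<tau>) z \<mu> =
    indicator IM z * indicator LR \<mu> * tangent \<mu> / two_pi_i *
    (\<Sum>j\<in>{1..2 * N}. exp (- Theta \<tau> 0 z / 2 + of_real (a j) * z) *
      ((-1) ^ (j + 1) * exp (Theta \<tau> 0 \<mu> / 2 - of_real (a j) * \<mu>))) / (z - \<mu>)"
proof (cases "z \<in> IM \<and> \<mu> \<in> LR")
  case False
  then show ?thesis
    by (auto simp: kernel_comp_def axis_to_interval_def interval_to_curve_def)
next
  case True
  let ?I = "interval_union N a"
  define w where "w = z - \<mu>"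
  have w: "w \<noteq> 0" using True LR_IM_disjoint by (auto simp: w_def)
  define E where "E = tangent \<mu> * exp (- Theta \<tau> 0 z / 2 + Theta \<tau> 0 \<mu> / 2) / two_pi_i"
  have split: "exp (- Theta \<tau> 0 z / 2 + of_real x * z) * exp (Theta \<tau> 0 \<mu> / 2 - of_real x * \<mu>) =
      exp (- Theta \<tau> 0 z / 2 + Theta \<tau> 0 \<mu> / 2) * exp (of_real x * w)" for x :: real
    unfolding exp_add[symmetric] by (rule arg_cong[of _ _ exp]) (simp add: w_def algebra_simps)
  have "axis_to_interval \<tau> z x * interval_to_curve \<tau> x \<mu> = E * - exp (of_real x * w)" for x
  proof -
    have "axis_to_interval \<tau> z x * interval_to_curve \<tau> x \<mu> =
        - (tangent \<mu> / two_pi_i * (exp (- Theta \<tau> 0 z / 2 + of_real x * z) * exp (Theta \<tau> 0 \<mu> / 2 - of_real x * \<mu>)))"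
      using True by (simp add: axis_to_interval_def interval_to_curve_def mult_ac)
    then show ?thesis unfolding split by (simp add: E_def mult_ac)
  qed
  then have "kernel_comp (restrict_space lborel ?I) (axis_to_interval \<tau>) (interval_to_curve \<tau>) z \<mu> =
      E * - (\<integral>x. exp (of_real x * w) \<partial>restrict_space lborel ?I)"
    by (simp add: kernel_comp_def)
  also have "(\<integral>x. exp (of_real x * w) \<partial>restrict_space lborel ?I) = (LINT x:?I|lborel. exp (of_real x * w))"
    unfolding set_lebesgue_integral_def
    by (rule integral_restrict_space) (simp add: interval_union_borel)
  also have "E * - (LINT x:?I|lborel. exp (of_real x * w)) =
      E * ((\<Sum>j\<in>{1..2 * N}. (-1) ^ (j + 1) * exp (of_real (a j) * w)) / w)"
    using integral_exp_interval_union[OF w mono] by simp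
  also have "\<dots> = (\<Sum>j\<in>{1..2 * N}. E * ((-1) ^ (j + 1) * exp (of_real (a j) * w))) / w"
    by (simp only: times_divide_eq_right sum_distrib_left)
  also have "\<dots> = (\<Sum>j\<in>{1..2 * N}. tangent \<mu> / two_pi_i * ((-1) ^ (j + 1) *
      (exp (- Theta \<tau> 0 z / 2 + Theta \<tau> 0 \<mu> / 2) * exp (of_real (a j) * w)))) / w"
    by (simp add: E_def mult_ac)
  also have "\<dots> = tangent \<mu> / two_pi_i * (\<Sum>j\<in>{1..2 * N}. (-1) ^ (j + 1) *
      (exp (- Theta \<tau> 0 z / 2 + Theta \<tau> 0 \<mu> / 2) * exp (of_real (a j) * w))) / w"
    by (simp only: sum_distrib_left)
  also have "\<dots> = tangent \<mu> / two_pi_i * (\<Sum>j\<in>{1..2 * N}. exp (- Theta \<tau> 0 z / 2 + of_real (a j) * z) *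
      ((-1) ^ (j + 1) * exp (Theta \<tau> 0 \<mu> / 2 - of_real (a j) * \<mu>))) / w"
    unfolding split[symmetric] by (simp only: mult_ac)
  finally show ?thesis
    using True by (simp add: w_def)
qed

text \<open>For \<mu> on the curves component 0 of \<open>g_vec\<close> vanishes, and the other
  components of \<open>f_vec\<close> live on the axis: only the block from the curves to the axis is
  seen.\<close>

lemma tilde_kernel_LR:
  assumes mono: "strict_mono_on {1..2 * N} a"
  shows "indicator LR \<mu> * tangent \<mu> * tilde_kernel N a \<tau> \<gamma> z \<mu> =
    kernel_comp (restrict_space lborel (interval_union N a)) (axis_to_interval \<tau>) (interval_to_curve \<tau>) z \<mu>"
proof (cases "\<mu> \<in> LR")
  case True
  then have \<mu>: "\<mu> \<notin> IM" by (rule LR_IM_disjoint)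
  have sum: "(\<Sum>j\<le>2 * N. f_vec a \<tau> \<gamma> z j * g_vec a \<tau> \<gamma> \<mu> j) =
      (\<Sum>j\<in>{1..2 * N}. f_vec a \<tau> \<gamma> z j * g_vec a \<tau> \<gamma> \<mu> j)"
    using True \<mu> by (intro sum.mono_neutral_right) (auto simp: g_vec_def not_le)
  also have "\<dots> = (\<Sum>j\<in>{1..2 * N}. indicator IM z / two_pi_i *
      (exp (- Theta \<tau> 0 z / 2 + of_real (a j) * z) * ((-1) ^ (j + 1) * exp (Theta \<tau> 0 \<mu> / 2 - of_real (a j) * \<mu>))))"
    using True \<mu> by (intro sum.cong) (auto simp: f_vec_def g_vec_def)
  also have "\<dots> = indicator IM z / two_pi_i * (\<Sum>j\<in>{1..2 * N}.
      exp (- Theta \<tau> 0 z / 2 + of_real (a j) * z) * ((-1) ^ (j + 1) * exp (Theta \<tau> 0 \<mu> / 2 - of_real (a j) * \<mu>)))"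
    by (rule sum_distrib_left[symmetric])
  finally show ?thesis
    unfolding axis_to_curve[OF mono] tilde_kernel_def using True by simp
qed (simp add: axis_to_curve[OF mono])

text \<open>The complementary block: for \<mu> on the axis only component 0 of \<open>g_vec\<close>
  survives, and component 0 of \<open>f_vec\<close> lives on the curves.\<close>

lemma tilde_kernel_IM:
  "indicator IM \<mu> * tangent \<mu> * tilde_kernel N a \<tau> \<gamma> z \<mu> =
    kernel_comp lborel (curve_to_line \<tau>) (line_to_axis \<tau>) z \<mu>"
proof (cases "\<mu> \<in> IM")
  case True
  then have \<mu>: "\<mu> \<notin> LR" using LR_IM_disjoint by blast
  have "(\<Sum>j\<le>2 * N. f_vec a \<tau> \<gamma> z j * g_vec a \<tau> \<gamma> \<mu> j) =
      (\<Sum>j\<in>{0}. f_vec a \<tau> \<gamma> z j * g_vec a \<tau> \<gamma> \<mu> j)"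
    using True \<mu> by (intro sum.mono_neutral_right) (auto simp: g_vec_def)
  also have "\<dots> = indicator LR z * exp (Theta \<tau> 0 z / 2 - Theta \<tau> 0 \<mu> / 2) / two_pi_i"
    using True \<mu> by (cases "z \<in> LR") (simp_all add: f_vec_def g_vec_def flip: exp_add)
  finally show ?thesis
    unfolding curve_to_axis tilde_kernel_def using True by (simp add: mult_ac)
qed (simp add: curve_to_axis)

text \<open>Composed as b (P1 Q1) p, the middle factor contains the Cauchy kernel, and the half
  exponents of neighbouring factors add up to the full ones of the Pearcey kernel. Associativity
  then regroups the product as (b P1) (Q1 p).\<close>

lemma pearcey_kernel_eq:
  assumes S: "S \<in> sets borel" "S \<subseteq> {u..v}" and x: "x \<in> S" and y: "y \<in> S"
  shows "pearcey_kernel \<tau> \<gamma> x y = kernel_comp lborel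
    (kernel_comp M (interval_to_curve \<tau>) (curve_to_line \<tau>))
    (kernel_comp M (line_to_axis \<tau>) (axis_to_interval \<tau>)) x y"
proof -
  let ?Y = "restrict_space lborel S"
  note sf = sigma_finite_M lborel.sigma_finite_measure_axioms
  note b = interval_to_curve_dominated[OF S, of \<tau>] and p = axis_to_interval_dominated[OF S, of \<tau>]
  note P = curve_to_line_dominated[of \<tau>] and Q = line_to_axis_dominated[of \<tau>]
  let ?PQ = "kernel_comp lborel (curve_to_line \<tau>) (line_to_axis \<tau>)"
  have PQ: "dominated_kernel M M ?PQ"
    by (rule dominated_kernel_comp[OF sf(2) P Q])
  have PQp: "dominated_kernel M ?Y (kernel_comp M ?PQ (axis_to_interval \<tau>))"
    by (rule dominated_kernel_comp[OF sf(1) PQ p])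
  have xy: "x \<in> space ?Y" "y \<in> space ?Y" using x y by (auto simp: space_restrict_space)
  let ?F = "\<lambda>\<mu> l. exp (Theta \<tau> x \<mu> - Theta \<tau> y l) / (l - \<mu>)"
  have section_y: "(\<lambda>l. axis_to_interval \<tau> l y) \<in> l2_space M"
    using l2_cnj[OF kernel_section_l2[OF dominated_kernel_adjoint[OF p] xy(2)]] by simp
  have section_PQp: "(\<lambda>\<mu>. kernel_comp M ?PQ (axis_to_interval \<tau>) \<mu> y) \<in> l2_space M"
    using l2_cnj[OF kernel_section_l2[OF dominated_kernel_adjoint[OF PQp] xy(2)]] by simp
  have Theta: "Theta \<tau> t z = Theta \<tau> 0 z - of_real t * z" for t z
    by (simp add: Theta_def)
  have inner_eq: "interval_to_curve \<tau> x \<mu> * (?PQ \<mu> l * axis_to_interval \<tau> l y) =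
      indicator LR \<mu> * tangent \<mu> * (indicator IM l * tangent l * ?F \<mu> l / two_pi_i\<^sup>2)" for \<mu> l
  proof (cases "\<mu> \<in> LR \<and> l \<in> IM")
    case False
    then show ?thesis by (auto simp: interval_to_curve_def axis_to_interval_def)
  next
    case True
    have e: "exp (Theta \<tau> 0 \<mu> / 2 - of_real x * \<mu>) * (exp (Theta \<tau> 0 \<mu> / 2 - Theta \<tau> 0 l / 2) *
        exp (- Theta \<tau> 0 l / 2 + of_real y * l)) = exp (Theta \<tau> x \<mu> - Theta \<tau> y l)"
      unfolding exp_add[symmetric] by (rule arg_cong[of _ _ exp]) (simp add: Theta[of x] Theta[of y])
    have neg: "1 / (l - \<mu>) = - (1 / (\<mu> - l))"
      by (metis minus_diff_eq minus_divide_right)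
    have "interval_to_curve \<tau> x \<mu> * (?PQ \<mu> l * axis_to_interval \<tau> l y) =
      tangent \<mu> * tangent l * (exp (Theta \<tau> 0 \<mu> / 2 - of_real x * \<mu>) * (exp (Theta \<tau> 0 \<mu> / 2 - Theta \<tau> 0 l / 2) *
        exp (- Theta \<tau> 0 l / 2 + of_real y * l))) * (- (1 / (\<mu> - l))) / two_pi_i\<^sup>2"
      unfolding curve_to_axis using True
      by (simp add: interval_to_curve_def axis_to_interval_def power2_eq_square mult_ac)
    also have "\<dots> = tangent \<mu> * tangent l * (?F \<mu> l / two_pi_i\<^sup>2)"
      unfolding e neg[symmetric] by simp
    finally show ?thesis using True by simp
  qed
  have inner: "indicator LR \<mu> * tangent \<mu> * line_integral [imaginary_axis] (?F \<mu>) =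
      two_pi_i\<^sup>2 * (interval_to_curve \<tau> x \<mu> * kernel_comp M ?PQ (axis_to_interval \<tau>) \<mu> y)" for \<mu>
  proof (cases "\<mu> \<in> LR")
    case True
    have pi: "two_pi_i\<^sup>2 \<noteq> 0" by simp
    have tn: "tangent \<mu> \<noteq> 0" using norm_tangent[of \<mu>] by (metis norm_zero zero_neq_one)
    \<comment> \<open>The tangent has modulus 1 and can be divided out. The inner integrand becomes
      a constant times a product of two square integrable sections, which gives the integrability
      that \<open>line_integral_IM\<close> asks for.\<close>
    define c where "c = two_pi_i\<^sup>2 * interval_to_curve \<tau> x \<mu> / tangent \<mu>"
    have pt: "indicator IM l * tangent l * ?F \<mu> l = c * (?PQ \<mu> l * axis_to_interval \<tau> l y)" for l
    proof -
      have "c * (?PQ \<mu> l * axis_to_interval \<tau> l y) = two_pi_i\<^sup>2 / tangent \<mu> *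
          (interval_to_curve \<tau> x \<mu> * (?PQ \<mu> l * axis_to_interval \<tau> l y))"
        by (simp add: c_def)
      also have "\<dots> = indicator IM l * tangent l * ?F \<mu> l"
        unfolding inner_eq using True pi tn by simp
      finally show ?thesis by simp
    qed
    have "integrable M (\<lambda>l. indicator IM l * tangent l * ?F \<mu> l)"
      unfolding pt by (intro integrable_mult_right l2_integrable_mult kernel_section_l2[OF PQ] section_y) simp
    from line_integral_IM[OF this]
    have "line_integral [imaginary_axis] (?F \<mu>) = (\<integral>l. c * (?PQ \<mu> l * axis_to_interval \<tau> l y) \<partial>M)"
      unfolding pt .
    then have "line_integral [imaginary_axis] (?F \<mu>) = c * kernel_comp M ?PQ (axis_to_interval \<tau>) \<mu> y"
      by (simp only: integral_mult_right_zero kernel_comp_def[of M])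
    then show ?thesis using True tn by (simp add: c_def)
  qed (simp add: interval_to_curve_def)
  have "integrable M (\<lambda>\<mu>. indicator LR \<mu> * tangent \<mu> * line_integral [imaginary_axis] (?F \<mu>))"
    unfolding inner
    by (intro integrable_mult_right l2_integrable_mult kernel_section_l2[OF b xy(1)] section_PQp)
  then have "line_integral (left_right \<gamma>) (\<lambda>\<mu>. line_integral [imaginary_axis] (?F \<mu>)) =
      two_pi_i\<^sup>2 * kernel_comp M (interval_to_curve \<tau>) (kernel_comp M ?PQ (axis_to_interval \<tau>)) x y"
    unfolding kernel_comp_def[of M "interval_to_curve \<tau>"] by (subst line_integral_LR) (simp_all add: inner)
  then have "pearcey_kernel \<tau> \<gamma> x y =
      kernel_comp M (interval_to_curve \<tau>) (kernel_comp M ?PQ (axis_to_interval \<tau>)) x y"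
    unfolding pearcey_kernel_def by simp
  also have "\<dots> = kernel_comp M (interval_to_curve \<tau>)
      (kernel_comp lborel (curve_to_line \<tau>) (kernel_comp M (line_to_axis \<tau>) (axis_to_interval \<tau>))) x y"
    unfolding kernel_comp_def[of M "interval_to_curve \<tau>"]
    by (intro Bochner_Integration.integral_cong refl arg_cong2[of _ _ _ _ "(*)"]
        kernel_comp_assoc[OF sf(2,1) P Q p _ xy(2)])
  also have "\<dots> = kernel_comp lborel (kernel_comp M (interval_to_curve \<tau>) (curve_to_line \<tau>))
      (kernel_comp M (line_to_axis \<tau>) (axis_to_interval \<tau>)) x y"
    by (rule kernel_comp_assoc[OF sf(1,2) b P dominated_kernel_comp[OF sf(1) Q p] xy, symmetric])
  finally show ?thesis .
qed

text \<open>On the curves and on the axis, respectively, one of the two blocks is all of the kernel;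
  the tangents inside the factors convert line elements to arc length.\<close>

lemma tilde_operator_eq:
  assumes mono: "strict_mono_on {1..2 * N} a" and h: "h \<in> l2_space M"
  shows "tilde_operator N a \<tau> \<gamma> h z = kernel_op M
    (\<lambda>z \<mu>. kernel_comp lborel (curve_to_line \<tau>) (line_to_axis \<tau>) z \<mu> +
      kernel_comp (restrict_space lborel (interval_union N a)) (axis_to_interval \<tau>) (interval_to_curve \<tau>) z \<mu>) h z"
proof -
  let ?I = "interval_union N a"
  have S: "?I \<in> sets borel" "?I \<subseteq> {a 1..a (2 * N)}"
    using interval_union_subset[OF mono] by (auto simp: interval_union_borel)
  let ?Y = "restrict_space lborel ?I"
  have sf: "sigma_finite_measure ?Y"
    using S by (intro sigma_finite_measure_restrict_space lborel.sigma_finite_measure_axioms) auto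
  let ?k1 = "kernel_comp lborel (curve_to_line \<tau>) (line_to_axis \<tau>)"
  let ?k2 = "kernel_comp ?Y (axis_to_interval \<tau>) (interval_to_curve \<tau>)"
  have k1: "dominated_kernel M M ?k1"
    by (rule dominated_kernel_comp[OF lborel.sigma_finite_measure_axioms curve_to_line_dominated line_to_axis_dominated])
  have k2: "dominated_kernel M M ?k2"
    by (rule dominated_kernel_comp[OF sf axis_to_interval_dominated[OF S] interval_to_curve_dominated[OF S]])
  have i1: "integrable M (\<lambda>\<mu>. ?k1 z \<mu> * h \<mu>)" and i2: "integrable M (\<lambda>\<mu>. ?k2 z \<mu> * h \<mu>)"
    using h by (auto intro!: l2_integrable_mult kernel_section_l2[OF k1] kernel_section_l2[OF k2])
  let ?F = "\<lambda>\<mu>. tilde_kernel N a \<tau> \<gamma> z \<mu> * h \<mu>"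
  have F2: "indicator LR \<mu> * tangent \<mu> * ?F \<mu> = ?k2 z \<mu> * h \<mu>" for \<mu>
    unfolding tilde_kernel_LR[OF mono, symmetric] by (simp add: mult.assoc)
  have F1: "indicator IM \<mu> * tangent \<mu> * ?F \<mu> = ?k1 z \<mu> * h \<mu>" for \<mu>
    unfolding tilde_kernel_IM[of \<mu> N a \<tau> z, symmetric] by (simp add: mult.assoc)
  have "tilde_operator N a \<tau> \<gamma> h z = line_integral (left_right \<gamma>) ?F + line_integral [imaginary_axis] ?F"
    by (simp add: tilde_operator_def full_contour_def line_integral_def)
  also have "\<dots> = (\<integral>\<mu>. ?k2 z \<mu> * h \<mu> \<partial>M) + (\<integral>\<mu>. ?k1 z \<mu> * h \<mu> \<partial>M)"
    using i1 i2 by (subst line_integral_LR line_integral_IM, simp only: F1 F2)+ (simp only: F1 F2)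
  also have "\<dots> = (\<integral>\<mu>. ?k1 z \<mu> * h \<mu> + ?k2 z \<mu> * h \<mu> \<partial>M)"
    using i1 i2 by (simp add: add.commute)
  finally show ?thesis by (simp add: kernel_op_def distrib_right)
qed

end

theorem theorem4p1:
  fixes N :: nat and a :: "nat \<Rightarrow> real" and \<tau> :: real and \<gamma> :: "real \<Rightarrow> complex"
  assumes "N \<ge> 1"
    and "strict_mono_on {1..2 * N} a"
    and "right_contour \<gamma>"
  shows "trace_class (arc_length (full_contour \<gamma>)) (tilde_operator N a \<tau> \<gamma>) \<and>
    fredholm_det (arc_length (full_contour \<gamma>)) (tilde_operator N a \<tau> \<gamma>) =
    fredholm_det (restrict_space lborel (interval_union N a))
      (pearcey_operator \<tau> \<gamma> (interval_union N a))"
proof -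
  interpret pearcey_contour \<gamma> by unfold_locales (rule assms(3))
  let ?I = "interval_union N a"
  let ?Y = "restrict_space lborel ?I"
  have S: "?I \<in> sets borel" "?I \<subseteq> {a 1..a (2 * N)}"
    using interval_union_subset[OF assms(2)] by (auto simp: interval_union_borel)
  have sf: "sigma_finite_measure ?Y"
    using S by (intro sigma_finite_measure_restrict_space lborel.sigma_finite_measure_axioms) auto
  have z1: "kernel_comp M (line_to_axis \<tau>) (curve_to_line \<tau>) s s' = 0" for s s'
  proof -
    have "line_to_axis \<tau> s z * curve_to_line \<tau> z s' = 0" for z
      using LR_IM_disjoint[of z] by (auto simp: line_to_axis_def curve_to_line_def indicator_def)
    then show ?thesis by (simp only: kernel_comp_def integral_zero)
  qed
  have z2: "kernel_comp M (interval_to_curve \<tau>) (axis_to_interval \<tau>) x x' = 0" for x x'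
  proof -
    have "interval_to_curve \<tau> x z * axis_to_interval \<tau> z x' = 0" for z
      using LR_IM_disjoint[of z] by (auto simp: interval_to_curve_def axis_to_interval_def indicator_def)
    then show ?thesis by (simp only: kernel_comp_def integral_zero)
  qed
  have L: "pearcey_operator \<tau> \<gamma> ?I h x = kernel_op ?Y (kernel_comp lborel
      (kernel_comp M (interval_to_curve \<tau>) (curve_to_line \<tau>))
      (kernel_comp M (line_to_axis \<tau>) (axis_to_interval \<tau>))) h x" if "x \<in> space ?Y" for h x
    unfolding pearcey_operator_def kernel_op_def
    using that by (intro Bochner_Integration.integral_cong refl)
      (simp add: pearcey_kernel_eq[OF S] space_restrict_space)
  \<comment> \<open>X is the contour, S the real line of the Laplace variable and Y the union of the
    intervals.\<close>
  note * = fredholm_det_cyclic[OF sigma_finite_M lborel.sigma_finite_measure_axioms sf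
      curve_to_line_dominated line_to_axis_dominated axis_to_interval_dominated[OF S]
      interval_to_curve_dominated[OF S] z1 z2 exists_basis_M exists_basis_lborel
      exists_basis_interval_union[OF assms(1,2)] tilde_operator_eq[OF assms(2)] L]
  show ?thesis using * by blast
qed

end
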